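(* Let $G$ be a locally compact abelian group, $\mathcal A=(A_i)_{i\in I}$ a van Hove net in $G$, $\mu$ a translation bounded measure on $G$ whose autocorrelation $\gamma_\mu$ exists with respect to $\mathcal A$, and $\chi\in\widehat G$. If $$\lim_i\frac1{|A_i|}\int_{A_i}\overline{\chi(t)}\,d\mu(t)=0$$ does not hold, then $\widehat{\gamma_\mu}(\{\chi\})\ne0$.
   Context: $G$ is written additively with neutral element $0$; a Haar measure is fixed, $|A|$ is the Haar measure of $A$. $\widehat G$ is the group of continuous homomorphisms $\xi:G\to\mathbb T$ ($\mathbb T$ = unit circle), with its usual locally compact topology. $C_c(G)$ is the space of compactly supported continuous complex functions. A measure on $G$ is a linear functional $\mu:C_c(G)\to\mathbb C$ such that for each compact $K\subseteq G$ there is $C_K\ge0$ with $|\mu(\varphi)|\le C_K\|\varphi\|_\infty$ for all $\varphi\in C_c(G)$ supported in $K$; $|\mu|$ is its total variation, $\mu|_A$ its restriction to a Borel set $A$. $\mu$ is translation bounded if $\sup_{t\in G}|\mu|(t+V)<\infty$ for one (equivalently every) nonempty open $V$ with compact closure. $\tilde\varphi(x)=\overline{\varphi(-x)}$, $\tilde\mu(\varphi)=\overline{\mu(\tilde\varphi)}$. For finite measures, $(\mu*\nu)(\varphi)=\int\int\varphi(s+t)\,d\mu(s)\,d\nu(t)$. For $\varphi\in C_c(G)$, $(\mu*\varphi)(t)=\int_G\varphi(t-s)\,d\mu(s)$. For compact $K$, $\partial^KA:=(\overline{A+K}\setminus A)\cup(((G\setminus A)-K)\cap\overline A)$. A van Hove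 net is a net $\mathcal A=(A_i)_{i\in I}$ of open subsets of $G$ with compact closure (with $|A_i|>0$) such that $\lim_i|\partial^KA_i|/|A_i|=0$ for every compact $K\subseteq G$. The autocorrelation $\gamma_\mu$ of $\mu$ with respect to $\mathcal A$ is the vague limit (pointwise on $C_c(G)$) of $\frac1{|A_i|}\,\mu|_{A_i}*\widetilde{\mu|_{A_i}}$, if it exists; it is positive definite, and $\widehat{\gamma_\mu}$ is the unique positive measure on $\widehat G$ with $\gamma_\mu*\varphi*\tilde\varphi(0)=\int_{\widehat G}|\widehat\varphi|^2\,d\widehat{\gamma_\mu}$ for all $\varphi\in C_c(G)$, where $\widehat\varphi(\xi)=\int_G\overline{\xi(t)}\varphi(t)\,dt$. "The limit equals $0$ does not hold" includes the case that the limit does not exist. *)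

theory Defs
  imports "HOL-Analysis.Analysis"
begin

definition Cc :: "('a::topological_space \<Rightarrow> complex) set" where
  "Cc = {\<phi>. continuous_on UNIV \<phi> \<and> compact (closure {x. \<phi> x \<noteq> 0})}"

text \<open>Functionals are total HOL functions; only their values on \<open>Cc\<close> matter.\<close>

definition radon_functional :: "(('a::topological_space \<Rightarrow> complex) \<Rightarrow> complex) \<Rightarrow> bool" where
  "radon_functional \<mu> \<longleftrightarrow>
     (\<forall>\<phi>\<in>Cc. \<forall>\<psi>\<in>Cc. \<mu> (\<lambda>x. \<phi> x + \<psi> x) = \<mu> \<phi> + \<mu> \<psi>) \<and>
     (\<forall>\<phi>\<in>Cc. \<forall>c. \<mu> (\<lambda>x. c * \<phi> x) = c * \<mu> \<phi>) \<and>
     (\<forall>K. compact K \<longrightarrow> (\<exists>C\<ge>0. \<forall>\<phi>\<in>Cc. closure {x. \<phi> x \<noteq> 0} \<subseteq> K \<longrightarrow>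
        norm (\<mu> \<phi>) \<le> C * (SUP x. norm (\<phi> x))))"

definition positive_functional :: "(('a::topological_space \<Rightarrow> complex) \<Rightarrow> complex) \<Rightarrow> bool" where
  "positive_functional \<mu> \<longleftrightarrow>
     (\<forall>\<phi>\<in>Cc. (\<forall>x. \<phi> x \<in> \<real> \<and> 0 \<le> Re (\<phi> x)) \<longrightarrow> \<mu> \<phi> \<in> \<real> \<and> 0 \<le> Re (\<mu> \<phi>))"

text \<open>
  Bourbaki's extension of a measure from \<open>Cc\<close> to the integrable functions.
  \<open>upper_variation \<mu> f\<close> is the upper integral of \<open>f\<close> with respect to the total variation
  \<open>\<bar>\<mu>\<bar>\<close>. On a lower semicontinuous \<open>g\<close> it is the supremum over \<open>h \<in> Cc\<close>, \<open>0 \<le> h \<le> g\<close>, of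
  \<open>\<bar>\<mu>\<bar>(h) = sup {\<bar>\<mu>(\<phi>)\<bar> : \<phi> \<in> Cc, \<bar>\<phi>\<bar> \<le> h}\<close>; the two suprema are merged below, since
  \<open>h = \<bar>\<phi>\<bar>\<close> is admissible.
\<close>

definition lower_semicontinuous :: "('a::topological_space \<Rightarrow> ennreal) \<Rightarrow> bool" where
  "lower_semicontinuous g \<longleftrightarrow> (\<forall>a. open {x. a < g x})"

definition variation_lsc ::
  "(('a::topological_space \<Rightarrow> complex) \<Rightarrow> complex) \<Rightarrow> ('a \<Rightarrow> ennreal) \<Rightarrow> ennreal" where
  "variation_lsc \<mu> g = (SUP \<phi> \<in> {\<phi>\<in>Cc. \<forall>x. ennreal (norm (\<phi> x)) \<le> g x}. ennreal (norm (\<mu> \<phi>)))"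

definition upper_variation ::
  "(('a::topological_space \<Rightarrow> complex) \<Rightarrow> complex) \<Rightarrow> ('a \<Rightarrow> ennreal) \<Rightarrow> ennreal" where
  "upper_variation \<mu> f =
     (INF g \<in> {g. lower_semicontinuous g \<and> (\<forall>x. f x \<le> g x)}. variation_lsc \<mu> g)"

definition total_variation ::
  "(('a::topological_space \<Rightarrow> complex) \<Rightarrow> complex) \<Rightarrow> 'a set \<Rightarrow> ennreal" where
  "total_variation \<mu> B = upper_variation \<mu> (indicator B)"

text \<open>
  \<open>f\<close> is integrable iff it lies in the closure of \<open>Cc\<close> for the seminorm \<open>\<bar>\<mu>\<bar>\<^sup>*(\<bar>f\<bar>)\<close>, and its
  integral is given by continuous extension of \<open>\<mu>\<close>.
\<close>

definition radon_has_integral ::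
  "(('a::topological_space \<Rightarrow> complex) \<Rightarrow> complex) \<Rightarrow> ('a \<Rightarrow> complex) \<Rightarrow> complex \<Rightarrow> bool" where
  "radon_has_integral \<mu> f c \<longleftrightarrow>
     (\<forall>\<epsilon>>0. \<exists>\<phi>\<in>Cc. upper_variation \<mu> (\<lambda>x. ennreal (norm (f x - \<phi> x))) < ennreal \<epsilon> \<and>
        norm (\<mu> \<phi> - c) < \<epsilon>)"

definition radon_integral ::
  "(('a::topological_space \<Rightarrow> complex) \<Rightarrow> complex) \<Rightarrow> ('a \<Rightarrow> complex) \<Rightarrow> complex" where
  "radon_integral \<mu> f = (THE c. radon_has_integral \<mu> f c)"

definition measure_of_set ::
  "(('a::topological_space \<Rightarrow> complex) \<Rightarrow> complex) \<Rightarrow> 'a set \<Rightarrow> complex" where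
  "measure_of_set \<mu> B = radon_integral \<mu> (indicator B)"

definition restrict_functional ::
  "(('a::topological_space \<Rightarrow> complex) \<Rightarrow> complex) \<Rightarrow> 'a set \<Rightarrow> (('a \<Rightarrow> complex) \<Rightarrow> complex)" where
  "restrict_functional \<mu> B = (\<lambda>\<phi>. radon_integral \<mu> (\<lambda>x. indicator B x * \<phi> x))"

definition translation_bounded ::
  "(('a::topological_ab_group_add \<Rightarrow> complex) \<Rightarrow> complex) \<Rightarrow> bool" where
  "translation_bounded \<mu> \<longleftrightarrow>
     (\<exists>V. open V \<and> V \<noteq> {} \<and> compact (closure V) \<and>
        (SUP t. total_variation \<mu> ((\<lambda>x. t + x) ` V)) < \<infinity>)"

definition tilde_fun :: "('a::ab_group_add \<Rightarrow> complex) \<Rightarrow> 'a \<Rightarrow> complex" where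
  "tilde_fun \<phi> = (\<lambda>x. cnj (\<phi> (- x)))"

definition tilde_functional ::
  "(('a::ab_group_add \<Rightarrow> complex) \<Rightarrow> complex) \<Rightarrow> (('a \<Rightarrow> complex) \<Rightarrow> complex)" where
  "tilde_functional \<mu> = (\<lambda>\<phi>. cnj (\<mu> (tilde_fun \<phi>)))"

definition conv_functional ::
  "(('a::topological_ab_group_add \<Rightarrow> complex) \<Rightarrow> complex) \<Rightarrow> (('a \<Rightarrow> complex) \<Rightarrow> complex) \<Rightarrow>
   (('a \<Rightarrow> complex) \<Rightarrow> complex)" where
  "conv_functional \<mu> \<nu> = (\<lambda>\<phi>. radon_integral \<nu> (\<lambda>t. radon_integral \<mu> (\<lambda>s. \<phi> (s + t))))"

definition conv_functional_fun ::
  "(('a::ab_group_add \<Rightarrow> complex) \<Rightarrow> complex) \<Rightarrow> ('a \<Rightarrow> complex) \<Rightarrow> 'a \<Rightarrow> complex" where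
  "conv_functional_fun \<mu> \<phi> = (\<lambda>t. \<mu> (\<lambda>s. \<phi> (t - s)))"

definition haar_measure :: "'a::topological_ab_group_add measure \<Rightarrow> bool" where
  "haar_measure H \<longleftrightarrow>
     sets H = sets borel \<and>
     emeasure H UNIV \<noteq> 0 \<and>
     (\<forall>K. compact K \<longrightarrow> emeasure H K < \<infinity>) \<and>
     (\<forall>t. \<forall>B\<in>sets borel. emeasure H ((\<lambda>x. t + x) ` B) = emeasure H B) \<and>
     (\<forall>B\<in>sets borel. emeasure H B = (INF U \<in> {U. open U \<and> B \<subseteq> U}. emeasure H U)) \<and>
     (\<forall>U. open U \<longrightarrow> emeasure H U = (SUP K \<in> {K. compact K \<and> K \<subseteq> U}. emeasure H K))"

definition conv_fun ::
  "'a::ab_group_add measure \<Rightarrow> ('a \<Rightarrow> complex) \<Rightarrow> ('a \<Rightarrow> complex) \<Rightarrow> 'a \<Rightarrow> complex" where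
  "conv_fun H f g = (\<lambda>t. \<integral>s. f (t - s) * g s \<partial>H)"

typedef (overloaded) ('a::topological_ab_group_add) dual =
  "{\<xi> :: 'a \<Rightarrow> complex. continuous_on UNIV \<xi> \<and> (\<forall>x. norm (\<xi> x) = 1) \<and>
      (\<forall>x y. \<xi> (x + y) = \<xi> x * \<xi> y)}"
  morphisms char_apply Abs_dual
  by (rule exI[of _ "\<lambda>_. 1"]) simp

text \<open>The compact-open topology.\<close>

instantiation dual :: (topological_ab_group_add) topological_space
begin

definition open_dual :: "'a dual set \<Rightarrow> bool" where
  "open_dual = generate_topology
     {{\<xi>. char_apply \<xi> ` K \<subseteq> U} | K U. compact K \<and> open U}"

instance
  by standard (auto simp: open_dual_def intro: generate_topology.intros)

end

definition fourier ::
  "'a::topological_ab_group_add measure \<Rightarrow> ('a \<Rightarrow> complex) \<Rightarrow> 'a dual \<Rightarrow> complex" where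
  "fourier H \<phi> \<xi> = (\<integral>t. cnj (char_apply \<xi> t) * \<phi> t \<partial>H)"

text \<open>
  \<open>\<nu>\<close> is the Fourier transform of \<open>\<gamma>\<close>. For positive definite \<open>\<gamma>\<close> on a locally compact group
  such a \<open>\<nu>\<close> exists and is unique.
\<close>

definition is_fourier_transform ::
  "'a::topological_ab_group_add measure \<Rightarrow> (('a \<Rightarrow> complex) \<Rightarrow> complex) \<Rightarrow>
   (('a dual \<Rightarrow> complex) \<Rightarrow> complex) \<Rightarrow> bool" where
  "is_fourier_transform H \<gamma> \<nu> \<longleftrightarrow>
     radon_functional \<nu> \<and> positive_functional \<nu> \<and>
     (\<forall>\<phi>\<in>Cc. radon_has_integral \<nu> (\<lambda>\<xi>. of_real ((norm (fourier H \<phi> \<xi>))\<^sup>2))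
        (conv_fun H (conv_functional_fun \<gamma> \<phi>) (tilde_fun \<phi>) 0))"

definition directed_index_set :: "'i set \<Rightarrow> ('i \<Rightarrow> 'i \<Rightarrow> bool) \<Rightarrow> bool" where
  "directed_index_set I le \<longleftrightarrow>
     I \<noteq> {} \<and> (\<forall>i\<in>I. le i i) \<and>
     (\<forall>i\<in>I. \<forall>j\<in>I. \<forall>k\<in>I. le i j \<longrightarrow> le j k \<longrightarrow> le i k) \<and>
     (\<forall>i\<in>I. \<forall>j\<in>I. \<exists>k\<in>I. le i k \<and> le j k)"

definition net_filter :: "'i set \<Rightarrow> ('i \<Rightarrow> 'i \<Rightarrow> bool) \<Rightarrow> 'i filter" where
  "net_filter I le = (INF i\<in>I. principal {j\<in>I. le i j})"

definition van_hove_boundary :: "'a::topological_ab_group_add set \<Rightarrow> 'a set \<Rightarrow> 'a set" where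
  "van_hove_boundary K A =
     (closure {a + k | a k. a \<in> A \<and> k \<in> K} - A) \<union>
     ({b - k | b k. b \<in> - A \<and> k \<in> K} \<inter> closure A)"

definition van_hove_net ::
  "'a::topological_ab_group_add measure \<Rightarrow> 'i set \<Rightarrow> ('i \<Rightarrow> 'i \<Rightarrow> bool) \<Rightarrow> ('i \<Rightarrow> 'a set) \<Rightarrow> bool" where
  "van_hove_net H I le A \<longleftrightarrow>
     directed_index_set I le \<and>
     (\<forall>i\<in>I. open (A i) \<and> compact (closure (A i)) \<and> 0 < emeasure H (A i)) \<and>
     (\<forall>K. compact K \<longrightarrow>
        ((\<lambda>i. measure H (van_hove_boundary K (A i)) / measure H (A i)) \<longlongrightarrow> 0) (net_filter I le))"

definition is_autocorrelation ::
  "'a::topological_ab_group_add measure \<Rightarrow> 'i set \<Rightarrow> ('i \<Rightarrow> 'i \<Rightarrow> bool) \<Rightarrow> ('i \<Rightarrow> 'a set) \<Rightarrow>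
   (('a \<Rightarrow> complex) \<Rightarrow> complex) \<Rightarrow> (('a \<Rightarrow> complex) \<Rightarrow> complex) \<Rightarrow> bool" where
  "is_autocorrelation H I le A \<mu> \<gamma> \<longleftrightarrow>
     radon_functional \<gamma> \<and>
     (\<forall>\<phi>\<in>Cc. ((\<lambda>i. of_real (1 / measure H (A i)) *
          conv_functional (restrict_functional \<mu> (A i))
            (tilde_functional (restrict_functional \<mu> (A i))) \<phi>) \<longlongrightarrow> \<gamma> \<phi>) (net_filter I le))"

end

theory Submission
  imports Defs
begin

text \<open>
  Write \<open>\<mu>\<^sub>i\<close> for the restriction of \<open>\<mu>\<close> to \<open>A i\<close>, \<open>a\<^sub>i\<close> for the average of \<open>cnj \<xi>\<close> over \<open>A i\<close> with
  respect to \<open>\<mu>\<close>, and \<open>\<phi>\<^sup>\<and>\<close> for the Fourier transform of \<open>\<phi> \<in> Cc\<close>. The proof compares \<open>a\<^sub>i\<close> with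
  \<open>\<gamma>_hat\<close> by smoothing: \<open>f\<^sub>i = \<mu>\<^sub>i * \<phi>\<close> is a continuous function supported in \<open>closure (A i) + L\<close>,
  where \<open>L\<close> carries \<open>\<phi>\<close>, and the Cauchy--Schwarz inequality bounds \<open>\<bar>\<integral> cnj \<xi> f\<^sub>i\<bar>\<^sup>2\<close> by
  \<open>\<integral>\<bar>f\<^sub>i\<bar>\<^sup>2\<close> times the Haar measure of \<open>closure (A i) + L\<close>. The first integral equals
  \<open>\<phi>\<^sup>\<and>(\<xi>) |A i| a\<^sub>i\<close> (\<open>fourier_convolution\<close>). The second one is the value of \<open>\<mu>\<^sub>i\<close> convolved with its
  reflected conjugate at the correlation of \<open>\<phi>\<close> with itself (\<open>conv_tilde_correlation\<close>), so that divided by \<open>|A i|\<close>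
  it converges to \<open>\<gamma> * \<phi> * \<phi>\<^sup>~ (0) = \<integral>\<bar>\<phi>\<^sup>\<and>\<bar>\<^sup>2 d\<gamma>_hat\<close> (\<open>radon_apply_correlation\<close>). The van Hove condition
  bounds the upper limit of \<open>|closure (A i) + L| / |A i|\<close> by 1 (\<open>van_hove_sumset_bound\<close>). Altogether
  \<open>\<bar>\<phi>\<^sup>\<and>(\<xi>)\<bar>\<^sup>2 limsup \<bar>a\<^sub>i\<bar>\<^sup>2 \<le> \<integral>\<bar>\<phi>\<^sup>\<and>\<bar>\<^sup>2 d\<gamma>_hat\<close> for every \<open>\<phi> \<in> Cc\<close>.

  It remains to make the right-hand side small while \<open>\<phi>\<^sup>\<and>(\<xi>)\<close> stays fixed, if \<open>\<gamma>_hat\<close> has no mass at \<open>\<xi>\<close>.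
  Averaging \<open>\<phi>\<close> with the translate \<open>\<xi>(s) \<phi>(\<cdot> - s)\<close> multiplies \<open>\<phi>\<^sup>\<and>(\<eta>)\<close> by \<open>(1 + \<xi>(s) cnj \<eta>(s)) / 2\<close>. This
  factor is 1 at \<open>\<xi>\<close> and has modulus less than 1 wherever \<open>\<eta>(s) \<noteq> \<xi>(s)\<close>, so finite products of such factors
  become uniformly small on every compact set of characters that omits \<open>\<xi>\<close> (\<open>damping_small\<close>). The squared
  moduli of these products, multiplied by a fixed nonnegative function in \<open>Cc\<close> with value 1 at \<open>\<xi>\<close>, form a
  downward directed family of continuous functions with infimum the indicator of \<open>{\<xi>}\<close>. A Dini argument shows
  that the indicator is integrable, its integral being the infimum of theirs (\<open>point_mass_integrable\<close>). If that integral is 0, then the damped integrals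
  \<open>\<integral>\<bar>\<phi>\<^sup>\<and>\<bar>\<^sup>2 d\<gamma>_hat\<close> have infimum 0 (\<open>damped_integral_null\<close>), and hence \<open>a\<^sub>i\<close> tends to 0.

  The integrals here are those of Bourbaki's theory, for functionals on \<open>Cc\<close>. The basis for computing with
  them is the subadditivity of the upper integral (\<open>radon_le_upper_variation_sum\<close>), which makes integrals
  unique. A functional and Haar measure can be interchanged by approximating the Haar integral
  by finite sums (\<open>haar_fubini\<close>).
\<close>

section \<open>Compactly supported functions and Radon functionals\<close>

lemma CcI:
  fixes \<phi> :: "'a::t2_space \<Rightarrow> complex"
  assumes "continuous_on UNIV \<phi>" "compact K" "\<And>x. x \<notin> K \<Longrightarrow> \<phi> x = 0"
  shows "\<phi> \<in> Cc"
proof -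
  have "closure {x. \<phi> x \<noteq> 0} \<subseteq> K"
    by (rule closure_minimal) (use assms compact_imp_closed in auto)
  then have "compact (closure {x. \<phi> x \<noteq> 0})"
    using closed_Int_compact[of "closure {x. \<phi> x \<noteq> 0}" K] assms(2)
    by (simp add: inf.absorb1)
  then show ?thesis
    using assms(1) by (simp add: Cc_def)
qed

lemma CcE:
  fixes \<phi> :: "'a::t2_space \<Rightarrow> complex"
  assumes "\<phi> \<in> Cc"
  obtains K where "continuous_on UNIV \<phi>" "compact K" "\<And>x. x \<notin> K \<Longrightarrow> \<phi> x = 0"
proof
  show "continuous_on UNIV \<phi>" "compact (closure {x. \<phi> x \<noteq> 0})"
    using assms by (auto simp: Cc_def)
  show "\<phi> x = 0" if "x \<notin> closure {x. \<phi> x \<noteq> 0}" for x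
    using that closure_subset[of "{x. \<phi> x \<noteq> 0}"] by auto
qed

lemma Cc_continuous: "\<phi> \<in> Cc \<Longrightarrow> continuous_on UNIV \<phi>"
  by (simp add: Cc_def)

lemma Cc_continuous_on: "\<phi> \<in> Cc \<Longrightarrow> continuous_on S \<phi>"
  using Cc_continuous continuous_on_subset by blast

lemma Cc_dominated:
  fixes \<phi> :: "'a::t2_space \<Rightarrow> complex"
  assumes "\<phi> \<in> Cc" "continuous_on UNIV \<psi>" "\<And>x. \<phi> x = 0 \<Longrightarrow> \<psi> x = 0"
  shows "\<psi> \<in> Cc"
proof -
  obtain K where "compact K" "\<And>x. x \<notin> K \<Longrightarrow> \<phi> x = 0"
    using CcE[OF assms(1)] by metis
  then show ?thesis
    using CcI[OF assms(2), of K] assms(3) by blast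
qed

lemma Cc_mult:
  fixes \<phi> :: "'a::t2_space \<Rightarrow> complex"
  assumes "\<phi> \<in> Cc" "continuous_on UNIV b"
  shows "(\<lambda>x. \<phi> x * b x) \<in> Cc" "(\<lambda>x. b x * \<phi> x) \<in> Cc"
  by (rule Cc_dominated[OF assms(1)]; use assms Cc_continuous in \<open>auto intro!: continuous_intros\<close>)+

lemma Cc_norm:
  fixes \<phi> :: "'a::t2_space \<Rightarrow> complex"
  shows "\<phi> \<in> Cc \<Longrightarrow> (\<lambda>x. of_real (norm (\<phi> x))) \<in> Cc"
  by (rule Cc_dominated) (auto intro!: continuous_intros Cc_continuous)

lemma Cc_scale:
  fixes \<phi> :: "'a::t2_space \<Rightarrow> complex"
  shows "\<phi> \<in> Cc \<Longrightarrow> (\<lambda>x. c * \<phi> x) \<in> Cc"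
  by (intro Cc_mult) auto

lemma Cc_zero: "(\<lambda>x::'a::t2_space. 0) \<in> Cc"
  by (rule CcI[where K="{}"]) auto

lemma Cc_add:
  fixes \<phi> :: "'a::t2_space \<Rightarrow> complex"
  assumes "\<phi> \<in> Cc" "\<psi> \<in> Cc"
  shows "(\<lambda>x. \<phi> x + \<psi> x) \<in> Cc"
proof -
  obtain K where "compact K" "\<And>x. x \<notin> K \<Longrightarrow> \<phi> x = 0"
    using CcE[OF assms(1)] by metis
  moreover obtain L where "compact L" "\<And>x. x \<notin> L \<Longrightarrow> \<psi> x = 0"
    using CcE[OF assms(2)] by metis
  moreover have "continuous_on UNIV (\<lambda>x. \<phi> x + \<psi> x)"
    using assms Cc_continuous by (intro continuous_intros) auto
  ultimately show ?thesis
    by (intro CcI[where K="K \<union> L"]) auto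
qed

lemma Cc_diff:
  fixes \<phi> :: "'a::t2_space \<Rightarrow> complex"
  assumes "\<phi> \<in> Cc" "\<psi> \<in> Cc"
  shows "(\<lambda>x. \<phi> x - \<psi> x) \<in> Cc"
  using Cc_add[OF assms(1) Cc_scale[OF assms(2), of "-1"]] by simp

lemma Cc_bounded:
  fixes \<phi> :: "'a::t2_space \<Rightarrow> complex"
  assumes "\<phi> \<in> Cc"
  obtains B where "B > 0" "\<And>x. norm (\<phi> x) \<le> B"
proof -
  obtain K where K: "compact K" "\<And>x. x \<notin> K \<Longrightarrow> \<phi> x = 0"
    using CcE[OF assms] by metis
  have "compact (\<phi> ` K)"
    using K Cc_continuous_on[OF assms] compact_continuous_image by blast
  then obtain B where "B > 0" "\<And>x. x \<in> K \<Longrightarrow> norm (\<phi> x) \<le> B"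
    using compact_imp_bounded bounded_pos by (metis imageI)
  with K that[of B] show ?thesis
    by (metis norm_zero less_imp_le)
qed

lemma continuous_bounded_on_compact:
  fixes b :: "'a::topological_space \<Rightarrow> complex"
  assumes "continuous_on UNIV b" "compact K"
  obtains B where "B > 0" "\<And>x. x \<in> K \<Longrightarrow> norm (b x) \<le> B"
proof -
  have "compact (b ` K)"
    using assms continuous_on_subset compact_continuous_image by blast
  then show ?thesis
    using compact_imp_bounded bounded_pos that by (metis imageI)
qed

lemma
  fixes \<mu> :: "('a::t2_space \<Rightarrow> complex) \<Rightarrow> complex"
  assumes "radon_functional \<mu>"
  shows radon_add: "\<phi> \<in> Cc \<Longrightarrow> \<psi> \<in> Cc \<Longrightarrow> \<mu> (\<lambda>x. \<phi> x + \<psi> x) = \<mu> \<phi> + \<mu> \<psi>"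
    and radon_scale: "\<phi> \<in> Cc \<Longrightarrow> \<mu> (\<lambda>x. c * \<phi> x) = c * \<mu> \<phi>"
  using assms by (auto simp: radon_functional_def)

lemma radon_diff:
  fixes \<mu> :: "('a::t2_space \<Rightarrow> complex) \<Rightarrow> complex"
  assumes "radon_functional \<mu>" "\<phi> \<in> Cc" "\<psi> \<in> Cc"
  shows "\<mu> (\<lambda>x. \<phi> x - \<psi> x) = \<mu> \<phi> - \<mu> \<psi>"
  using radon_add[OF assms(1,2) Cc_scale[OF assms(3), of "-1"]] radon_scale[OF assms(1,3), of "-1"]
  by simp

lemma radon_bound:
  fixes \<mu> :: "('a::t2_space \<Rightarrow> complex) \<Rightarrow> complex"
  assumes "radon_functional \<mu>" "compact K"
  obtains C where "C > 0" "\<And>\<phi> B. \<lbrakk>\<phi> \<in> Cc; \<And>x. x \<notin> K \<Longrightarrow> \<phi> x = 0; \<And>x. x \<in> K \<Longrightarrow> norm (\<phi> x) \<le> B; B \<ge> 0\<rbrakk>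
      \<Longrightarrow> norm (\<mu> \<phi>) \<le> C * B"
proof -
  obtain C where C: "C \<ge> 0" "\<And>\<phi>. \<phi> \<in> Cc \<Longrightarrow> closure {x. \<phi> x \<noteq> 0} \<subseteq> K \<Longrightarrow>
        norm (\<mu> \<phi>) \<le> C * (SUP x. norm (\<phi> x))"
    using assms unfolding radon_functional_def by meson
  show ?thesis
  proof (rule that[of "C + 1"])
    fix \<phi> :: "'a \<Rightarrow> complex" and B :: real
    assume *: "\<phi> \<in> Cc" "\<And>x. x \<notin> K \<Longrightarrow> \<phi> x = 0" "\<And>x. x \<in> K \<Longrightarrow> norm (\<phi> x) \<le> B" "B \<ge> 0"
    have "closure {x. \<phi> x \<noteq> 0} \<subseteq> K"
      by (rule closure_minimal) (use * assms compact_imp_closed in auto)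
    then have "norm (\<mu> \<phi>) \<le> C * (SUP x. norm (\<phi> x))"
      using C * by blast
    also have "(SUP x. norm (\<phi> x)) \<le> B"
      by (rule cSUP_least) (use * in \<open>auto, metis norm_zero\<close>)
    then have "C * (SUP x. norm (\<phi> x)) \<le> C * B"
      using C by (simp add: mult_left_mono)
    also have "\<dots> \<le> (C + 1) * B"
      using * by (simp add: algebra_simps)
    finally show "norm (\<mu> \<phi>) \<le> (C + 1) * B" .
  qed (use C in auto)
qed

section \<open>The upper integral and the uniqueness of integrals\<close>

text \<open>
  The majorants used for estimating upper integrals are all of this shape: a continuous function cut off
  outside an open set.
\<close>

lemma lower_semicontinuous_on_open:
  fixes h :: "'a::topological_space \<Rightarrow> real"
  assumes "open U" "continuous_on UNIV h"
  shows "lower_semicontinuous (\<lambda>x. if x \<in> U then ennreal (h x) else 0)"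
  unfolding lower_semicontinuous_def
proof
  fix a :: ennreal
  have "open {x. a < ennreal (h x)}"
    using assms(2) by (intro open_Collect_less continuous_on_ennreal) auto
  moreover have "{x. a < (if x \<in> U then ennreal (h x) else 0)} = U \<inter> {x. a < ennreal (h x)}"
    by (auto split: if_splits)
  ultimately show "open {x. a < (if x \<in> U then ennreal (h x) else 0)}"
    using assms(1) by (simp add: open_Int)
qed

lemma upper_variation_le:
  assumes "lower_semicontinuous g" "\<And>x. f x \<le> g x"
    "\<And>\<phi>. \<phi> \<in> Cc \<Longrightarrow> (\<And>x. ennreal (norm (\<phi> x)) \<le> g x) \<Longrightarrow> norm (\<mu> \<phi>) \<le> c"
  shows "upper_variation \<mu> f \<le> ennreal c"
proof -
  have "upper_variation \<mu> f \<le> variation_lsc \<mu> g"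
    unfolding upper_variation_def using assms by (intro INF_lower) auto
  also have "\<dots> \<le> ennreal c"
    unfolding variation_lsc_def using assms(3) by (intro SUP_least) (auto intro: ennreal_leI)
  finally show ?thesis .
qed

lemma upper_variation_mono:
  "(\<And>x. f x \<le> f' x) \<Longrightarrow> upper_variation \<mu> f \<le> upper_variation \<mu> f'"
  unfolding upper_variation_def by (intro INF_superset_mono) (auto intro: order_trans)

lemma Hausdorff_space_euclidean_t2: "Hausdorff_space (euclidean :: 'a::t2_space topology)"
  unfolding Hausdorff_space_def disjnt_def using hausdorff by fastforce

lemma lsc_minorant:
  fixes g :: "'a::t2_space \<Rightarrow> ennreal"
  assumes "lower_semicontinuous g" "compact K" "x \<in> K" "ennreal a < g x" "0 \<le> a"
  obtains h :: "'a \<Rightarrow> real" where "continuous_on K h" "\<And>y. y \<in> K \<Longrightarrow> 0 \<le> h y"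
    "\<And>y. y \<in> K \<Longrightarrow> ennreal (h y) \<le> g y" "h x = a"
proof -
  have "Hausdorff_space (top_of_set K)"
    by (intro Hausdorff_space_subtopology Hausdorff_space_euclidean_t2)
  moreover have "compact_space (top_of_set K)"
    using assms(2) by (simp add: compact_space_subtopology)
  ultimately have "completely_regular_space (top_of_set K)"
    by (simp add: compact_Hausdorff_or_regular_imp_normal_space normal_imp_completely_regular_space_gen)
  moreover have "closedin (top_of_set K) (K \<inter> - {y. ennreal a < g y})"
    using assms(1) unfolding lower_semicontinuous_def
    by (intro closedin_closed_Int) (auto simp: closed_Compl)
  moreover have "x \<in> K - K \<inter> - {y. ennreal a < g y}"
    using assms by auto
  ultimately obtain f :: "'a \<Rightarrow> real" where f: "continuous_map (top_of_set K) (top_of_set {0..1}) f"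
    "f x = 0" "f ` (K \<inter> - {y. ennreal a < g y}) \<subseteq> {1}"
    unfolding completely_regular_space_def by (metis topspace_euclidean_subtopology)
  have cf: "continuous_on K f" and f01: "\<And>y. y \<in> K \<Longrightarrow> 0 \<le> f y \<and> f y \<le> 1"
    using f(1) by (auto simp: continuous_map_in_subtopology image_subset_iff Pi_iff)
  show ?thesis
  proof (rule that[of "\<lambda>y. a * (1 - f y)"])
    show "continuous_on K (\<lambda>y. a * (1 - f y))"
      using cf by (intro continuous_intros)
    show "0 \<le> a * (1 - f y)" if "y \<in> K" for y
      using f01[OF that] assms(5) by simp
    show "ennreal (a * (1 - f y)) \<le> g y" if "y \<in> K" for y
    proof (cases "ennreal a < g y")
      case True
      have "a * (1 - f y) \<le> a"
        using f01[OF that] assms(5) by (simp add: mult_left_le)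
      then show ?thesis
        using True by (meson ennreal_leI less_imp_le order_trans)
    next
      case False
      then have "f y = 1" using f(3) that by auto
      then show ?thesis by simp
    qed
  qed (use f in auto)
qed

lemma lsc_minorant_or_zero:
  fixes g :: "'a::t2_space \<Rightarrow> ennreal"
  assumes "lower_semicontinuous g" "compact K" "x \<in> K" "ennreal a < g x \<or> a = 0" "0 \<le> a"
  obtains h :: "'a \<Rightarrow> real" where "continuous_on K h" "\<And>y. y \<in> K \<Longrightarrow> 0 \<le> h y"
    "\<And>y. y \<in> K \<Longrightarrow> ennreal (h y) \<le> g y" "h x = a"
proof (cases "ennreal a < g x")
  case True
  then show ?thesis using lsc_minorant[OF assms(1-3) True assms(5)] that by blast
next
  case False
  then show ?thesis using assms that[of "\<lambda>_. 0"] by auto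
qed

text \<open>
  The alternative \<open>a = 0\<close> is there because \<open>u\<close> may vanish, in which case no nonnegative real lies strictly below it.
\<close>

lemma ennreal_split_less:
  assumes "ennreal r \<le> u + v" "0 \<le> r" "0 < e"
  obtains a b where "0 \<le> a" "0 \<le> b" "ennreal a < u \<or> a = 0" "ennreal b < v \<or> b = 0" "r < a + b + e"
proof -
  have ap: "\<exists>a\<ge>0. (ennreal a < w \<or> a = 0) \<and> (w = top \<and> r \<le> a \<or> w < top \<and> enn2real w < a + e/2)"
    for w
  proof (cases "w = top")
    case True
    then show ?thesis using assms(2) by (intro exI[of _ r]) simp
  next
    case False
    then obtain x where x: "w = ennreal x" "x \<ge> 0"
      by (cases w) auto
    show ?thesis
    proof (rule exI[of _ "max 0 (x - e/4)"], intro conjI)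
      show "ennreal (max 0 (x - e/4)) < w \<or> max 0 (x - e/4) = 0"
        using x assms(3) by (cases "x \<le> e/4") (auto simp: ennreal_less_iff max_def)
    qed (use x assms(3) in \<open>auto simp: max_def\<close>)
  qed
  obtain a where a: "a\<ge>0" "ennreal a < u \<or> a = 0" "u = top \<and> r \<le> a \<or> u < top \<and> enn2real u < a + e/2"
    using ap[of u] by blast
  obtain b where b: "b\<ge>0" "ennreal b < v \<or> b = 0" "v = top \<and> r \<le> b \<or> v < top \<and> enn2real v < b + e/2"
    using ap[of v] by blast
  have "r < a + b + e"
  proof (cases "u < top \<and> v < top")
    case True
    then have "ennreal r \<le> ennreal (enn2real u + enn2real v)"
      using assms(1) by (simp add: ennreal_plus)
    then have "r \<le> enn2real u + enn2real v"
      by (subst (asm) ennreal_le_iff) auto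
    moreover have "enn2real u < a + e/2" "enn2real v < b + e/2"
      using True a(3) b(3) less_irrefl by metis+
    ultimately show ?thesis by linarith
  next
    case False
    then show ?thesis using a b assms(2,3) by auto
  qed
  then show ?thesis using that a b by blast
qed

text \<open>
  On a compact Hausdorff space a lower semicontinuous function is the pointwise supremum of its continuous
  minorants, by Urysohn's lemma. These minorants are closed under maxima, so compactness turns the
  pointwise approximation of a function below \<open>g1 + g2\<close> into a uniform one, and does so for both summands at once.
\<close>

lemma lsc_sum_minorants:
  fixes g1 g2 :: "'a::t2_space \<Rightarrow> ennreal" and r :: "'a \<Rightarrow> real"
  assumes g: "lower_semicontinuous g1" "lower_semicontinuous g2" and K: "compact K"
    and r: "continuous_on K r" "\<And>x. 0 \<le> r x" "\<And>x. ennreal (r x) \<le> g1 x + g2 x" and e: "e > 0"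
  obtains h1 h2 :: "'a \<Rightarrow> real" where "continuous_on K h1" "continuous_on K h2"
    "\<And>y. y \<in> K \<Longrightarrow> 0 \<le> h1 y \<and> 0 \<le> h2 y \<and> ennreal (h1 y) \<le> g1 y \<and> ennreal (h2 y) \<le> g2 y \<and> r y < h1 y + h2 y + e"
proof -
  \<comment> \<open>Admissible pairs; the maximum of finitely many of them is admissible again.\<close>
  define adm where "adm = (\<lambda>(h1::'a\<Rightarrow>real, h2::'a\<Rightarrow>real). continuous_on K h1 \<and> continuous_on K h2 \<and>
     (\<forall>y\<in>K. 0 \<le> h1 y \<and> 0 \<le> h2 y \<and> ennreal (h1 y) \<le> g1 y \<and> ennreal (h2 y) \<le> g2 y))"
  have "\<exists>h U. adm h \<and> open U \<and> x \<in> U \<and> (\<forall>y\<in>U \<inter> K. r y < fst h y + snd h y + e)" if xK: "x \<in> K" for x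
  proof -
    obtain a b where ab: "0 \<le> a" "0 \<le> b" "ennreal a < g1 x \<or> a = 0" "ennreal b < g2 x \<or> b = 0" "r x < a + b + e"
      using ennreal_split_less[OF r(3) r(2) e] by blast
    obtain h1 where h1: "continuous_on K h1" "\<And>y. y \<in> K \<Longrightarrow> 0 \<le> h1 y"
      "\<And>y. y \<in> K \<Longrightarrow> ennreal (h1 y) \<le> g1 y" "h1 x = a"
      using lsc_minorant_or_zero[OF g(1) K xK ab(3) ab(1)] by blast
    obtain h2 where h2: "continuous_on K h2" "\<And>y. y \<in> K \<Longrightarrow> 0 \<le> h2 y"
      "\<And>y. y \<in> K \<Longrightarrow> ennreal (h2 y) \<le> g2 y" "h2 x = b"
      using lsc_minorant_or_zero[OF g(2) K xK ab(4) ab(2)] by blast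
    have "continuous_on K (\<lambda>y. h1 y + h2 y + e - r y)"
      using h1 h2 r by (intro continuous_intros)
    then obtain U where "open U" "U \<inter> K = (\<lambda>y. h1 y + h2 y + e - r y) -` {0<..} \<inter> K"
      unfolding continuous_on_open_invariant by (meson open_greaterThan)
    then show ?thesis
      using h1 h2 ab xK
      by (intro exI[of _ "(h1,h2)"] exI[of _ U]) (auto simp: adm_def)
  qed
  then obtain h U where hU: "\<And>x. x \<in> K \<Longrightarrow> adm (h x) \<and> open (U x) \<and> x \<in> U x \<and>
      (\<forall>y\<in>U x \<inter> K. r y < fst (h x) y + snd (h x) y + e)"
    by metis
  have "\<exists>D\<subseteq>K. finite D \<and> K \<subseteq> (\<Union>x\<in>D. U x)"
    by (rule compactE_image[OF K, of K U]) (use hU in blast)+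
  then obtain D where D: "D \<subseteq> K" "finite D" "K \<subseteq> (\<Union>x\<in>D. U x)" by blast
  have "\<exists>k. adm k \<and> (\<forall>x\<in>D. \<forall>y\<in>K. fst (h x) y \<le> fst k y \<and> snd (h x) y \<le> snd k y)"
    using D(2,1)
  proof (induction D)
    case empty
    then show ?case by (intro exI[of _ "(\<lambda>_. 0, \<lambda>_. 0)"]) (auto simp: adm_def)
  next
    case (insert x D)
    then obtain k where k: "adm k" "\<forall>x\<in>D. \<forall>y\<in>K. fst (h x) y \<le> fst k y \<and> snd (h x) y \<le> snd k y"
      by auto
    have "adm (\<lambda>y. max (fst k y) (fst (h x) y), \<lambda>y. max (snd k y) (snd (h x) y))"
    proof -
      have "ennreal (max p q) \<le> w" if "ennreal p \<le> w" "ennreal q \<le> w" for p q w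
        using that by (simp add: max_def)
      moreover have "adm (h x)" using hU insert by blast
      ultimately show ?thesis
        using k(1) unfolding adm_def by (auto simp: split_beta le_max_iff_disj intro!: continuous_on_max)
    qed
    then show ?case
      using k(2) by (intro exI conjI) (assumption, auto simp: le_max_iff_disj)
  qed
  then obtain k where k: "adm k" "\<And>x y. x \<in> D \<Longrightarrow> y \<in> K \<Longrightarrow> fst (h x) y \<le> fst k y \<and> snd (h x) y \<le> snd k y"
    by blast
  show ?thesis
  proof (rule that[of "fst k" "snd k"])
    fix y assume y: "y \<in> K"
    then obtain x where x: "x \<in> D" "y \<in> U x" using D by auto
    then have "r y < fst (h x) y + snd (h x) y + e"
      using hU[of x] D y by blast
    then have "r y < fst k y + snd k y + e"
      using k(2)[OF x(1) y] by linarith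
    then show "0 \<le> fst k y \<and> 0 \<le> snd k y \<and> ennreal (fst k y) \<le> g1 y \<and> ennreal (snd k y) \<le> g2 y \<and> r y < fst k y + snd k y + e"
      using k(1) y by (auto simp: adm_def split_beta)
  qed (use k in \<open>auto simp: adm_def split_beta\<close>)
qed

text \<open>
  A factor \<open>r\<close> that is continuous on \<open>K\<close> only does no harm: \<open>K\<close> and the zero set of \<open>\<phi>\<close> are closed sets that
  cover the space, and the two definitions agree where they meet.
\<close>

lemma Cc_times_continuous_on_support:
  fixes \<phi> :: "'a::t2_space \<Rightarrow> complex"
  assumes \<phi>: "continuous_on UNIV \<phi>" and K: "compact K" "\<And>x. x \<notin> K \<Longrightarrow> \<phi> x = 0"
    and r: "continuous_on K r"
  shows "(\<lambda>x. if x \<in> K then \<phi> x * r x else 0) \<in> Cc"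
proof (rule CcI[OF _ K(1)])
  have "continuous_on (K \<union> {x. \<phi> x = 0}) (\<lambda>x. if x \<in> K then \<phi> x * r x else 0)"
  proof (rule continuous_on_If)
    show "closed K" using K(1) by (rule compact_imp_closed)
    show "closed {x. \<phi> x = 0}"
      using \<phi> by (intro closed_Collect_eq) auto
    show "continuous_on K (\<lambda>x. \<phi> x * r x)"
      using r continuous_on_subset[OF \<phi>] by (intro continuous_intros) auto
  qed (use K in auto)
  moreover have "K \<union> {x. \<phi> x = 0} = UNIV" using K by auto
  ultimately show "continuous_on UNIV (\<lambda>x. if x \<in> K then \<phi> x * r x else 0)" by simp
qed auto

text \<open>
  Subadditivity of the upper integral on lower semicontinuous functions. A function \<open>\<phi>\<close> dominated by \<open>g1 + g2\<close>
  is cut into pieces \<open>\<phi> h1 / s\<close> and \<open>\<phi> h2 / s\<close>, dominated by \<open>g1\<close> and \<open>g2\<close>, and a uniformly small remainder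
  \<open>\<phi> d / s\<close>, where \<open>h1\<close> and \<open>h2\<close> are continuous minorants and \<open>s = h1 + h2 + d\<close>.
\<close>

lemma radon_le_variation_lsc_sum:
  fixes \<mu> :: "('a::t2_space \<Rightarrow> complex) \<Rightarrow> complex"
  assumes \<mu>: "radon_functional \<mu>" and \<phi>: "\<phi> \<in> Cc"
    and g: "lower_semicontinuous g1" "lower_semicontinuous g2"
    and le: "\<And>x. ennreal (norm (\<phi> x)) \<le> g1 x + g2 x"
  shows "ennreal (norm (\<mu> \<phi>)) \<le> variation_lsc \<mu> g1 + variation_lsc \<mu> g2"
proof -
  obtain K where K: "continuous_on UNIV \<phi>" "compact K" "\<And>x. x \<notin> K \<Longrightarrow> \<phi> x = 0"
    using CcE[OF \<phi>] by metis
  obtain C where C: "C > 0" "\<And>\<psi> B. \<lbrakk>\<psi> \<in> Cc; \<And>x. x \<notin> K \<Longrightarrow> \<psi> x = 0; \<And>x. x \<in> K \<Longrightarrow> norm (\<psi> x) \<le> B; B \<ge> 0\<rbrakk>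
      \<Longrightarrow> norm (\<mu> \<psi>) \<le> C * B"
    using radon_bound[OF \<mu> K(2)] by metis
  have "ennreal (norm (\<mu> \<phi>)) \<le> variation_lsc \<mu> g1 + variation_lsc \<mu> g2 + ennreal e" if e: "e > 0" for e
  proof -
    define d where "d = e / C"
    have d: "d > 0" using e C by (simp add: d_def)
    have nc: "continuous_on K (\<lambda>x. norm (\<phi> x))"
      using K(1) continuous_on_subset by (intro continuous_intros) auto
    obtain h1 h2 where h: "continuous_on K h1" "continuous_on K h2"
      "\<And>y. y \<in> K \<Longrightarrow> 0 \<le> h1 y \<and> 0 \<le> h2 y \<and> ennreal (h1 y) \<le> g1 y \<and> ennreal (h2 y) \<le> g2 y \<and>
         norm (\<phi> y) < h1 y + h2 y + d"
      by (rule lsc_sum_minorants[OF g K(2) nc norm_ge_zero le d], rule that)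
    define s where "s y = h1 y + h2 y + d" for y
    have s: "s y > 0" "norm (\<phi> y) < s y" if "y \<in> K" for y
      using h(3)[OF that] d by (auto simp: s_def)
    define part where "part h x = (if x \<in> K then \<phi> x * complex_of_real (h x / s x) else 0)"
      for h and x :: 'a
    have part_Cc: "part h \<in> Cc" if "continuous_on K h" for h
      unfolding part_def
    proof (rule Cc_times_continuous_on_support[OF K])
      have "continuous_on K s" unfolding s_def using h by (intro continuous_intros)
      moreover have "\<forall>x\<in>K. s x \<noteq> 0" using s by fastforce
      ultimately show "continuous_on K (\<lambda>x. complex_of_real (h x / s x))"
        using that by (intro continuous_intros)
    qed
    have part_le: "norm (part h y) \<le> h y" if "y \<in> K" "0 \<le> h y" for h y
    proof -
      have "norm (part h y) = norm (\<phi> y) * h y / s y"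
        using that s(1)[of y] by (simp add: part_def norm_mult norm_divide)
      also have "\<dots> \<le> s y * h y / s y"
        using that s[of y] by (intro divide_right_mono mult_right_mono) auto
      finally show ?thesis using s(1)[of y] that by simp
    qed
    have part0: "part h y = 0" if "y \<notin> K" for h y using that by (simp add: part_def)
    have sum: "\<phi> = (\<lambda>x. (part h1 x + part h2 x) + part (\<lambda>_. d) x)"
    proof
      fix x show "\<phi> x = (part h1 x + part h2 x) + part (\<lambda>_. d) x"
      proof (cases "x \<in> K")
        case True
        have "(part h1 x + part h2 x) + part (\<lambda>_. d) x = \<phi> x * complex_of_real (h1 x / s x + h2 x / s x + d / s x)"
          using True by (simp add: part_def distrib_left)
        also have "h1 x / s x + h2 x / s x + d / s x = 1"
          using s(1)[OF True] by (simp add: s_def add_divide_distrib[symmetric])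
        finally show ?thesis by simp
      qed (use K in \<open>auto simp: part_def\<close>)
    qed
    have eq: "\<mu> \<phi> = \<mu> (part h1) + \<mu> (part h2) + \<mu> (part (\<lambda>_. d))"
    proof -
      have "part h1 \<in> Cc" "part h2 \<in> Cc" "part (\<lambda>_. d) \<in> Cc"
        by (rule part_Cc, use h in simp)+
      then have "\<mu> (\<lambda>x. (part h1 x + part h2 x) + part (\<lambda>_. d) x) = \<mu> (part h1) + \<mu> (part h2) + \<mu> (part (\<lambda>_. d))"
        by (simp only: radon_add[OF \<mu>] Cc_add)
      then show ?thesis by (simp only: sum[symmetric])
    qed
    from norm_triangle_ineq[of "\<mu> (part h1) + \<mu> (part h2)" "\<mu> (part (\<lambda>_. d))"]
      norm_triangle_ineq[of "\<mu> (part h1)" "\<mu> (part h2)"]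
    have "norm (\<mu> \<phi>) \<le> norm (\<mu> (part h1)) + norm (\<mu> (part h2)) + norm (\<mu> (part (\<lambda>_. d)))"
      unfolding eq by linarith
    also have "norm (\<mu> (part (\<lambda>_. d))) \<le> C * d"
      using d by (intro C(2) part_Cc part0 part_le) auto
    finally have 1: "norm (\<mu> \<phi>) \<le> norm (\<mu> (part h1)) + norm (\<mu> (part h2)) + e"
      using C(1) by (simp add: d_def)
    have v1: "ennreal (norm (\<mu> (part h1))) \<le> variation_lsc \<mu> g1"
      unfolding variation_lsc_def
    proof (rule SUP_upper, safe)
      show "ennreal (norm (part h1 x)) \<le> g1 x" for x
      proof (cases "x \<in> K")
        case True
        then have "ennreal (norm (part h1 x)) \<le> ennreal (h1 x)"
          using part_le[of x h1] h(3)[of x] by (intro ennreal_leI) auto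
        also have "\<dots> \<le> g1 x" using h(3)[OF True] by auto
        finally show ?thesis .
      qed (simp add: part0)
    qed (simp add: part_Cc h)
    have v2: "ennreal (norm (\<mu> (part h2))) \<le> variation_lsc \<mu> g2"
      unfolding variation_lsc_def
    proof (rule SUP_upper, safe)
      show "ennreal (norm (part h2 x)) \<le> g2 x" for x
      proof (cases "x \<in> K")
        case True
        then have "ennreal (norm (part h2 x)) \<le> ennreal (h2 x)"
          using part_le[of x h2] h(3)[of x] by (intro ennreal_leI) auto
        also have "\<dots> \<le> g2 x" using h(3)[OF True] by auto
        finally show ?thesis .
      qed (simp add: part0)
    qed (simp add: part_Cc h)
    have "ennreal (norm (\<mu> \<phi>)) \<le> ennreal (norm (\<mu> (part h1)) + norm (\<mu> (part h2)) + e)"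
      using 1 by (rule ennreal_leI)
    also have "\<dots> = ennreal (norm (\<mu> (part h1))) + ennreal (norm (\<mu> (part h2))) + ennreal e"
      using e by (simp add: ennreal_plus)
    also have "\<dots> \<le> variation_lsc \<mu> g1 + variation_lsc \<mu> g2 + ennreal e"
      using v1 v2 by (intro add_mono) auto
    finally show ?thesis .
  qed
  then show ?thesis by (rule ennreal_le_epsilon)
qed

lemma radon_le_upper_variation_sum:
  fixes \<mu> :: "('a::t2_space \<Rightarrow> complex) \<Rightarrow> complex"
  assumes \<mu>: "radon_functional \<mu>" and \<phi>: "\<phi> \<in> Cc"
    and le: "\<And>x. ennreal (norm (\<phi> x)) \<le> f1 x + f2 x"
  shows "ennreal (norm (\<mu> \<phi>)) \<le> upper_variation \<mu> f1 + upper_variation \<mu> f2"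
proof -
  have *: "ennreal (norm (\<mu> \<phi>)) \<le> variation_lsc \<mu> g1 + variation_lsc \<mu> g2"
    if "lower_semicontinuous g1" "\<And>x. f1 x \<le> g1 x" "lower_semicontinuous g2" "\<And>x. f2 x \<le> g2 x" for g1 g2
    using that by (intro radon_le_variation_lsc_sum[OF \<mu> \<phi>]) (auto intro: order_trans[OF le] add_mono)
  show ?thesis
  proof (cases "upper_variation \<mu> f1 < \<infinity> \<and> upper_variation \<mu> f2 < \<infinity>")
    case False
    then show ?thesis by (auto simp: less_top[symmetric])
  next
    case True
    have approx: "\<exists>g. lower_semicontinuous g \<and> (\<forall>x. f x \<le> g x) \<and> variation_lsc \<mu> g \<le> upper_variation \<mu> f + ennreal e"
      if "upper_variation \<mu> f < \<infinity>" "e > 0" for f e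
    proof -
      have "upper_variation \<mu> f < upper_variation \<mu> f + ennreal e"
        using that by (simp add: ennreal_add_left_cancel_less[of _ 0, simplified]) 
      then show ?thesis
        unfolding upper_variation_def INF_less_iff by (auto intro: less_imp_le)
    qed
    have "ennreal (norm (\<mu> \<phi>)) \<le> upper_variation \<mu> f1 + upper_variation \<mu> f2 + ennreal e" if e: "e > 0" for e
    proof -
      obtain g1 where g1: "lower_semicontinuous g1" "\<And>x. f1 x \<le> g1 x"
        "variation_lsc \<mu> g1 \<le> upper_variation \<mu> f1 + ennreal (e/2)"
        using approx[of f1 "e/2"] True e by auto
      obtain g2 where g2: "lower_semicontinuous g2" "\<And>x. f2 x \<le> g2 x"
        "variation_lsc \<mu> g2 \<le> upper_variation \<mu> f2 + ennreal (e/2)"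
        using approx[of f2 "e/2"] True e by auto
      have "ennreal (norm (\<mu> \<phi>)) \<le> (upper_variation \<mu> f1 + ennreal (e/2)) + (upper_variation \<mu> f2 + ennreal (e/2))"
        using add_mono[OF g1(3) g2(3)] by (rule order_trans[OF *[OF g1(1,2) g2(1,2)]])
      also have "\<dots> = upper_variation \<mu> f1 + upper_variation \<mu> f2 + (ennreal (e/2) + ennreal (e/2))"
        by (simp add: ac_simps)
      also have "ennreal (e/2) + ennreal (e/2) = ennreal e"
        using e by (subst ennreal_plus[symmetric]) auto
      finally show ?thesis .
    qed
    then show ?thesis by (rule ennreal_le_epsilon)
  qed
qed

text \<open>
  Two approximations of the same \<open>f\<close> differ by at most the sum of their distances to \<open>f\<close>. This gives both
  the uniqueness of the integral and the Cauchy property behind its existence.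
\<close>

lemma radon_diff_le:
  fixes \<mu> :: "('a::t2_space \<Rightarrow> complex) \<Rightarrow> complex"
  assumes \<mu>: "radon_functional \<mu>" and "\<phi> \<in> Cc" "\<psi> \<in> Cc"
    and "upper_variation \<mu> (\<lambda>x. ennreal (norm (f x - \<phi> x))) \<le> ennreal a" "0 \<le> a"
    and "upper_variation \<mu> (\<lambda>x. ennreal (norm (f x - \<psi> x))) \<le> ennreal b" "0 \<le> b"
  shows "norm (\<mu> \<phi> - \<mu> \<psi>) \<le> a + b"
proof -
  have "ennreal (norm (\<mu> (\<lambda>x. \<phi> x - \<psi> x))) \<le>
     upper_variation \<mu> (\<lambda>x. ennreal (norm (f x - \<phi> x))) + upper_variation \<mu> (\<lambda>x. ennreal (norm (f x - \<psi> x)))"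
  proof (rule radon_le_upper_variation_sum[OF \<mu> Cc_diff])
    show "ennreal (norm (\<phi> x - \<psi> x)) \<le> ennreal (norm (f x - \<phi> x)) + ennreal (norm (f x - \<psi> x))" for x
    proof -
      have "norm (\<phi> x - \<psi> x) \<le> norm (f x - \<phi> x) + norm (f x - \<psi> x)"
        using norm_triangle_ineq4[of "f x - \<psi> x" "f x - \<phi> x"] by (simp add: algebra_simps)
      then have "ennreal (norm (\<phi> x - \<psi> x)) \<le> ennreal (norm (f x - \<phi> x) + norm (f x - \<psi> x))"
        by (rule ennreal_leI)
      then show ?thesis by simp
    qed
  qed (use assms in auto)
  also have "\<dots> \<le> ennreal a + ennreal b"
    using assms by (intro add_mono)
  also have "\<dots> = ennreal (a + b)"
    using assms by (simp add: ennreal_plus)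
  finally have "norm (\<mu> (\<lambda>x. \<phi> x - \<psi> x)) \<le> a + b"
    using assms by (subst (asm) ennreal_le_iff) auto
  then show ?thesis
    using assms by (simp add: radon_diff)
qed

lemma radon_has_integral_le:
  fixes \<mu> :: "('a::t2_space \<Rightarrow> complex) \<Rightarrow> complex"
  assumes \<mu>: "radon_functional \<mu>" and f: "radon_has_integral \<mu> f c" and \<psi>: "\<psi> \<in> Cc"
    and b: "upper_variation \<mu> (\<lambda>x. ennreal (norm (f x - \<psi> x))) \<le> ennreal b" "0 \<le> b"
  shows "norm (c - \<mu> \<psi>) \<le> b"
proof (rule field_le_epsilon)
  fix e :: real assume e: "e > 0"
  obtain \<phi> where \<phi>: "\<phi> \<in> Cc" "upper_variation \<mu> (\<lambda>x. ennreal (norm (f x - \<phi> x))) < ennreal (e/2)"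
    "norm (\<mu> \<phi> - c) < e/2"
    using f e unfolding radon_has_integral_def by (meson half_gt_zero)
  have "norm (\<mu> \<phi> - \<mu> \<psi>) \<le> e/2 + b"
    using radon_diff_le[OF \<mu> \<phi>(1) \<psi> less_imp_le[OF \<phi>(2)] _ b] e by simp
  moreover have "norm (c - \<mu> \<psi>) \<le> norm (\<mu> \<phi> - c) + norm (\<mu> \<phi> - \<mu> \<psi>)"
    using norm_triangle_ineq4[of "\<mu> \<phi> - \<mu> \<psi>" "\<mu> \<phi> - c"] by (simp add: algebra_simps)
  ultimately show "norm (c - \<mu> \<psi>) \<le> b + e" using \<phi>(3) by linarith
qed

lemma radon_has_integral_unique:
  fixes \<mu> :: "('a::t2_space \<Rightarrow> complex) \<Rightarrow> complex"
  assumes \<mu>: "radon_functional \<mu>" and f: "radon_has_integral \<mu> f c" "radon_has_integral \<mu> f d"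
  shows "c = d"
proof -
  have "norm (c - d) \<le> 0 + e" if e: "e > 0" for e
  proof -
    obtain \<phi> where \<phi>: "\<phi> \<in> Cc" "upper_variation \<mu> (\<lambda>x. ennreal (norm (f x - \<phi> x))) < ennreal (e/2)"
      "norm (\<mu> \<phi> - d) < e/2"
      using f(2) e unfolding radon_has_integral_def by (meson half_gt_zero)
    have "norm (c - \<mu> \<phi>) \<le> e/2"
      using radon_has_integral_le[OF \<mu> f(1) \<phi>(1) less_imp_le[OF \<phi>(2)]] e by simp
    then show ?thesis using \<phi>(3) norm_triangle_ineq[of "c - \<mu> \<phi>" "\<mu> \<phi> - d"] by simp
  qed
  then have "norm (c - d) \<le> 0" by (rule field_le_epsilon)
  then show ?thesis by simp
qed

lemma radon_integral_eq:
  fixes \<mu> :: "('a::t2_space \<Rightarrow> complex) \<Rightarrow> complex"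
  assumes "radon_functional \<mu>" "radon_has_integral \<mu> f c"
  shows "radon_integral \<mu> f = c"
  unfolding radon_integral_def using assms radon_has_integral_unique by (intro the_equality) blast+

lemma upper_variation_zero:
  fixes \<mu> :: "('a::t2_space \<Rightarrow> complex) \<Rightarrow> complex"
  assumes \<mu>: "radon_functional \<mu>"
  shows "upper_variation \<mu> (\<lambda>x. 0) = 0"
proof -
  have "upper_variation \<mu> (\<lambda>x. 0) \<le> ennreal 0"
  proof (rule upper_variation_le[where g="\<lambda>_. 0"])
    fix \<phi> :: "'a \<Rightarrow> complex" assume "\<phi> \<in> Cc" "\<And>x. ennreal (norm (\<phi> x)) \<le> 0"
    then have "\<phi> = (\<lambda>x. 0 * 0)" by (auto simp: ennreal_eq_0_iff)
    then show "norm (\<mu> \<phi>) \<le> 0" using radon_scale[OF \<mu> Cc_zero, of 0] by simp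
  qed (auto simp: lower_semicontinuous_def)
  then show ?thesis by simp
qed

lemma radon_integral_Cc:
  fixes \<mu> :: "('a::t2_space \<Rightarrow> complex) \<Rightarrow> complex"
  assumes \<mu>: "radon_functional \<mu>" and "\<phi> \<in> Cc"
  shows "radon_integral \<mu> \<phi> = \<mu> \<phi>"
proof (rule radon_integral_eq[OF \<mu>])
  show "radon_has_integral \<mu> \<phi> (\<mu> \<phi>)"
    unfolding radon_has_integral_def
    using assms by (auto intro!: bexI[of _ \<phi>] simp: upper_variation_zero)
qed

text \<open>
  In this form integrability of \<open>f\<close> is a conclusion: a sequence in \<open>Cc\<close> that approximates \<open>f\<close> in the upper integral
  has convergent values, and the limit is the integral.
\<close>

lemma radon_has_integral_limit:
  fixes \<mu> :: "('a::t2_space \<Rightarrow> complex) \<Rightarrow> complex"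
  assumes \<mu>: "radon_functional \<mu>" and \<phi>: "\<And>n. \<phi> n \<in> Cc"
    and le: "\<And>n. upper_variation \<mu> (\<lambda>x. ennreal (norm (f x - \<phi> n x))) \<le> ennreal (e n)"
    and e: "\<And>n. 0 \<le> e n" "e \<longlonglongrightarrow> 0"
  shows "(\<lambda>n. \<mu> (\<phi> n)) \<longlonglongrightarrow> radon_integral \<mu> f"
proof -
  have d: "norm (\<mu> (\<phi> m) - \<mu> (\<phi> n)) \<le> e m + e n" for m n
    by (rule radon_diff_le[OF \<mu> \<phi> \<phi> le e(1) le e(1)])
  have "Cauchy (\<lambda>n. \<mu> (\<phi> n))"
  proof (rule CauchyI)
    fix r :: real assume "r > 0"
    then obtain N where N: "\<And>n. n \<ge> N \<Longrightarrow> norm (e n) < r/2"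
      using LIMSEQ_D[OF e(2), of "r/2"] by auto
    show "\<exists>M. \<forall>m\<ge>M. \<forall>n\<ge>M. norm (\<mu> (\<phi> m) - \<mu> (\<phi> n)) < r"
    proof (intro exI allI impI)
      fix m n assume "N \<le> m" "N \<le> n"
      then show "norm (\<mu> (\<phi> m) - \<mu> (\<phi> n)) < r"
        using N[of m] N[of n] d[of m n] e(1)[of m] e(1)[of n] by simp
    qed
  qed
  then obtain c where c: "(\<lambda>n. \<mu> (\<phi> n)) \<longlonglongrightarrow> c"
    using Cauchy_convergent convergent_def by blast
  have "radon_has_integral \<mu> f c"
    unfolding radon_has_integral_def
  proof (intro allI impI)
    fix r :: real assume r: "r > 0"
    have "eventually (\<lambda>n. norm (e n) < r \<and> norm (\<mu> (\<phi> n) - c) < r) sequentially"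
      using tendstoD[OF e(2) r] tendstoD[OF c r] by (simp add: dist_norm eventually_conj)
    then obtain n where n: "norm (e n) < r" "norm (\<mu> (\<phi> n) - c) < r"
      using eventually_happens by force
    moreover have "ennreal (e n) < ennreal r"
      using n e(1)[of n] r by (simp add: ennreal_less_iff)
    ultimately show "\<exists>\<phi>\<in>Cc. upper_variation \<mu> (\<lambda>x. ennreal (norm (f x - \<phi> x))) < ennreal r \<and> norm (\<mu> \<phi> - c) < r"
      using le[of n] \<phi>[of n] by (intro bexI[of _ "\<phi> n"]) (auto intro: le_less_trans)
  qed
  then show ?thesis using c radon_integral_eq[OF \<mu>] by simp
qed

section \<open>Restriction of a measure to a relatively compact open set\<close>

lemma unimodular_rotation:
  fixes w :: complex
  obtains t where "norm t = 1" "t * w = of_real (norm w)"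
proof (cases "w = 0")
  case False
  have "cnj (sgn w) * w = (w * cnj w) / of_real (norm w)"
    by (simp add: sgn_eq mult.commute)
  also have "\<dots> = of_real ((norm w)\<^sup>2) / of_real (norm w)"
    by (simp only: complex_norm_square)
  also have "\<dots> = of_real (norm w)"
    using False by (simp add: power2_eq_square)
  finally show ?thesis using False by (intro that[of "cnj (sgn w)"]) (simp_all add: norm_sgn)
qed (use that[of 1] in auto)

lemma norm_add_rotated:
  fixes z w :: complex
  obtains t where "norm t = 1" "norm (z + t * w) = norm z + norm w"
proof -
  obtain s where s: "norm s = 1" "s * z = of_real (norm z)" by (rule unimodular_rotation)
  obtain t where t: "norm t = 1" "t * w = of_real (norm w)" by (rule unimodular_rotation)
  have "cnj s * s = 1" using complex_norm_square[of s] s(1) by (simp add: mult.commute)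
  moreover have "s * (z + (cnj s * t) * w) = s * z + (cnj s * s) * (t * w)"
    by (simp add: algebra_simps)
  ultimately have "s * (z + (cnj s * t) * w) = of_real (norm z) + of_real (norm w)"
    by (simp only: s(2) t(2) mult_1_left)
  then have "norm (s * (z + (cnj s * t) * w)) = \<bar>norm z + norm w\<bar>"
    by (metis norm_of_real of_real_add)
  then show ?thesis
    using s(1) t(1) by (intro that[of "cnj s * t"]) (simp_all add: norm_mult)
qed

text \<open>
  The restriction is a limit of the functionals \<open>b \<mapsto> \<mu> (\<psi> n * b)\<close>, with one sequence \<open>\<psi>\<close> for all continuous \<open>b\<close>.
  It suffices that the \<open>\<psi> n\<close> nearly exhaust the variation of \<open>\<mu>\<close> on \<open>A\<close>: if \<open>\<bar>\<mu> (p n)\<bar>\<close> is close to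
  the supremum over all functions bounded by the indicator of \<open>A\<close>, then a function below \<open>1 - \<bar>p n\<bar>\<close> on \<open>A\<close>
  has a small value, since after rotation by a phase it could be added to \<open>p n\<close>. Hence \<open>1 - \<bar>p n\<bar>\<close> has small
  upper integral on \<open>A\<close>, and \<open>\<psi> n = \<bar>p n\<bar>\<close> works.
\<close>

lemma restrict_functional_limit:
  fixes \<mu> :: "('a::t2_space \<Rightarrow> complex) \<Rightarrow> complex"
  assumes \<mu>: "radon_functional \<mu>" and A: "open A" "compact (closure A)"
  obtains \<psi> :: "nat \<Rightarrow> 'a \<Rightarrow> real" where
    "\<And>n. continuous_on UNIV (\<psi> n)" "\<And>n x. 0 \<le> \<psi> n x \<and> \<psi> n x \<le> indicator A x"
    "\<And>b. continuous_on UNIV b \<Longrightarrow> (\<lambda>n. \<mu> (\<lambda>x. of_real (\<psi> n x) * b x)) \<longlonglongrightarrow> restrict_functional \<mu> A b"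
proof -
  obtain C where C: "C > 0" "\<And>\<psi> B. \<lbrakk>\<psi> \<in> Cc; \<And>x. x \<notin> closure A \<Longrightarrow> \<psi> x = 0; \<And>x. x \<in> closure A \<Longrightarrow> norm (\<psi> x) \<le> B; B \<ge> 0\<rbrakk>
      \<Longrightarrow> norm (\<mu> \<psi>) \<le> C * B"
    using radon_bound[OF \<mu> A(2)] by metis
  have outA: "x \<notin> A" if "x \<notin> closure A" for x using that closure_subset by blast
  define D where "D = {\<psi>\<in>Cc. \<forall>x. norm (\<psi> x) \<le> indicator A x}"
  have D0: "(\<lambda>_. 0) \<in> D" by (simp add: D_def Cc_zero)
  have bd: "bdd_above ((\<lambda>\<psi>. norm (\<mu> \<psi>)) ` D)"
  proof (rule bdd_aboveI2)
    fix \<psi> assume "\<psi> \<in> D"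
    then have D: "\<psi> \<in> Cc" "\<And>x. norm (\<psi> x) \<le> indicator A x" by (auto simp: D_def)
    have "norm (\<psi> x) \<le> 1" for x using D(2)[of x] by (cases "x \<in> A") auto
    moreover have "\<psi> x = 0" if "x \<notin> closure A" for x using D(2)[of x] outA[OF that] by simp
    ultimately show "norm (\<mu> \<psi>) \<le> C * 1"
      by (intro C(2) D(1)) auto
  qed
  \<comment> \<open>The variation of the functional on the open set.\<close>
  define V where "V = (SUP \<psi>\<in>D. norm (\<mu> \<psi>))"
  have "\<exists>\<psi>\<in>D. V - 1 / real (Suc n) < norm (\<mu> \<psi>)" for n
    unfolding V_def using D0 bd by (subst less_cSUP_iff[symmetric]) auto
  then obtain p where p: "\<And>n. p n \<in> D" "\<And>n. V - 1 / real (Suc n) < norm (\<mu> (p n))"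
    by metis
  have pD: "p n \<in> Cc" "norm (p n x) \<le> indicator A x" for n x
    using p(1)[of n] by (auto simp: D_def)
  show ?thesis
  proof (rule that[of "\<lambda>n x. norm (p n x)"])
    show cp: "continuous_on UNIV (\<lambda>x. norm (p n x))" for n
      using Cc_continuous[OF pD(1)] by (intro continuous_intros)
    show "0 \<le> norm (p n x) \<and> norm (p n x) \<le> indicator A x" for n x
      using pD by auto
    fix b :: "'a \<Rightarrow> complex" assume b: "continuous_on UNIV b"
    obtain B where B: "B > 0" "\<And>x. x \<in> closure A \<Longrightarrow> norm (b x) \<le> B"
      using continuous_bounded_on_compact[OF b A(2)] by metis
    have "upper_variation \<mu> (\<lambda>x. ennreal (norm (indicator A x * b x - of_real (norm (p n x)) * b x)))
        \<le> ennreal (B / real (Suc n))" for n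
    proof (rule upper_variation_le)
      show "lower_semicontinuous (\<lambda>x. if x \<in> A then ennreal (B * (1 - norm (p n x))) else 0)"
        by (intro lower_semicontinuous_on_open A continuous_on_mult continuous_on_diff continuous_on_const cp)
      show "ennreal (norm (indicator A x * b x - of_real (norm (p n x)) * b x))
          \<le> (if x \<in> A then ennreal (B * (1 - norm (p n x))) else 0)" for x
      proof (cases "x \<in> A")
        case True
        then have x: "norm (b x) \<le> B" "norm (p n x) \<le> 1"
          using B(2) closure_subset[of A] pD(2)[of n x] by auto
        have "indicator A x * b x - of_real (norm (p n x)) * b x = of_real (1 - norm (p n x)) * b x"
          using True by (simp add: algebra_simps)
        then have "norm (indicator A x * b x - of_real (norm (p n x)) * b x) = \<bar>1 - norm (p n x)\<bar> * norm (b x)"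
          by (simp only: norm_mult norm_of_real)
        also have "\<dots> = (1 - norm (p n x)) * norm (b x)" using x by simp
        also have "\<dots> \<le> (1 - norm (p n x)) * B"
          using x by (intro mult_left_mono) auto
        finally show ?thesis using True by (simp add: mult.commute ennreal_leI)
      next
        case False
        then show ?thesis using pD(2)[of n x] by simp
      qed
      fix \<phi> assume \<phi>: "\<phi> \<in> Cc" "\<And>x. ennreal (norm (\<phi> x)) \<le> (if x \<in> A then ennreal (B * (1 - norm (p n x))) else 0)"
      have \<phi>A: "norm (\<phi> x) / B + norm (p n x) \<le> indicator A x" for x
      proof (cases "x \<in> A")
        case True
        then have "norm (p n x) \<le> 1" using pD(2)[of n x] by auto
        then have "norm (\<phi> x) \<le> B * (1 - norm (p n x))"
          using \<phi>(2)[of x] True B(1) by (simp add: ennreal_le_iff)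
        then show ?thesis using True B(1) by (simp add: field_simps)
      next
        case False
        then show ?thesis using \<phi>(2)[of x] pD(2)[of n x] by (simp add: ennreal_eq_0_iff)
      qed
      obtain t where t: "norm t = 1" "norm (\<mu> (p n) + t * \<mu> (\<lambda>x. (1/B) * \<phi> x)) = norm (\<mu> (p n)) + norm (\<mu> (\<lambda>x. (1/B) * \<phi> x))"
        using norm_add_rotated by blast
      have "(\<lambda>x. p n x + t * ((1/B) * \<phi> x)) \<in> D"
        unfolding D_def
      proof safe
        show "(\<lambda>x. p n x + t * ((1/B) * \<phi> x)) \<in> Cc"
          using pD \<phi> by (intro Cc_add Cc_scale)
        show "norm (p n x + t * ((1/B) * \<phi> x)) \<le> indicator A x" for x
        proof -
          have "norm (p n x + t * ((1/B) * \<phi> x)) \<le> norm (p n x) + norm (\<phi> x) / B"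
            using norm_triangle_ineq[of "p n x" "t * ((1/B) * \<phi> x)"] t(1) B(1)
            by (simp add: norm_mult norm_divide)
          then show ?thesis using \<phi>A[of x] by linarith
        qed
      qed
      then have "norm (\<mu> (\<lambda>x. p n x + t * ((1/B) * \<phi> x))) \<le> V"
        unfolding V_def using bd by (intro cSUP_upper)
      moreover have "\<mu> (\<lambda>x. p n x + t * ((1/B) * \<phi> x)) = \<mu> (p n) + t * \<mu> (\<lambda>x. (1/B) * \<phi> x)"
        using pD \<phi> by (simp only: radon_add[OF \<mu>] radon_scale[OF \<mu>] Cc_scale)
      ultimately have "norm (\<mu> (\<lambda>x. (1/B) * \<phi> x)) \<le> 1 / real (Suc n)"
        using t(2) p(2)[of n] by simp
      moreover have "norm (\<mu> (\<lambda>x. (1/B) * \<phi> x)) = norm (\<mu> \<phi>) / B"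
        using B(1) by (simp only: radon_scale[OF \<mu> \<phi>(1)]) (simp add: norm_divide)
      ultimately have "norm (\<mu> \<phi>) / B \<le> 1 / real (Suc n)"
        by simp
      then have "B * (norm (\<mu> \<phi>) / B) \<le> B * (1 / real (Suc n))"
        using B(1) by (intro mult_left_mono) auto
      then show "norm (\<mu> \<phi>) \<le> B / real (Suc n)"
        using B(1) by simp
    qed
    then show "(\<lambda>n. \<mu> (\<lambda>x. of_real (norm (p n x)) * b x)) \<longlonglongrightarrow> restrict_functional \<mu> A b"
      unfolding restrict_functional_def
    proof (rule radon_has_integral_limit[OF \<mu>, rotated])
      show "(\<lambda>n. B / real (Suc n)) \<longlonglongrightarrow> 0"
        using LIMSEQ_Suc[OF lim_const_over_n[of B]] by simp
      show "(\<lambda>x. of_real (norm (p n x)) * b x) \<in> Cc" for n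
        by (rule Cc_mult(1)[OF Cc_norm[OF pD(1)] b])
      show "0 \<le> B / real (Suc n)" for n using B(1) by simp
    qed
  qed
qed

text \<open>
  Through the approximating sequence the restriction becomes a bounded linear functional on all continuous
  functions, not only on those of compact support. This is what allows characters to be integrated against it.
\<close>

lemma
  fixes \<mu> :: "('a::t2_space \<Rightarrow> complex) \<Rightarrow> complex"
  assumes \<mu>: "radon_functional \<mu>" and A: "open A" "compact (closure A)"
  shows restrict_functional_add: "continuous_on UNIV b \<Longrightarrow> continuous_on UNIV c \<Longrightarrow>
      restrict_functional \<mu> A (\<lambda>x. b x + c x) = restrict_functional \<mu> A b + restrict_functional \<mu> A c"
    and restrict_functional_scale: "continuous_on UNIV b \<Longrightarrow>
      restrict_functional \<mu> A (\<lambda>x. z * b x) = z * restrict_functional \<mu> A b"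
    and restrict_functional_bound: "\<exists>C>0. \<forall>b B. continuous_on UNIV b \<longrightarrow> (\<forall>x\<in>closure A. norm (b x) \<le> B) \<longrightarrow> 0 \<le> B \<longrightarrow>
      norm (restrict_functional \<mu> A b) \<le> C * B"
proof -
  obtain \<psi> where \<psi>: "\<And>n. continuous_on UNIV (\<psi> n)" "\<And>n x. 0 \<le> \<psi> n x \<and> \<psi> n x \<le> indicator A x"
    "\<And>b. continuous_on UNIV b \<Longrightarrow> (\<lambda>n. \<mu> (\<lambda>x. of_real (\<psi> n x) * b x)) \<longlonglongrightarrow> restrict_functional \<mu> A b"
    by (rule restrict_functional_limit[OF \<mu> A], rule that)
  have \<psi>0: "\<psi> n x = 0" if "x \<notin> closure A" for n x
    using that closure_subset[of A] \<psi>(2)[of n x] by (cases "x \<in> A") auto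
  have \<psi>b: "(\<lambda>x. of_real (\<psi> n x) * b x) \<in> Cc" if "continuous_on UNIV b" for n b
  proof (rule CcI[OF _ A(2)])
    show "continuous_on UNIV (\<lambda>x. of_real (\<psi> n x) * b x)"
      by (intro continuous_on_mult continuous_on_of_real \<psi>(1) that)
  qed (simp add: \<psi>0)
  show "restrict_functional \<mu> A (\<lambda>x. b x + c x) = restrict_functional \<mu> A b + restrict_functional \<mu> A c"
    if b: "continuous_on UNIV b" and c: "continuous_on UNIV c"
  proof (rule LIMSEQ_unique)
    show "(\<lambda>n. \<mu> (\<lambda>x. of_real (\<psi> n x) * (b x + c x))) \<longlonglongrightarrow> restrict_functional \<mu> A (\<lambda>x. b x + c x)"
      by (intro \<psi>(3) continuous_on_add b c)
    show "(\<lambda>n. \<mu> (\<lambda>x. of_real (\<psi> n x) * (b x + c x))) \<longlonglongrightarrow> restrict_functional \<mu> A b + restrict_functional \<mu> A c"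
      using tendsto_add[OF \<psi>(3)[OF b] \<psi>(3)[OF c]] by (simp add: distrib_left radon_add[OF \<mu>] \<psi>b b c)
  qed
  show "restrict_functional \<mu> A (\<lambda>x. z * b x) = z * restrict_functional \<mu> A b"
    if b: "continuous_on UNIV b"
  proof (rule LIMSEQ_unique)
    show "(\<lambda>n. \<mu> (\<lambda>x. of_real (\<psi> n x) * (z * b x))) \<longlonglongrightarrow> restrict_functional \<mu> A (\<lambda>x. z * b x)"
      by (intro \<psi>(3) continuous_on_mult continuous_on_const b)
    have "(\<lambda>n. \<mu> (\<lambda>x. z * (of_real (\<psi> n x) * b x))) \<longlonglongrightarrow> z * restrict_functional \<mu> A b"
      using tendsto_mult_left[OF \<psi>(3)[OF b], of z] by (simp only: radon_scale[OF \<mu> \<psi>b[OF b]])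
    then show "(\<lambda>n. \<mu> (\<lambda>x. of_real (\<psi> n x) * (z * b x))) \<longlonglongrightarrow> z * restrict_functional \<mu> A b"
      by (simp add: mult.left_commute)
  qed
  obtain C where C: "C > 0" "\<And>\<psi> B. \<lbrakk>\<psi> \<in> Cc; \<And>x. x \<notin> closure A \<Longrightarrow> \<psi> x = 0; \<And>x. x \<in> closure A \<Longrightarrow> norm (\<psi> x) \<le> B; B \<ge> 0\<rbrakk>
      \<Longrightarrow> norm (\<mu> \<psi>) \<le> C * B"
    using radon_bound[OF \<mu> A(2)] by metis
  show "\<exists>C>0. \<forall>b B. continuous_on UNIV b \<longrightarrow> (\<forall>x\<in>closure A. norm (b x) \<le> B) \<longrightarrow> 0 \<le> B \<longrightarrow>
      norm (restrict_functional \<mu> A b) \<le> C * B"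
  proof (intro exI conjI allI impI)
    fix b :: "'a \<Rightarrow> complex" and B :: real
    assume b: "continuous_on UNIV b" "\<forall>x\<in>closure A. norm (b x) \<le> B" "0 \<le> B"
    have "norm (\<mu> (\<lambda>x. of_real (\<psi> n x) * b x)) \<le> C * B" for n
    proof (rule C(2)[OF \<psi>b[OF b(1)]])
      fix x assume "x \<in> closure A"
      then have "norm (b x) \<le> B" "\<bar>\<psi> n x\<bar> \<le> 1"
        using b \<psi>(2)[of n x] by (auto intro: order_trans[OF _ indicator_le_1])
      then show "norm (of_real (\<psi> n x) * b x) \<le> B"
        using mult_mono[of "\<bar>\<psi> n x\<bar>" 1 "norm (b x)" B] by (simp add: norm_mult)
    qed (use \<psi>0 b in auto)
    then show "norm (restrict_functional \<mu> A b) \<le> C * B"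
      by (intro LIMSEQ_le_const2[OF tendsto_norm[OF \<psi>(3)[OF b(1)]]]) auto
  qed (use C in auto)
qed

section \<open>Characters, damping, and the mass of a point of the dual\<close>

lemma char_norm [simp]: "norm (char_apply \<xi> x) = 1"
  and char_add: "char_apply \<xi> (x + y) = char_apply \<xi> x * char_apply \<xi> y"
  and char_continuous: "continuous_on UNIV (char_apply \<xi>)"
  using char_apply[of \<xi>] by auto

lemma char_mult_cnj: "char_apply \<xi> x * cnj (char_apply \<xi> x) = 1"
  using complex_norm_square[of "char_apply \<xi> x"] by simp

lemma open_char_eval: "open U \<Longrightarrow> open {\<xi>. char_apply \<xi> s \<in> U}"
  unfolding open_dual_def
proof (rule generate_topology.Basis, safe)
  assume "open U"
  then show "\<exists>K V. {\<xi>. char_apply \<xi> s \<in> U} = {\<xi>. char_apply \<xi> ` K \<subseteq> V} \<and> compact K \<and> open V"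
    by (intro exI[of _ "{s}"] exI[of _ U]) auto
qed

lemma continuous_char_eval: "continuous_on UNIV (\<lambda>\<xi>. char_apply \<xi> s)"
  using open_char_eval by (auto simp: continuous_on_open_vimage[OF open_UNIV] vimage_def)

instance dual :: (topological_ab_group_add) t2_space
proof
  fix \<xi> \<eta> :: "'a dual" assume "\<xi> \<noteq> \<eta>"
  then obtain s where "char_apply \<xi> s \<noteq> char_apply \<eta> s"
    by (metis char_apply_inject ext)
  then obtain U V where UV: "open U" "open V" "char_apply \<xi> s \<in> U" "char_apply \<eta> s \<in> V" "U \<inter> V = {}"
    using hausdorff[of "char_apply \<xi> s" "char_apply \<eta> s"] by auto
  then show "\<exists>U V. open U \<and> open V \<and> \<xi> \<in> U \<and> \<eta> \<in> V \<and> U \<inter> V = {}"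
    by (intro exI[of _ "{\<zeta>. char_apply \<zeta> s \<in> U}"] exI[of _ "{\<zeta>. char_apply \<zeta> s \<in> V}"])
      (auto simp: open_char_eval)
qed

text \<open>
  The square of the modulus of the factor by which \<open>\<phi>\<^sup>\<and>(\<eta>)\<close> changes when \<open>\<phi>\<close> is averaged successively with
  \<open>\<xi>(s) \<phi>(\<cdot> - s)\<close> for the entries \<open>s\<close> of the list. Lists are used because concatenation
  corresponds to the product, so that the family is directed downwards.
\<close>

definition damping :: "'a::topological_ab_group_add dual \<Rightarrow> 'a list \<Rightarrow> 'a dual \<Rightarrow> real" where
  "damping \<xi> l \<eta> = (\<Prod>s\<leftarrow>l. (norm ((1 + char_apply \<xi> s * cnj (char_apply \<eta> s)) / 2))\<^sup>2)"

lemma norm_midpoint_unit_circle: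
  assumes "norm z = 1"
  shows "(norm ((1 + z) / 2))\<^sup>2 = (1 + Re z) / 2"
proof -
  have "(Re z)\<^sup>2 + (Im z)\<^sup>2 = 1" using cmod_power2[of z] assms by simp
  moreover have "(norm ((1 + z) / 2))\<^sup>2 = ((1 + Re z) / 2)\<^sup>2 + (Im z / 2)\<^sup>2"
    by (subst cmod_power2) simp
  ultimately show ?thesis by (simp add: power2_eq_square field_simps)
qed

lemma damping_Nil [simp]: "damping \<xi> [] \<eta> = 1"
  and damping_append: "damping \<xi> (l @ l') \<eta> = damping \<xi> l \<eta> * damping \<xi> l' \<eta>"
  by (simp_all add: damping_def)

lemma damping_Cons: "damping \<xi> (s # l) \<eta> =
    (1 + Re (char_apply \<xi> s * cnj (char_apply \<eta> s))) / 2 * damping \<xi> l \<eta>"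
proof -
  have "norm (char_apply \<xi> s * cnj (char_apply \<eta> s)) = 1" by (simp add: norm_mult)
  from norm_midpoint_unit_circle[OF this] show ?thesis
    by (simp only: damping_def list.map prod_list.Cons)
qed

lemma damping_factor_range:
  "0 \<le> (1 + Re (char_apply \<xi> s * cnj (char_apply \<eta> s))) / 2"
  "(1 + Re (char_apply \<xi> s * cnj (char_apply \<eta> s))) / 2 \<le> 1"
  using abs_Re_le_cmod[of "char_apply \<xi> s * cnj (char_apply \<eta> s)"] by (auto simp: norm_mult)

lemma damping_range: "0 \<le> damping \<xi> l \<eta> \<and> damping \<xi> l \<eta> \<le> 1"
proof (induction l)
  case (Cons s l)
  then show ?case
    unfolding damping_Cons using damping_factor_range[of \<xi> s \<eta>]
    by (metis mult_le_one mult_nonneg_nonneg)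
qed simp

lemma damping_self [simp]: "damping \<xi> l \<xi> = 1"
  by (induction l) (simp_all add: damping_Cons char_mult_cnj)

lemma continuous_damping: "continuous_on S (damping \<xi> l)"
proof -
  have "continuous_on UNIV (damping \<xi> l)"
  proof (induction l)
    case Nil
    then show ?case by (simp add: damping_Nil[abs_def])
  next
    case (Cons s l)
    then show ?case
      unfolding damping_Cons[abs_def] by (intro continuous_intros continuous_char_eval) auto
  qed
  then show ?thesis using continuous_on_subset by blast
qed

text \<open>
  The midpoint of two distinct points of the unit circle lies strictly inside the disc.
\<close>

lemma damping_less_one:
  assumes "char_apply \<xi> s \<noteq> char_apply \<eta> s" "s \<in> set l"
  shows "damping \<xi> l \<eta> < 1"
  using assms(2)
proof (induction l)
  case (Cons r l)
  let ?w = "\<lambda>s. (1 + Re (char_apply \<xi> s * cnj (char_apply \<eta> s))) / 2"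
  show ?case
  proof (cases "r = s")
    case True
    have "Re (char_apply \<xi> s * cnj (char_apply \<eta> s)) \<noteq> 1"
    proof
      assume 1: "Re (char_apply \<xi> s * cnj (char_apply \<eta> s)) = 1"
      have "norm (char_apply \<xi> s * cnj (char_apply \<eta> s)) = 1" by (simp add: norm_mult)
      with 1 have "char_apply \<xi> s * cnj (char_apply \<eta> s) = 1"
        using cmod_power2[of "char_apply \<xi> s * cnj (char_apply \<eta> s)"] by (simp add: complex_eq_iff)
      then have "char_apply \<xi> s * (char_apply \<eta> s * cnj (char_apply \<eta> s)) = char_apply \<eta> s"
        by (metis mult.commute mult.left_commute mult_1_right)
      then show False using assms(1) by (simp add: char_mult_cnj)
    qed
    then have "?w r < 1" using damping_factor_range(2)[of \<xi> s \<eta>] True by simp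
    moreover have "?w r * damping \<xi> l \<eta> \<le> ?w r"
      using damping_range[of \<xi> l \<eta>] damping_factor_range(1)[of \<xi> r \<eta>] by (simp add: mult_left_le)
    ultimately show ?thesis unfolding damping_Cons by linarith
  next
    case False
    then have "damping \<xi> l \<eta> < 1" using Cons by auto
    moreover have "?w r * damping \<xi> l \<eta> \<le> damping \<xi> l \<eta>"
      using damping_range[of \<xi> l \<eta>] damping_factor_range[of \<xi> r \<eta>] by (metis mult_left_le_one_le)
    ultimately show ?thesis unfolding damping_Cons by linarith
  qed
qed simp

text \<open>
  Each character in \<open>C\<close> is separated from \<open>\<xi>\<close> by some group element, on a whole neighbourhood. By compactness one finite
  list \<open>l\<close> of group elements gives a factor below 1 throughout \<open>C\<close>; its maximum there is some \<open>r < 1\<close>, and repeating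
  the list \<open>N\<close> times gives the bound \<open>r ^ N\<close>.
\<close>

lemma damping_small:
  assumes C: "compact C" "\<xi> \<notin> C" and e: "e > 0"
  obtains l where "\<And>\<eta>. \<eta> \<in> C \<Longrightarrow> damping \<xi> l \<eta> \<le> e"
proof -
  have "\<exists>s. char_apply \<xi> s \<noteq> char_apply \<eta> s" if "\<eta> \<in> C" for \<eta>
    using that C(2) by (metis char_apply_inject ext)
  then obtain s where s: "\<And>\<eta>. \<eta> \<in> C \<Longrightarrow> char_apply \<xi> (s \<eta>) \<noteq> char_apply \<eta> (s \<eta>)" by metis
  define W where "W \<eta> = {\<zeta>. char_apply \<zeta> (s \<eta>) \<in> - {char_apply \<xi> (s \<eta>)}}" for \<eta>
  have op: "open (W \<eta>)" for \<eta>
    unfolding W_def by (rule open_char_eval) auto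
  have "C \<subseteq> (\<Union>\<eta>\<in>C. W \<eta>)"
  proof
    fix \<eta> assume "\<eta> \<in> C"
    moreover from s[OF this] have "\<eta> \<in> W \<eta>" by (simp add: W_def)
    ultimately show "\<eta> \<in> (\<Union>\<eta>\<in>C. W \<eta>)" by (rule UN_I)
  qed
  then obtain D where D: "D \<subseteq> C" "finite D" "C \<subseteq> (\<Union>\<eta>\<in>D. W \<eta>)"
    using compactE_image[OF C(1), of C W] op by metis
  obtain l where l: "set l = s ` D"
    using finite_list[OF finite_imageI[OF D(2), of s]] ..
  have l1: "damping \<xi> l \<eta> < 1" if \<eta>: "\<eta> \<in> C" for \<eta>
  proof -
    obtain \<zeta> where \<zeta>: "\<zeta> \<in> D" "\<eta> \<in> W \<zeta>" using D(3) \<eta> by blast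
    show ?thesis
      by (rule damping_less_one[of _ "s \<zeta>"]) (use \<zeta> l in \<open>auto simp: W_def\<close>)
  qed
  have "\<exists>r<1. \<forall>\<eta>\<in>C. damping \<xi> l \<eta> \<le> r"
  proof (cases "C = {}")
    case False
    obtain \<zeta> where "\<zeta> \<in> C" "\<forall>\<eta>\<in>C. damping \<xi> l \<eta> \<le> damping \<xi> l \<zeta>"
      using continuous_attains_sup[OF C(1) False continuous_damping[of C \<xi> l]] by auto
    then show ?thesis using l1[of \<zeta>] by auto
  qed (auto intro: exI[of _ 0])
  then obtain r where r: "r < 1" "\<And>\<eta>. \<eta> \<in> C \<Longrightarrow> damping \<xi> l \<eta> \<le> r" by blast
  \<comment> \<open>If C is empty, the bound r may be negative.\<close>
  obtain N where N: "(max r 0) ^ N < e"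
    using real_arch_pow_inv[OF e, of "max r 0"] r(1) by auto
  show ?thesis
  proof (rule that[of "concat (replicate N l)"])
    fix \<eta> assume \<eta>: "\<eta> \<in> C"
    have "damping \<xi> (concat (replicate N l)) \<eta> = damping \<xi> l \<eta> ^ N"
      by (induction N) (simp_all add: damping_append)
    also have "\<dots> \<le> (max r 0) ^ N"
      using r(2)[OF \<eta>] damping_range[of \<xi> l \<eta>] by (intro power_mono) auto
    finally show "damping \<xi> (concat (replicate N l)) \<eta> \<le> e" using N by simp
  qed
qed

lemma Cc_damping:
  assumes "\<psi> \<in> Cc"
  shows "(\<lambda>\<eta>. of_real (damping \<xi> l \<eta>) * \<psi> \<eta>) \<in> Cc"
  by (intro Cc_mult(2) assms continuous_on_of_real continuous_damping)

text \<open>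
  Where \<open>\<psi>\<close> is small nothing has to be done; the rest of its support is a compact set that omits \<open>\<xi>\<close>.
\<close>

lemma damping_null:
  fixes \<nu> :: "('a::topological_ab_group_add dual \<Rightarrow> complex) \<Rightarrow> complex"
  assumes \<nu>: "radon_functional \<nu>" and \<psi>: "\<psi> \<in> Cc" "\<psi> \<xi> = 0" and e: "e > 0"
  obtains l where "norm (\<nu> (\<lambda>\<eta>. of_real (damping \<xi> l \<eta>) * \<psi> \<eta>)) \<le> e"
proof -
  obtain K where K: "compact K" "\<And>\<eta>. \<eta> \<notin> K \<Longrightarrow> \<psi> \<eta> = 0"
    using CcE[OF \<psi>(1)] by metis
  obtain C where C: "C > 0" "\<And>\<phi> B. \<lbrakk>\<phi> \<in> Cc; \<And>x. x \<notin> K \<Longrightarrow> \<phi> x = 0; \<And>x. x \<in> K \<Longrightarrow> norm (\<phi> x) \<le> B; B \<ge> 0\<rbrakk>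
      \<Longrightarrow> norm (\<nu> \<phi>) \<le> C * B"
    using radon_bound[OF \<nu> K(1)] by metis
  obtain B where B: "B > 0" "\<And>\<eta>. norm (\<psi> \<eta>) \<le> B"
    using Cc_bounded[OF \<psi>(1)] by metis
  define d where "d = e / C"
  have d: "d > 0" using e C by (simp add: d_def)
  have "closed {\<eta>. d \<le> norm (\<psi> \<eta>)}"
    using Cc_continuous[OF \<psi>(1)] by (intro closed_Collect_le continuous_intros) auto
  then have "compact (K \<inter> {\<eta>. d \<le> norm (\<psi> \<eta>)})"
    using K(1) by (rule compact_Int_closed[rotated])
  then obtain l where l: "\<And>\<eta>. \<eta> \<in> K \<inter> {\<eta>. d \<le> norm (\<psi> \<eta>)} \<Longrightarrow> damping \<xi> l \<eta> \<le> d / B"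
    by (rule damping_small[of _ \<xi> "d / B"]) (use \<psi>(2) d B(1) in auto)
  have "norm (\<nu> (\<lambda>\<eta>. of_real (damping \<xi> l \<eta>) * \<psi> \<eta>)) \<le> C * d"
  proof (rule C(2)[OF Cc_damping[OF \<psi>(1)]])
    fix \<eta> assume \<eta>: "\<eta> \<in> K"
    have n: "norm (of_real (damping \<xi> l \<eta>) * \<psi> \<eta>) = damping \<xi> l \<eta> * norm (\<psi> \<eta>)"
      using damping_range[of \<xi> l \<eta>] by (simp add: norm_mult)
    show "norm (of_real (damping \<xi> l \<eta>) * \<psi> \<eta>) \<le> d"
    proof (cases "d \<le> norm (\<psi> \<eta>)")
      case True
      then have "damping \<xi> l \<eta> * norm (\<psi> \<eta>) \<le> d / B * B"
        using l[of \<eta>] \<eta> B(2)[of \<eta>] d B(1) by (intro mult_mono) auto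
      then show ?thesis using n B(1) by simp
    next
      case False
      have "damping \<xi> l \<eta> * norm (\<psi> \<eta>) \<le> 1 * norm (\<psi> \<eta>)"
        using damping_range[of \<xi> l \<eta>] by (intro mult_right_mono) auto
      then show ?thesis using n False by simp
    qed
  qed (use K d in auto)
  then show ?thesis using that C(1) by (simp add: d_def)
qed

text \<open>
  After rotation by a phase the value at \<open>\<phi>\<close> is the value at the real part, and that is below the value at \<open>h\<close> by
  positivity. Applied to \<open>h - k\<close>, positivity also shows that values at real functions are real.
\<close>

lemma positive_functional_norm_le:
  fixes \<nu> :: "('a::t2_space \<Rightarrow> complex) \<Rightarrow> complex"
  assumes \<nu>: "radon_functional \<nu>" "positive_functional \<nu>"
    and \<phi>: "\<phi> \<in> Cc" and h: "(\<lambda>x. of_real (h x)) \<in> Cc" and le: "\<And>x. norm (\<phi> x) \<le> h x"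
  shows "norm (\<nu> \<phi>) \<le> Re (\<nu> (\<lambda>x. of_real (h x)))"
proof -
  have pos: "\<nu> (\<lambda>x. of_real (k x)) \<in> \<real> \<and> 0 \<le> Re (\<nu> (\<lambda>x. of_real (k x)))"
    if "(\<lambda>x. of_real (k x)) \<in> Cc" "\<And>x. 0 \<le> k x" for k :: "'a \<Rightarrow> real"
    using \<nu>(2) that unfolding positive_functional_def by auto
  have h0: "0 \<le> h x" for x using le[of x] norm_ge_zero order_trans by blast
  have real: "\<nu> (\<lambda>x. of_real (k x)) \<in> \<real> \<and> Re (\<nu> (\<lambda>x. of_real (k x))) \<le> Re (\<nu> (\<lambda>x. of_real (h x)))"
    if k: "(\<lambda>x. of_real (k x)) \<in> Cc" "\<And>x. \<bar>k x\<bar> \<le> h x" for k :: "'a \<Rightarrow> real"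
  proof -
    have eq: "(\<lambda>x. complex_of_real (h x - k x)) = (\<lambda>x. of_real (h x) - of_real (k x))" by auto
    have "(\<lambda>x. complex_of_real (h x - k x)) \<in> Cc" unfolding eq by (intro Cc_diff h k)
    then have "\<nu> (\<lambda>x. of_real (h x - k x)) \<in> \<real>" "0 \<le> Re (\<nu> (\<lambda>x. of_real (h x - k x)))"
      using pos[of "\<lambda>x. h x - k x"] k(2) by (auto simp: abs_le_iff)
    moreover have "\<nu> (\<lambda>x. of_real (h x - k x)) = \<nu> (\<lambda>x. of_real (h x)) - \<nu> (\<lambda>x. of_real (k x))"
      unfolding eq by (rule radon_diff[OF \<nu>(1) h k(1)])
    moreover have "\<nu> (\<lambda>x. of_real (h x)) \<in> \<real>" using pos[OF h h0] by blast
    ultimately show ?thesis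
      by (metis (no_types, lifting) Reals_diff diff_diff_eq2 add_diff_cancel_left' diff_ge_0_iff_ge minus_complex.simps(1))
  qed
  obtain t where t: "norm t = 1" "t * \<nu> \<phi> = of_real (norm (\<nu> \<phi>))"
    by (rule unimodular_rotation)
  define p q where "p x = Re (t * \<phi> x)" and "q x = Im (t * \<phi> x)" for x
  have bound: "\<bar>p x\<bar> \<le> h x" "\<bar>q x\<bar> \<le> h x" for x
    using abs_Re_le_cmod[of "t * \<phi> x"] abs_Im_le_cmod[of "t * \<phi> x"] le[of x] t(1)
    by (auto simp: p_def q_def norm_mult)
  have cont: "continuous_on UNIV \<phi>" using Cc_continuous[OF \<phi>] .
  have p: "(\<lambda>x. complex_of_real (p x)) \<in> Cc"
    by (rule Cc_dominated[OF \<phi>]) (auto simp: p_def[abs_def] intro!: continuous_intros cont)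
  have q: "(\<lambda>x. complex_of_real (q x)) \<in> Cc"
    by (rule Cc_dominated[OF \<phi>]) (auto simp: q_def[abs_def] intro!: continuous_intros cont)
  have "t * \<nu> \<phi> = \<nu> (\<lambda>x. t * \<phi> x)"
    using radon_scale[OF \<nu>(1) \<phi>] by simp
  also have "(\<lambda>x. t * \<phi> x) = (\<lambda>x. of_real (p x) + \<i> * of_real (q x))"
    by (simp add: p_def q_def complex_eq_iff fun_eq_iff)
  also have "\<nu> \<dots> = \<nu> (\<lambda>x. of_real (p x)) + \<i> * \<nu> (\<lambda>x. of_real (q x))"
    using radon_add[OF \<nu>(1) p Cc_scale[OF q, of \<i>]] radon_scale[OF \<nu>(1) q, of \<i>] by simp
  finally have "Re (t * \<nu> \<phi>) = Re (\<nu> (\<lambda>x. of_real (p x))) - Im (\<nu> (\<lambda>x. of_real (q x)))"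
    by simp
  moreover have "\<nu> (\<lambda>x. of_real (q x)) \<in> \<real>" using real[OF q bound(2)] by blast
  ultimately have "norm (\<nu> \<phi>) = Re (\<nu> (\<lambda>x. of_real (p x)))"
    unfolding t(2) by (simp add: complex_is_Real_iff)
  also have "\<dots> \<le> Re (\<nu> (\<lambda>x. of_real (h x)))" using real[OF p bound(1)] by blast
  finally show ?thesis .
qed

text \<open>
  A Dini argument. The function \<open>damping l * \<psi>\<close> exceeds the indicator of \<open>{\<xi>}\<close> by a lower semicontinuous
  function \<open>g\<close>, namely itself off \<open>\<xi>\<close> and 0 at \<open>\<xi>\<close>. If \<open>\<bar>\<phi>\<bar> \<le> g\<close>, then \<open>\<phi>\<close> vanishes at \<open>\<xi>\<close>, so a further damping
  by \<open>k\<close> makes the integral of \<open>\<bar>\<phi>\<bar>\<close> small, and for the remaining part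
  \<open>(1 - damping k) \<bar>\<phi>\<bar> \<le> damping l * \<psi> - damping (k @ l) * \<psi>\<close>. So the upper integral of \<open>g\<close> is
  at most the difference between the integral of \<open>damping l * \<psi>\<close> and the infimum of all such integrals.
\<close>

lemma point_mass_integrable:
  fixes \<nu> :: "('a::topological_ab_group_add dual \<Rightarrow> complex) \<Rightarrow> complex" and \<psi> :: "'a dual \<Rightarrow> real"
  assumes \<nu>: "radon_functional \<nu>" "positive_functional \<nu>"
    and \<psi>: "(\<lambda>\<eta>. of_real (\<psi> \<eta>)) \<in> Cc" "\<And>\<eta>. 0 \<le> \<psi> \<eta>" "\<psi> \<xi> = 1"
  shows "radon_has_integral \<nu> (indicator {\<xi>})
     (of_real (INF l. Re (\<nu> (\<lambda>\<eta>. of_real (damping \<xi> l \<eta> * \<psi> \<eta>)))))"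
proof -
  define R where "R l = Re (\<nu> (\<lambda>\<eta>. of_real (damping \<xi> l \<eta> * \<psi> \<eta>)))" for l
  define m where "m = (INF l. R l)"
  have w0: "0 \<le> damping \<xi> l \<eta>" "damping \<xi> l \<eta> \<le> 1" for l \<eta>
    using damping_range[of \<xi> l \<eta>] by auto
  have Cc: "(\<lambda>\<eta>. complex_of_real (damping \<xi> l \<eta> * \<psi> \<eta>)) \<in> Cc" for l
    using Cc_damping[OF \<psi>(1), of \<xi> l] by simp
  have pos: "\<nu> (\<lambda>\<eta>. of_real (damping \<xi> l \<eta> * \<psi> \<eta>)) \<in> \<real> \<and> 0 \<le> R l" for l
    using \<nu>(2) Cc[of l] w0 \<psi>(2) unfolding positive_functional_def R_def by auto
  have bdd: "bdd_below (range R)" using pos by (intro bdd_belowI2[of _ 0]) auto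
  have mR: "m \<le> R l" for l unfolding m_def by (rule cINF_lower[OF bdd]) auto
  have c\<psi>: "continuous_on UNIV \<psi>"
    using continuous_on_Re[OF Cc_continuous[OF \<psi>(1)]] by simp
  have uv: "upper_variation \<nu> (\<lambda>\<eta>. ennreal (norm (indicator {\<xi>} \<eta> - complex_of_real (damping \<xi> l \<eta> * \<psi> \<eta>))))
      \<le> ennreal (R l - m)" for l
  proof (rule upper_variation_le)
    let ?g = "\<lambda>\<eta>. if \<eta> \<in> - {\<xi>} then ennreal (damping \<xi> l \<eta> * \<psi> \<eta>) else 0"
    show "lower_semicontinuous ?g"
      by (intro lower_semicontinuous_on_open continuous_on_mult continuous_damping c\<psi>) auto
    show "ennreal (norm (indicator {\<xi>} \<eta> - complex_of_real (damping \<xi> l \<eta> * \<psi> \<eta>))) \<le> ?g \<eta>" for \<eta>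
      using w0 \<psi>(2,3) by (cases "\<eta> = \<xi>") (auto simp: norm_mult)
    fix \<phi> assume \<phi>: "\<phi> \<in> Cc" "\<And>\<eta>. ennreal (norm (\<phi> \<eta>)) \<le> ?g \<eta>"
    have \<phi>0: "\<phi> \<xi> = 0" using \<phi>(2)[of \<xi>] by (simp add: ennreal_eq_0_iff)
    have \<phi>le: "norm (\<phi> \<eta>) \<le> damping \<xi> l \<eta> * \<psi> \<eta>" for \<eta>
    proof (cases "\<eta> = \<xi>")
      case False
      then show ?thesis using \<phi>(2)[of \<eta>] w0(1)[of l \<eta>] \<psi>(2)[of \<eta>] by (simp add: ennreal_le_iff)
    qed (use \<phi>0 \<psi>(3) in simp)
    show "norm (\<nu> \<phi>) \<le> R l - m"
    proof (rule field_le_epsilon)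
      fix d :: real assume d: "d > 0"
      obtain k where k: "norm (\<nu> (\<lambda>\<eta>. of_real (damping \<xi> k \<eta>) * of_real (norm (\<phi> \<eta>)))) \<le> d"
        using damping_null[OF \<nu>(1) Cc_norm[OF \<phi>(1)] _ d, of \<xi>] \<phi>0 by auto
      let ?h = "\<lambda>\<eta>. damping \<xi> l \<eta> * \<psi> \<eta> - damping \<xi> (k @ l) \<eta> * \<psi> \<eta> + damping \<xi> k \<eta> * norm (\<phi> \<eta>)"
      have eq: "(\<lambda>\<eta>. complex_of_real (?h \<eta>)) = (\<lambda>\<eta>. (of_real (damping \<xi> l \<eta> * \<psi> \<eta>) -
         of_real (damping \<xi> (k @ l) \<eta> * \<psi> \<eta>)) + of_real (damping \<xi> k \<eta>) * of_real (norm (\<phi> \<eta>)))"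
        by auto
      have Ck: "(\<lambda>\<eta>. complex_of_real (damping \<xi> k \<eta>) * of_real (norm (\<phi> \<eta>))) \<in> Cc"
        by (rule Cc_damping[OF Cc_norm[OF \<phi>(1)]])
      have "norm (\<nu> \<phi>) \<le> Re (\<nu> (\<lambda>\<eta>. of_real (?h \<eta>)))"
      proof (rule positive_functional_norm_le[OF \<nu> \<phi>(1)])
        show "(\<lambda>\<eta>. complex_of_real (?h \<eta>)) \<in> Cc"
          unfolding eq by (intro Cc_add Cc_diff Cc Ck)
        fix \<eta>
        have "norm (\<phi> \<eta>) * (1 - damping \<xi> k \<eta>) \<le> damping \<xi> l \<eta> * \<psi> \<eta> * (1 - damping \<xi> k \<eta>)"
          using \<phi>le[of \<eta>] w0(2)[of k \<eta>] by (intro mult_right_mono) auto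
        then show "norm (\<phi> \<eta>) \<le> ?h \<eta>" by (simp add: damping_append algebra_simps)
      qed
      also have "\<nu> (\<lambda>\<eta>. of_real (?h \<eta>)) = \<nu> (\<lambda>\<eta>. of_real (damping \<xi> l \<eta> * \<psi> \<eta>)) -
         \<nu> (\<lambda>\<eta>. of_real (damping \<xi> (k @ l) \<eta> * \<psi> \<eta>)) + \<nu> (\<lambda>\<eta>. of_real (damping \<xi> k \<eta>) * of_real (norm (\<phi> \<eta>)))"
        unfolding eq by (simp only: radon_add[OF \<nu>(1)] radon_diff[OF \<nu>(1)] Cc_diff Cc Ck)
      also have "Re \<dots> = R l - R (k @ l) + Re (\<nu> (\<lambda>\<eta>. of_real (damping \<xi> k \<eta>) * of_real (norm (\<phi> \<eta>))))"
        by (simp only: R_def plus_complex.simps minus_complex.simps)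
      also have "Re (\<nu> (\<lambda>\<eta>. of_real (damping \<xi> k \<eta>) * of_real (norm (\<phi> \<eta>)))) \<le> d"
        using k complex_Re_le_cmod order_trans by blast
      finally show "norm (\<nu> \<phi>) \<le> R l - m + d" using mR[of "k @ l"] by linarith
    qed
  qed
  have "radon_has_integral \<nu> (indicator {\<xi>}) (of_real m)"
    unfolding radon_has_integral_def
  proof (intro allI impI)
    fix e :: real assume e: "e > 0"
    have "\<exists>l. R l < m + e"
      using e cINF_less_iff[OF _ bdd, of "m + e"] unfolding m_def by auto
    then obtain l where l: "R l < m + e" by blast
    have "\<nu> (\<lambda>\<eta>. of_real (damping \<xi> l \<eta> * \<psi> \<eta>)) = of_real (R l)"
      using pos[of l] by (simp add: R_def)
    then have "norm (\<nu> (\<lambda>\<eta>. of_real (damping \<xi> l \<eta> * \<psi> \<eta>)) - of_real m) = \<bar>R l - m\<bar>"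
      by (metis of_real_diff norm_of_real)
    moreover have "ennreal (R l - m) < ennreal e"
      using l e mR[of l] by (simp add: ennreal_less_iff)
    ultimately show "\<exists>\<phi>\<in>Cc. upper_variation \<nu> (\<lambda>x. ennreal (norm (indicator {\<xi>} x - \<phi> x))) < ennreal e \<and>
        norm (\<nu> \<phi> - of_real m) < e"
      using l mR[of l] uv[of l] Cc[of l]
      by (intro bexI[of _ "\<lambda>\<eta>. of_real (damping \<xi> l \<eta> * \<psi> \<eta>)"] conjI) (auto intro: le_less_trans)
  qed
  then show ?thesis unfolding m_def R_def .
qed

text \<open>
  If \<open>\<psi> \<xi> = 0\<close>, this is \<open>damping_null\<close>. Otherwise \<open>\<bar>\<psi>\<bar>\<close> divided by its value at \<open>\<xi>\<close> serves as the function \<open>\<psi>\<close> of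
  \<open>point_mass_integrable\<close>, so that the infimum of its damped integrals is the mass of \<open>{\<xi>}\<close>.
\<close>

lemma damping_null_of_no_point_mass:
  fixes \<nu> :: "('a::topological_ab_group_add dual \<Rightarrow> complex) \<Rightarrow> complex"
  assumes \<nu>: "radon_functional \<nu>" "positive_functional \<nu>" and null: "measure_of_set \<nu> {\<xi>} = 0"
    and \<psi>: "\<psi> \<in> Cc" and e: "e > 0"
  obtains l where "norm (\<nu> (\<lambda>\<eta>. of_real (damping \<xi> l \<eta>) * \<psi> \<eta>)) \<le> e"
proof (cases "\<psi> \<xi> = 0")
  case True
  then show ?thesis using damping_null[OF \<nu>(1) \<psi> _ e] that by blast
next
  case False
  define a where "a = norm (\<psi> \<xi>)"
  have a: "a > 0" using False by (simp add: a_def)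
  define \<psi>1 where "\<psi>1 \<eta> = norm (\<psi> \<eta>) / a" for \<eta>
  have \<psi>1: "(\<lambda>\<eta>. complex_of_real (\<psi>1 \<eta>)) \<in> Cc"
    using Cc_scale[OF Cc_norm[OF \<psi>], of "of_real (1 / a)"] by (simp add: \<psi>1_def)
  define R where "R l = Re (\<nu> (\<lambda>\<eta>. of_real (damping \<xi> l \<eta> * \<psi>1 \<eta>)))" for l
  have Cc: "(\<lambda>\<eta>. complex_of_real (damping \<xi> l \<eta> * \<psi>1 \<eta>)) \<in> Cc" for l
    using Cc_damping[OF \<psi>1, of \<xi> l] by simp
  have "radon_has_integral \<nu> (indicator {\<xi>}) (of_real (INF l. R l))"
    unfolding R_def
    by (rule point_mass_integrable[OF \<nu> \<psi>1]) (use a in \<open>auto simp: \<psi>1_def a_def\<close>)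
  then have 0: "(INF l. R l) = 0"
    using null radon_integral_eq[OF \<nu>(1)] unfolding measure_of_set_def by force
  have pos: "0 \<le> R l" for l
    using \<nu>(2) Cc[of l] damping_range[of \<xi> l] a unfolding positive_functional_def R_def
    by (auto simp: \<psi>1_def)
  have bdd: "bdd_below (range R)" using pos by (intro bdd_belowI2[of _ 0]) auto
  have "\<exists>l. R l < e / a"
    using cINF_less_iff[OF _ bdd, of "e / a"] 0 e a by auto
  then obtain l where l: "R l < e / a" by blast
  have ca: "(\<lambda>\<eta>. complex_of_real (damping \<xi> l \<eta> * norm (\<psi> \<eta>))) =
      (\<lambda>\<eta>. of_real a * of_real (damping \<xi> l \<eta> * \<psi>1 \<eta>))"
    using a by (auto simp: \<psi>1_def)
  have "norm (\<nu> (\<lambda>\<eta>. of_real (damping \<xi> l \<eta>) * \<psi> \<eta>)) \<le>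
      Re (\<nu> (\<lambda>\<eta>. of_real (damping \<xi> l \<eta> * norm (\<psi> \<eta>))))"
  proof (rule positive_functional_norm_le[OF \<nu> Cc_damping[OF \<psi>]])
    show "(\<lambda>\<eta>. complex_of_real (damping \<xi> l \<eta> * norm (\<psi> \<eta>))) \<in> Cc"
      unfolding ca by (rule Cc_scale[OF Cc])
    show "norm (of_real (damping \<xi> l \<eta>) * \<psi> \<eta>) \<le> damping \<xi> l \<eta> * norm (\<psi> \<eta>)" for \<eta>
      using damping_range[of \<xi> l \<eta>] by (simp add: norm_mult)
  qed
  also have "\<dots> = a * R l"
    unfolding ca radon_scale[OF \<nu>(1) Cc] R_def by simp
  also have "\<dots> \<le> e" using l a by (simp add: field_simps)
  finally show ?thesis by (rule that)
qed

text \<open>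
  Damping does not increase the distance between \<open>F\<close> and an approximation \<open>\<psi> \<in> Cc\<close>, because the factors are at
  most 1. So the question for an integrable \<open>F\<close> reduces to \<open>\<psi>\<close>, with one approximation for all \<open>l\<close>.
\<close>

lemma damped_integral_null:
  fixes \<nu> :: "('a::topological_ab_group_add dual \<Rightarrow> complex) \<Rightarrow> complex"
  assumes \<nu>: "radon_functional \<nu>" "positive_functional \<nu>" and null: "measure_of_set \<nu> {\<xi>} = 0"
    and F: "\<And>l. radon_has_integral \<nu> (\<lambda>\<eta>. of_real (damping \<xi> l \<eta>) * F \<eta>) (q l)" and e: "e > 0"
  obtains l where "norm (q l) \<le> e"
proof -
  have "radon_has_integral \<nu> F (q [])" using F[of "[]"] by simp
  then obtain \<psi> where \<psi>: "\<psi> \<in> Cc" "upper_variation \<nu> (\<lambda>x. ennreal (norm (F x - \<psi> x))) < ennreal (e / 2)"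
    using e unfolding radon_has_integral_def by (meson half_gt_zero)
  obtain l where l: "norm (\<nu> (\<lambda>\<eta>. of_real (damping \<xi> l \<eta>) * \<psi> \<eta>)) \<le> e / 2"
    using damping_null_of_no_point_mass[OF \<nu> null \<psi>(1), of "e/2"] e by auto
  have "upper_variation \<nu> (\<lambda>\<eta>. ennreal (norm (of_real (damping \<xi> l \<eta>) * F \<eta> - of_real (damping \<xi> l \<eta>) * \<psi> \<eta>)))
      \<le> upper_variation \<nu> (\<lambda>x. ennreal (norm (F x - \<psi> x)))"
  proof (rule upper_variation_mono, rule ennreal_leI)
    fix \<eta>
    have "norm (of_real (damping \<xi> l \<eta>) * F \<eta> - of_real (damping \<xi> l \<eta>) * \<psi> \<eta>) = damping \<xi> l \<eta> * norm (F \<eta> - \<psi> \<eta>)"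
      using damping_range[of \<xi> l \<eta>] by (simp add: norm_mult flip: right_diff_distrib)
    also have "\<dots> \<le> 1 * norm (F \<eta> - \<psi> \<eta>)"
      using damping_range[of \<xi> l \<eta>] by (intro mult_right_mono) auto
    finally show "norm (of_real (damping \<xi> l \<eta>) * F \<eta> - of_real (damping \<xi> l \<eta>) * \<psi> \<eta>) \<le> norm (F \<eta> - \<psi> \<eta>)"
      by simp
  qed
  also have "\<dots> \<le> ennreal (e / 2)" using \<psi>(2) by simp
  finally have "norm (q l - \<nu> (\<lambda>\<eta>. of_real (damping \<xi> l \<eta>) * \<psi> \<eta>)) \<le> e / 2"
    by (rule radon_has_integral_le[OF \<nu>(1) F Cc_damping[OF \<psi>(1)]]) (use e in simp)
  then have "norm (q l) \<le> e"
    using l norm_triangle_ineq2[of "q l" "\<nu> (\<lambda>\<eta>. of_real (damping \<xi> l \<eta>) * \<psi> \<eta>)"] by linarith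
  then show ?thesis by (rule that)
qed

section \<open>Haar measure and the interchange of integrals\<close>

lemma haar_sets: "haar_measure H \<Longrightarrow> sets H = sets borel"
  by (simp add: haar_measure_def)

lemma haar_space: "haar_measure H \<Longrightarrow> space H = UNIV"
  using sets_eq_imp_space_eq[OF haar_sets] by simp

lemma haar_compact_finite: "haar_measure H \<Longrightarrow> compact K \<Longrightarrow> emeasure H K < \<infinity>"
  by (simp add: haar_measure_def)

lemma haar_continuous_measurable:
  fixes h :: "'a::topological_ab_group_add \<Rightarrow> 'b::topological_space"
  assumes "haar_measure H" "continuous_on UNIV h"
  shows "h \<in> borel_measurable H"
  using borel_measurable_continuous_onI[OF assms(2)]
  by (simp add: measurable_cong_sets[OF haar_sets[OF assms(1)] refl])

lemma haar_compact_sets: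
  fixes K :: "'a::{topological_ab_group_add,t2_space} set"
  assumes "haar_measure H" "compact K"
  shows "K \<in> sets H"
  using haar_sets[OF assms(1)] borel_compact[OF assms(2)] by simp

lemma haar_integrable:
  fixes h :: "'a::{topological_ab_group_add,t2_space} \<Rightarrow> complex"
  assumes H: "haar_measure H" and h: "h \<in> Cc"
  shows "integrable H h"
proof -
  obtain K where K: "compact K" "\<And>x. x \<notin> K \<Longrightarrow> h x = 0" using CcE[OF h] by metis
  obtain B where B: "\<And>x. norm (h x) \<le> B" using Cc_bounded[OF h] by metis
  show ?thesis
    by (rule integrableI_bounded_set[where A=K and B=B])
      (use K B haar_compact_sets[OF H K(1)] haar_compact_finite[OF H K(1)]
        haar_continuous_measurable[OF H Cc_continuous[OF h]] in auto)
qed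

lemma integral_bound_on_set:
  fixes h :: "'a \<Rightarrow> 'b::{banach, second_countable_topology}"
  assumes L: "L \<in> sets M" "emeasure M L < \<infinity>" and h: "integrable M h"
    and le: "\<And>x. x \<notin> L \<Longrightarrow> h x = 0" "\<And>x. x \<in> L \<Longrightarrow> norm (h x) \<le> B" and "0 \<le> B"
  shows "norm (\<integral>x. h x \<partial>M) \<le> B * measure M L"
proof -
  have int: "integrable M (\<lambda>x. B * indicator L x)"
    using L by (intro integrable_mult_right integrable_real_indicator)
  have "norm (\<integral>x. h x \<partial>M) \<le> (\<integral>x. norm (h x) \<partial>M)" by (rule integral_norm_bound)
  also have "\<dots> \<le> (\<integral>x. B * indicator L x \<partial>M)"
  proof (rule integral_mono)
    show "norm (h x) \<le> B * indicator L x" for x using le[of x] by (cases "x \<in> L") auto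
  qed (use h int in auto)
  also have "\<dots> = B * measure M L" using L by simp
  finally show ?thesis .
qed

lemma haar_translate:
  assumes H: "haar_measure H" and B: "B \<in> sets H"
  shows "emeasure H ((\<lambda>x. t + x) ` B) = emeasure H B"
proof -
  have "\<forall>t. \<forall>B\<in>sets borel. emeasure H ((\<lambda>x. t + x) ` B) = emeasure H B"
    using H unfolding haar_measure_def by (elim conjE)
  then show ?thesis using B haar_sets[OF H] by blast
qed

lemma haar_integral_translate:
  fixes h :: "'a::{topological_ab_group_add,t2_space} \<Rightarrow> complex"
  assumes H: "haar_measure H" and h: "continuous_on UNIV h"
  shows "(\<integral>x. h (x + t) \<partial>H) = (\<integral>x. h x \<partial>H)"
proof -
  have cont: "continuous_on UNIV (\<lambda>x::'a. x + t)" by (intro continuous_intros)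
  have meas: "(\<lambda>x. x + t) \<in> measurable H H"
    using borel_measurable_continuous_onI[OF cont]
    by (simp add: measurable_cong_sets[OF haar_sets[OF H] haar_sets[OF H]])
  have "distr H H (\<lambda>x. x + t) = H"
  proof (rule measure_eqI)
    fix B assume "B \<in> sets (distr H H (\<lambda>x. x + t))"
    then have B: "B \<in> sets H" by simp
    have "(\<lambda>x. x + t) -` B = (\<lambda>x. (- t) + x) ` B"
    proof (intro set_eqI iffI)
      fix x assume "x \<in> (\<lambda>x. x + t) -` B"
      then show "x \<in> (\<lambda>x. (- t) + x) ` B" by (intro image_eqI[of _ _ "x + t"]) auto
    qed auto
    then have "emeasure (distr H H (\<lambda>x. x + t)) B = emeasure H ((\<lambda>x. (- t) + x) ` B)"
      using B meas by (simp add: emeasure_distr haar_space[OF H])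
    also have "\<dots> = emeasure H B"
      by (rule haar_translate[OF H B])
    finally show "emeasure (distr H H (\<lambda>x. x + t)) B = emeasure H B" .
  qed simp
  then show ?thesis
    using integral_distr[OF meas haar_continuous_measurable[OF H h]] by simp
qed

text \<open>
  The points \<open>d i\<close> and weights \<open>c i\<close> depend only on the cover \<open>X\<close>, so the same sum approximates the integral of every
  \<open>g\<close> that varies little on the sets \<open>X t\<close>. The weights are the measures of the sets in a partition of \<open>L\<close> that is
  subordinate to a finite subcover.
\<close>

lemma haar_riemann_sum:
  fixes H :: "'a::{topological_ab_group_add,t2_space} measure"
  assumes H: "haar_measure H" and L: "compact L"
    and X: "\<And>t. t \<in> L \<Longrightarrow> open (X t) \<and> t \<in> X t"
  obtains n :: nat and d :: "nat \<Rightarrow> 'a" and c :: "nat \<Rightarrow> complex" where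
    "\<And>(g::'a \<Rightarrow> complex) B. \<lbrakk>continuous_on UNIV g; \<And>t. t \<notin> L \<Longrightarrow> g t = 0;
       \<And>t t'. t \<in> L \<Longrightarrow> t' \<in> X t \<Longrightarrow> norm (g t' - g t) \<le> B; 0 \<le> B\<rbrakk>
       \<Longrightarrow> norm ((\<integral>t. g t \<partial>H) - (\<Sum>i<n. c i * g (d i))) \<le> B * measure H L"
proof -
  have "\<exists>D\<subseteq>L. finite D \<and> L \<subseteq> (\<Union>t\<in>D. X t)"
    by (rule compactE_image[OF L, of L X]) (use X in blast)+
  then obtain D where D: "D \<subseteq> L" "finite D" "L \<subseteq> (\<Union>t\<in>D. X t)" by blast
  obtain n :: nat and d where nd: "D = d ` {i. i < n}"
    using finite_imp_nat_seg_image_inj_on[OF D(2)] by blast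
  have dL: "d i \<in> L" if "i < n" for i using D(1) nd that by auto
  define E where "E i = (if i < n then X (d i) else {})" for i
  define P where "P i = disjointed E i \<inter> L" for i
  have LH: "L \<in> sets H" "emeasure H L < \<infinity>"
    using haar_compact_sets[OF H L] haar_compact_finite[OF H L] by auto
  have EH: "E i \<in> sets H" for i
    using X[OF dL] haar_sets[OF H] by (auto simp: E_def)
  have "disjointed E i \<in> sets H" for i
    using sets.range_disjointed_sets[of E H] EH by blast
  then have PH: "P i \<in> sets H" for i unfolding P_def using LH by blast
  have Pfin: "emeasure H (P i) < \<infinity>" for i
    using emeasure_mono[of "P i" L H] LH by (auto simp: P_def intro: le_less_trans)
  have PX: "t \<in> X (d i) \<and> t \<in> L \<and> i < n" if "t \<in> P i" for t i
    using that disjointed_subset[of E i] by (auto simp: P_def E_def split: if_splits)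
  have uniq: "i = j" if "t \<in> P i" "t \<in> P j" for t i j
    using that disjoint_family_disjointed[of E] by (auto simp: P_def disjoint_family_on_def)
  have cover: "\<exists>i<n. t \<in> P i" if t: "t \<in> L" for t
  proof -
    have "t \<in> (\<Union>i. E i)" using D(3) t nd by (auto simp: E_def)
    then have "t \<in> (\<Union>i. disjointed E i)" by (simp add: UN_disjointed_eq)
    then show ?thesis using PX t by (auto simp: P_def)
  qed
  show ?thesis
  proof (rule that[where n=n and d=d and c="\<lambda>i. of_real (measure H (P i))"])
    fix g :: "'a \<Rightarrow> complex" and B :: real
    assume g: "continuous_on UNIV g" "\<And>t. t \<notin> L \<Longrightarrow> g t = 0"
      "\<And>t t'. t \<in> L \<Longrightarrow> t' \<in> X t \<Longrightarrow> norm (g t' - g t) \<le> B" "0 \<le> B"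
    define s where "s t = (\<Sum>i<n. indicator (P i) t *\<^sub>R g (d i))" for t
    have intP: "integrable H (\<lambda>t. indicator (P i) t *\<^sub>R g (d i))" for i
      by (intro integrable_scaleR_left integrable_real_indicator PH Pfin)
    have gi: "integrable H g" using H g L by (intro haar_integrable CcI) auto
    have si: "integrable H s" unfolding s_def using intP by (intro Bochner_Integration.integrable_sum)
    have "(\<integral>t. s t \<partial>H) = (\<Sum>i<n. \<integral>t. indicator (P i) t *\<^sub>R g (d i) \<partial>H)"
      unfolding s_def using intP by (intro Bochner_Integration.integral_sum)
    also have "\<dots> = (\<Sum>i<n. of_real (measure H (P i)) * g (d i))"
    proof (intro sum.cong refl)
      fix i
      have "(\<integral>t. indicator (P i) t *\<^sub>R g (d i) \<partial>H) = (\<integral>t. indicator (P i) t \<partial>H) *\<^sub>R g (d i)"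
        using PH Pfin by (intro integral_scaleR_left integrable_real_indicator)
      then show "(\<integral>t. indicator (P i) t *\<^sub>R g (d i) \<partial>H) = of_real (measure H (P i)) * g (d i)"
        using PH haar_space[OF H] by (simp add: scaleR_conv_of_real)
    qed
    finally have s: "(\<integral>t. s t \<partial>H) = (\<Sum>i<n. of_real (measure H (P i)) * g (d i))" .
    have "norm (\<integral>t. g t - s t \<partial>H) \<le> B * measure H L"
    proof (rule integral_bound_on_set[OF LH])
      show "integrable H (\<lambda>t. g t - s t)" using gi si by simp
      show "g t - s t = 0" if "t \<notin> L" for t
      proof -
        have "t \<notin> P i" for i using that PX by blast
        then show ?thesis using g(2)[OF that] by (simp add: s_def)
      qed
      show "norm (g t - s t) \<le> B" if "t \<in> L" for t
      proof -
        obtain i where i: "i < n" "t \<in> P i" using cover[OF \<open>t \<in> L\<close>] by blast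
        have "s t = (\<Sum>j<n. if j = i then g (d j) else 0)"
          unfolding s_def using i(2) uniq by (intro sum.cong) (auto simp: indicator_def)
        then have "s t = g (d i)" using i(1) by simp
        then show ?thesis using g(3)[OF dL[OF i(1)]] PX[OF i(2)] by simp
      qed
    qed (rule g(4))
    then show "norm ((\<integral>t. g t \<partial>H) - (\<Sum>i<n. of_real (measure H (P i)) * g (d i))) \<le> B * measure H L"
      using gi si s by simp
  qed
qed

lemma continuous_on_UNIV_eps:
  fixes f :: "'b::topological_space \<Rightarrow> complex"
  assumes "\<And>x e. e > 0 \<Longrightarrow> \<exists>X. open X \<and> x \<in> X \<and> (\<forall>y\<in>X. norm (f y - f x) \<le> e)"
  shows "continuous_on UNIV f"
  unfolding continuous_on_def
proof (intro ballI tendstoI)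
  fix x :: 'b and e :: real assume "e > 0"
  then obtain X where X: "open X" "x \<in> X" "\<forall>y\<in>X. norm (f y - f x) \<le> e / 2"
    using assms[of "e/2" x] by auto
  then have "\<forall>y\<in>X. dist (f y) (f x) < e"
    using \<open>e > 0\<close> by (fastforce simp: dist_norm)
  then show "eventually (\<lambda>y. dist (f y) (f x) < e) (at x)"
    using X by (auto simp: eventually_at_topological)
qed

text \<open>
  By compactness of \<open>K\<close>, \<open>F x t\<close> depends on \<open>t\<close> continuously and uniformly for \<open>x \<in> K\<close>, and \<open>M\<close> is controlled by the
  values on \<open>K\<close>.
\<close>

lemma functional_parameter_Cc:
  fixes M :: "('b::topological_space \<Rightarrow> complex) \<Rightarrow> complex" and F :: "'b \<Rightarrow> 'a::t2_space \<Rightarrow> complex"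
  assumes S: "\<And>t. (\<lambda>x. F x t) \<in> S" "\<And>f g. f \<in> S \<Longrightarrow> g \<in> S \<Longrightarrow> (\<lambda>x. f x - g x) \<in> S \<and> M (\<lambda>x. f x - g x) = M f - M g"
    and bound: "C > 0" "\<And>f B. f \<in> S \<Longrightarrow> (\<And>x. x \<in> K \<Longrightarrow> norm (f x) \<le> B) \<Longrightarrow> 0 \<le> B \<Longrightarrow> norm (M f) \<le> C * B"
    and F: "continuous_on UNIV (\<lambda>(x, t). F x t)" and K: "compact K" and L: "compact L"
    and zero: "\<And>x t. x \<in> K \<Longrightarrow> t \<notin> L \<Longrightarrow> F x t = 0"
  shows "(\<lambda>t. M (\<lambda>x. F x t)) \<in> Cc" and "\<And>t. t \<notin> L \<Longrightarrow> M (\<lambda>x. F x t) = 0"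
proof -
  show z: "M (\<lambda>x. F x t) = 0" if "t \<notin> L" for t
    using bound(2)[OF S(1)[of t], of 0] zero that by simp
  show "(\<lambda>t. M (\<lambda>x. F x t)) \<in> Cc"
  proof (rule CcI[OF continuous_on_UNIV_eps L z])
    fix t :: 'a and e :: real assume e: "e > 0"
    have "continuous_on (UNIV \<times> K) (\<lambda>p. (\<lambda>(x, t). F x t) (snd p, fst p))"
      by (rule continuous_on_compose2[OF F]) (auto intro!: continuous_intros)
    then obtain X where "t \<in> X" "open X" "\<forall>t'\<in>X \<inter> UNIV. \<forall>x\<in>K.
          dist ((\<lambda>p. (\<lambda>(x, t). F x t) (snd p, fst p)) (t', x)) ((\<lambda>p. (\<lambda>(x, t). F x t) (snd p, fst p)) (t, x)) \<le> e / C"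
      by (rule continuous_on_prod_compactE[OF _ K UNIV_I, of _ "e / C" t]) (use e bound(1) in simp)
    then have X: "t \<in> X" "open X" "\<forall>t'\<in>X. \<forall>x\<in>K. dist (F x t') (F x t) \<le> e / C" by auto
    have "norm (M (\<lambda>x. F x t') - M (\<lambda>x. F x t)) \<le> e" if "t' \<in> X" for t'
    proof -
      have "norm (M (\<lambda>x. F x t' - F x t)) \<le> C * (e / C)"
        using S X that e bound(1) by (intro bound(2)) (auto simp: dist_norm)
      then show ?thesis using S bound(1) by simp
    qed
    then show "\<exists>X. open X \<and> t \<in> X \<and> (\<forall>y\<in>X. norm (M (\<lambda>x. F x y) - M (\<lambda>x. F x t)) \<le> e)"
      using X by blast
  qed
qed

text \<open>
  Interchange of a functional with a Haar integral. The domain \<open>S\<close> is left open since the lemma is applied to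
  functionals on continuous functions as well as to functionals on functions supported in a fixed
  compact set. Both sides are compared with the same finite sum: a cover adapted to \<open>F\<close>, uniformly in \<open>x \<in> K\<close>,
  makes it approximate the inner integral on the right uniformly on \<open>K\<close>, and the outer integral on the left.
\<close>

lemma haar_fubini:
  fixes M :: "('b::topological_space \<Rightarrow> complex) \<Rightarrow> complex" and F :: "'b \<Rightarrow> 'a::{topological_ab_group_add,t2_space} \<Rightarrow> complex"
  assumes H: "haar_measure H"
    and add: "\<And>f g. f \<in> S \<Longrightarrow> g \<in> S \<Longrightarrow> (\<lambda>x. f x + g x) \<in> S \<and> M (\<lambda>x. f x + g x) = M f + M g"
    and scale: "\<And>f c. f \<in> S \<Longrightarrow> (\<lambda>x. c * f x) \<in> S \<and> M (\<lambda>x. c * f x) = c * M f"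
    and bound: "C > 0" "\<And>f B. f \<in> S \<Longrightarrow> (\<And>x. x \<in> K \<Longrightarrow> norm (f x) \<le> B) \<Longrightarrow> 0 \<le> B \<Longrightarrow> norm (M f) \<le> C * B"
    and F: "continuous_on UNIV (\<lambda>(x, t). F x t)" and K: "compact K" and L: "compact L"
    and zero: "\<And>x t. x \<in> K \<Longrightarrow> t \<notin> L \<Longrightarrow> F x t = 0"
    and S: "\<And>t. (\<lambda>x. F x t) \<in> S" "(\<lambda>x. \<integral>t. F x t \<partial>H) \<in> S"
  shows "(\<integral>t. M (\<lambda>x. F x t) \<partial>H) = M (\<lambda>x. \<integral>t. F x t \<partial>H)"
proof -
  have diff: "(\<lambda>x. f x - g x) \<in> S \<and> M (\<lambda>x. f x - g x) = M f - M g" if "f \<in> S" "g \<in> S" for f g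
    using add[OF that(1), of "\<lambda>x. - 1 * g x"] scale[OF that(2), of "-1"] by simp
  have G: "(\<lambda>t. M (\<lambda>x. F x t)) \<in> Cc" "\<And>t. t \<notin> L \<Longrightarrow> M (\<lambda>x. F x t) = 0"
    by (rule functional_parameter_Cc[where M=M and F=F and S=S, OF S(1) diff bound F K L zero]; assumption)+
  have sum: "(\<lambda>x. \<Sum>i<n. c i * F x (d i)) \<in> S \<and> M (\<lambda>x. \<Sum>i<n. c i * F x (d i)) = (\<Sum>i<n. c i * M (\<lambda>x. F x (d i)))"
    for n :: nat and c d
  proof (induction n)
    case 0
    then show ?case using scale[OF S(2), of 0] by simp
  next
    case (Suc n)
    then show ?case
      using add[of "\<lambda>x. \<Sum>i<n. c i * F x (d i)" "\<lambda>x. c n * F x (d n)"] scale[OF S(1)] by simp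
  qed
  have "norm ((\<integral>t. M (\<lambda>x. F x t) \<partial>H) - M (\<lambda>x. \<integral>t. F x t \<partial>H)) \<le> 0 + r" if r: "r > 0" for r
  proof -
    \<comment> \<open>The summand 1 avoids a division by 0.\<close>
    define e where "e = r / (2 * C * measure H L + 1)"
    have pos: "2 * C * measure H L + 1 > 0" using bound(1) by (simp add: add_nonneg_pos)
    then have e: "e > 0" using r by (simp add: e_def)
    have cF: "continuous_on (UNIV \<times> K) (\<lambda>p. (\<lambda>(x, t). F x t) (snd p, fst p))"
      by (rule continuous_on_compose2[OF F]) (auto intro!: continuous_intros)
    have "\<exists>X. open X \<and> t \<in> X \<and> (\<forall>t'\<in>X. \<forall>x\<in>K. norm (F x t' - F x t) \<le> e)" for t
    proof -
      obtain X where "t \<in> X" "open X" "\<forall>t'\<in>X \<inter> UNIV. \<forall>x\<in>K.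
          dist ((\<lambda>p. (\<lambda>(x, t). F x t) (snd p, fst p)) (t', x)) ((\<lambda>p. (\<lambda>(x, t). F x t) (snd p, fst p)) (t, x)) \<le> e"
        by (rule continuous_on_prod_compactE[OF cF K UNIV_I e, of t])
      then show ?thesis by (intro exI[of _ X]) (simp add: dist_norm)
    qed
    then obtain X where X: "\<And>t. open (X t) \<and> t \<in> X t \<and> (\<forall>t'\<in>X t. \<forall>x\<in>K. norm (F x t' - F x t) \<le> e)"
      by metis
    obtain n d c where R: "\<And>(g::'a \<Rightarrow> complex) B. \<lbrakk>continuous_on UNIV g; \<And>t. t \<notin> L \<Longrightarrow> g t = 0;
       \<And>t t'. t \<in> L \<Longrightarrow> t' \<in> X t \<Longrightarrow> norm (g t' - g t) \<le> B; 0 \<le> B\<rbrakk>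
       \<Longrightarrow> norm ((\<integral>t. g t \<partial>H) - (\<Sum>i<(n::nat). c i * g (d i))) \<le> B * measure H L"
      by (rule haar_riemann_sum[OF H L, of X]) (use X in blast)+
    have 1: "norm ((\<integral>t. M (\<lambda>x. F x t) \<partial>H) - (\<Sum>i<n. c i * M (\<lambda>x. F x (d i)))) \<le> C * e * measure H L"
    proof (rule R)
      fix t t' assume "t' \<in> X t"
      then have "norm (M (\<lambda>x. F x t' - F x t)) \<le> C * e"
        using X[of t] e by (intro bound(2)) (auto simp: diff S)
      then show "norm (M (\<lambda>x. F x t') - M (\<lambda>x. F x t)) \<le> C * e" by (simp add: diff S)
    next
      show "continuous_on UNIV (\<lambda>t. M (\<lambda>x. F x t))" by (rule Cc_continuous[OF G(1)])
      show "M (\<lambda>x. F x t) = 0" if "t \<notin> L" for t by (rule G(2)[OF that])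
    qed (use e bound(1) in simp)
    have "norm (M (\<lambda>x. (\<integral>t. F x t \<partial>H) - (\<Sum>i<n. c i * F x (d i)))) \<le> C * (e * measure H L)"
    proof (rule bound(2))
      show "(\<lambda>x. (\<integral>t. F x t \<partial>H) - (\<Sum>i<n. c i * F x (d i))) \<in> S" using diff[OF S(2)] sum by blast
      fix x assume x: "x \<in> K"
      show "norm ((\<integral>t. F x t \<partial>H) - (\<Sum>i<n. c i * F x (d i))) \<le> e * measure H L"
      proof (rule R)
        have "continuous_on UNIV (\<lambda>t. (\<lambda>(x, t). F x t) (x, t))"
          by (rule continuous_on_compose2[OF F]) (auto intro!: continuous_intros)
        then show "continuous_on UNIV (F x)" by simp
      qed (use X zero[OF x] e x in auto)
    qed (use e in simp)
    then have 2: "norm (M (\<lambda>x. \<integral>t. F x t \<partial>H) - (\<Sum>i<n. c i * M (\<lambda>x. F x (d i)))) \<le> C * e * measure H L"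
      using diff[OF S(2)] sum by (simp add: mult.assoc)
    have "norm ((\<integral>t. M (\<lambda>x. F x t) \<partial>H) - M (\<lambda>x. \<integral>t. F x t \<partial>H)) \<le> e * (2 * C * measure H L)"
      using norm_triangle_ineq4[of "(\<integral>t. M (\<lambda>x. F x t) \<partial>H) - (\<Sum>i<n. c i * M (\<lambda>x. F x (d i)))"
        "M (\<lambda>x. \<integral>t. F x t \<partial>H) - (\<Sum>i<n. c i * M (\<lambda>x. F x (d i)))"] 1 2
      unfolding diff_diff_eq2 diff_add_cancel by (simp add: algebra_simps)
    also have "\<dots> \<le> e * (2 * C * measure H L + 1)" using e by (intro mult_left_mono) auto
    also have "\<dots> = r" using pos by (simp add: e_def)
    finally show ?thesis by simp
  qed
  then have "norm ((\<integral>t. M (\<lambda>x. F x t) \<partial>H) - M (\<lambda>x. \<integral>t. F x t \<partial>H)) \<le> 0" by (rule field_le_epsilon)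
  then show ?thesis by simp
qed

lemma haar_parameter_continuous:
  fixes F :: "'b::topological_space \<Rightarrow> 'a::{topological_ab_group_add,t2_space} \<Rightarrow> complex"
  assumes H: "haar_measure H"
    and F: "continuous_on UNIV (\<lambda>(x, t). F x t)" and L: "compact L"
    and zero: "\<And>x t. t \<notin> L \<Longrightarrow> F x t = 0"
  shows "continuous_on UNIV (\<lambda>x. \<integral>t. F x t \<partial>H)"
proof (rule continuous_on_UNIV_eps)
  fix x and r :: real assume r: "r > 0"
  define e where "e = r / (measure H L + 1)"
  have pos: "measure H L + 1 > 0" by (simp add: add_nonneg_pos)
  then have e: "e > 0" using r by (simp add: e_def)
  have cont: "continuous_on UNIV (F x)" for x
  proof -
    have "continuous_on UNIV (\<lambda>t. (\<lambda>(x, t). F x t) (x, t))"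
      by (rule continuous_on_compose2[OF F]) (auto intro!: continuous_intros)
    then show ?thesis by simp
  qed
  have int: "integrable H (F x)" for x
    by (intro haar_integrable[OF H] CcI[OF cont L] zero)
  have F': "continuous_on (UNIV \<times> L) (\<lambda>(x, t). F x t)" using F continuous_on_subset by blast
  obtain X where X: "x \<in> X" "open X" "\<forall>y\<in>X \<inter> UNIV. \<forall>t\<in>L. dist ((\<lambda>(x, t). F x t) (y, t)) ((\<lambda>(x, t). F x t) (x, t)) \<le> e"
    by (rule continuous_on_prod_compactE[OF F' L UNIV_I e, of x])
  have "norm ((\<integral>t. F y t \<partial>H) - (\<integral>t. F x t \<partial>H)) \<le> r" if "y \<in> X" for y
  proof -
    have "norm (\<integral>t. F y t - F x t \<partial>H) \<le> e * measure H L"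
      by (rule integral_bound_on_set)
        (use haar_compact_sets[OF H L] haar_compact_finite[OF H L] int zero X that e in \<open>auto simp: dist_norm\<close>)
    also have "\<dots> \<le> e * (measure H L + 1)" using e by (intro mult_left_mono) auto
    also have "\<dots> = r" using pos by (simp add: e_def)
    finally show ?thesis using int by simp
  qed
  then show "\<exists>X. open X \<and> x \<in> X \<and> (\<forall>y\<in>X. norm ((\<integral>t. F y t \<partial>H) - (\<integral>t. F x t \<partial>H)) \<le> r)"
    using X by blast
qed

lemma compact_set_plus:
  fixes K L :: "'a::topological_ab_group_add set"
  assumes "compact K" "compact L"
  shows "compact {a + b | a b. a \<in> K \<and> b \<in> L}" "compact {a - b | a b. a \<in> K \<and> b \<in> L}"
proof -
  have "{a + b | a b. a \<in> K \<and> b \<in> L} = (\<lambda>p. fst p + snd p) ` (K \<times> L)" by force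
  moreover have "compact ((\<lambda>p. fst p + snd p) ` (K \<times> L))"
    using assms by (intro compact_continuous_image compact_Times continuous_intros)
  ultimately show "compact {a + b | a b. a \<in> K \<and> b \<in> L}" by simp
  have "{a - b | a b. a \<in> K \<and> b \<in> L} = (\<lambda>p. fst p + - snd p) ` (K \<times> L)" by force
  moreover have "compact ((\<lambda>p. fst p + - snd p) ` (K \<times> L))"
    using assms by (intro compact_continuous_image compact_Times continuous_intros)
  ultimately show "compact {a - b | a b. a \<in> K \<and> b \<in> L}" by simp
qed

lemma compact_uminus_image:
  fixes K :: "'a::topological_ab_group_add set"
  shows "compact K \<Longrightarrow> compact (uminus ` K)"
  by (intro compact_continuous_image continuous_intros)

text \<open>
  By inner regularity some compact set has positive Haar measure, and local compactness provides an Urysohn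
  function that is 1 on this set and has compact support.
\<close>

lemma haar_bump:
  fixes H :: "'a::{topological_ab_group_add,t2_space} measure"
  assumes lc: "locally compact (UNIV :: 'a set)" and H: "haar_measure H"
  obtains b :: "'a \<Rightarrow> complex" where "b \<in> Cc" "(\<integral>x. b x \<partial>H) \<noteq> 0"
proof -
  have "emeasure H UNIV = (SUP K \<in> {K. compact K \<and> K \<subseteq> UNIV}. emeasure H K)" "emeasure H UNIV \<noteq> 0"
    using H open_UNIV unfolding haar_measure_def by (elim conjE, blast)+
  then have "0 < (SUP K \<in> {K. compact K \<and> K \<subseteq> UNIV}. emeasure H K)" by (metis not_gr_zero)
  then obtain K where K: "compact K" "0 < emeasure H K" by (auto simp: less_SUP_iff)
  have "locally_compact_space (euclidean :: 'a topology)"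
    unfolding locally_compact_space_def
  proof
    fix x :: 'a
    have "openin (top_of_set UNIV) (UNIV :: 'a set)" by simp
    with lc obtain u v where "openin (top_of_set UNIV) u" "compact v" "x \<in> u" "u \<subseteq> v"
      unfolding locally_def by (metis UNIV_I)
    then show "\<exists>U K. openin euclidean U \<and> compactin euclidean K \<and> x \<in> U \<and> U \<subseteq> K" by auto
  qed
  then obtain U L where UL: "open U" "compact L" "K \<subseteq> U" "U \<subseteq> L"
    using K(1) locally_compact_space_compact_closed_compact[OF disjI1[OF Hausdorff_space_euclidean_t2]]
    by (metis compactin_euclidean_iff open_openin)
  have "Hausdorff_space (top_of_set L)"
    by (intro Hausdorff_space_subtopology Hausdorff_space_euclidean_t2)
  then have "normal_space (top_of_set L)"
    using UL(2) by (simp add: compact_Hausdorff_or_regular_imp_normal_space compact_space_subtopology)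
  moreover have "closedin (top_of_set L) (L - U)"
    using UL(1) by (auto simp: Diff_eq intro!: closedin_closed_Int)
  moreover have "closedin (top_of_set L) K"
    using K(1) UL compact_imp_closed by (intro closed_subset) auto
  moreover have "disjnt (L - U) K" using UL by (auto simp: disjnt_def)
  ultimately obtain f where f: "continuous_map (top_of_set L) (top_of_set {0..1::real}) f"
    "f ` (L - U) \<subseteq> {0}" "f ` K \<subseteq> {1}"
    by (rule Urysohn_lemma[where a=0 and b=1]) auto
  have cf: "continuous_on L f" and f01: "\<And>x. x \<in> L \<Longrightarrow> 0 \<le> f x"
    using f(1) by (auto simp: continuous_map_in_subtopology image_subset_iff Pi_iff)
  define b where "b x = (if x \<in> L then f x else 0)" for x
  have "continuous_on (L \<union> - U) b"
    unfolding b_def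
    by (rule continuous_on_If) (use UL cf f(2) compact_imp_closed in auto)
  then have cb: "continuous_on UNIV b" using UL by (metis Compl_partition Un_absorb1 Un_assoc Un_commute compl_sup_top sup_top_left)
  have bCc: "(\<lambda>x. complex_of_real (b x)) \<in> Cc"
    by (rule CcI[OF continuous_on_of_real[OF cb] UL(2)]) (simp add: b_def)
  have int: "integrable H b"
    using integrable_Re[OF haar_integrable[OF H bCc]] by simp
  have Kf: "K \<in> sets H" "emeasure H K < \<infinity>"
    using haar_compact_sets[OF H K(1)] haar_compact_finite[OF H K(1)] by auto
  have "0 < measure H K"
    using K(2) Kf by (simp add: measure_def enn2real_positive_iff)
  also have "measure H K = (\<integral>x. indicator K x \<partial>H)"
    using Kf haar_space[OF H] by simp
  also have "\<dots> \<le> (\<integral>x. b x \<partial>H)"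
  proof (rule integral_mono[OF _ int])
    show "indicator K x \<le> b x" for x
      using f(3) f01 UL by (cases "x \<in> K") (auto simp: b_def subset_iff image_subset_iff)
  qed (use Kf in \<open>simp add: integrable_real_indicator\<close>)
  finally have "(\<integral>x. complex_of_real (b x) \<partial>H) \<noteq> 0"
    by (simp only: integral_complex_of_real of_real_eq_0_iff)
  then show ?thesis using that bCc by blast
qed

lemma haar_fubini_Cc:
  fixes F :: "'a::{topological_ab_group_add,t2_space} \<Rightarrow> 'a \<Rightarrow> complex"
  assumes H: "haar_measure H" and F: "continuous_on UNIV (\<lambda>(x, t). F x t)"
    and K: "compact K" and L: "compact L"
    and zero: "\<And>x t. x \<notin> K \<Longrightarrow> F x t = 0" "\<And>x t. t \<notin> L \<Longrightarrow> F x t = 0"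
  shows "(\<integral>t. \<integral>x. F x t \<partial>H \<partial>H) = (\<integral>x. \<integral>t. F x t \<partial>H \<partial>H)"
proof (rule haar_fubini[where S="{u. continuous_on UNIV u \<and> (\<forall>x. x \<notin> K \<longrightarrow> u x = 0)}"
      and C="measure H K + 1" and M="\<lambda>u. \<integral>x. u x \<partial>H", OF H _ _ _ _ F K L])
  have int: "integrable H u" if "u \<in> {u. continuous_on UNIV u \<and> (\<forall>x. x \<notin> K \<longrightarrow> u x = 0)}" for u :: "'a \<Rightarrow> complex"
    using that by (intro haar_integrable[OF H] CcI[OF _ K]) auto
  show "(\<lambda>x. f x + g x) \<in> {u. continuous_on UNIV u \<and> (\<forall>x. x \<notin> K \<longrightarrow> u x = 0)} \<and>
      (\<integral>x. f x + g x \<partial>H) = (\<integral>x. f x \<partial>H) + (\<integral>x. g x \<partial>H)"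
    if "f \<in> {u. continuous_on UNIV u \<and> (\<forall>x. x \<notin> K \<longrightarrow> u x = 0)}"
      "g \<in> {u. continuous_on UNIV u \<and> (\<forall>x. x \<notin> K \<longrightarrow> u x = 0)}" for f g :: "'a \<Rightarrow> complex"
    using int[OF that(1)] int[OF that(2)] that by (auto intro!: continuous_intros)
  show "(\<lambda>x. c * f x) \<in> {u. continuous_on UNIV u \<and> (\<forall>x. x \<notin> K \<longrightarrow> u x = 0)} \<and>
      (\<integral>x. c * f x \<partial>H) = c * (\<integral>x. f x \<partial>H)"
    if "f \<in> {u. continuous_on UNIV u \<and> (\<forall>x. x \<notin> K \<longrightarrow> u x = 0)}" for f :: "'a \<Rightarrow> complex" and c
    using that by (auto intro!: continuous_intros)
  show "norm (\<integral>x. f x \<partial>H) \<le> (measure H K + 1) * B"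
    if "f \<in> {u. continuous_on UNIV u \<and> (\<forall>x. x \<notin> K \<longrightarrow> u x = 0)}" "\<And>x. x \<in> K \<Longrightarrow> norm (f x) \<le> B" "0 \<le> B"
    for f :: "'a \<Rightarrow> complex" and B
  proof -
    have "norm (\<integral>x. f x \<partial>H) \<le> B * measure H K"
      using that int[OF that(1)] haar_compact_sets[OF H K] haar_compact_finite[OF H K]
      by (intro integral_bound_on_set) auto
    also have "\<dots> \<le> (measure H K + 1) * B" using that(3) by (simp add: algebra_simps)
    finally show ?thesis .
  qed
  show "(\<lambda>x. F x t) \<in> {u. continuous_on UNIV u \<and> (\<forall>x. x \<notin> K \<longrightarrow> u x = 0)}" for t
  proof -
    have "continuous_on UNIV (\<lambda>x. (\<lambda>(x, t). F x t) (x, t))"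
      by (rule continuous_on_compose2[OF F]) (auto intro!: continuous_intros)
    then show ?thesis using zero(1) by simp
  qed
  show "(\<lambda>x. \<integral>t. F x t \<partial>H) \<in> {u. continuous_on UNIV u \<and> (\<forall>x. x \<notin> K \<longrightarrow> u x = 0)}"
  proof -
    have "(\<integral>t. F x t \<partial>H) = 0" if "x \<notin> K" for x
    proof -
      have "F x = (\<lambda>_. 0)" using zero(1)[OF that] by auto
      then show ?thesis by simp
    qed
    then show ?thesis using haar_parameter_continuous[OF H F L zero(2)] by blast
  qed
qed (use zero in \<open>auto simp: add_nonneg_pos\<close>)

text \<open>
  Inversion invariance of Haar integrals on an abelian group. With a fixed \<open>b\<close> of nonzero integral,
  \<open>\<integral>h(-y) dy \<integral>b(x) dx = \<integral>\<integral> b(x + y) h(-y) dx dy = \<integral>\<integral> b(y) h(x - y) dy dx = \<integral>b \<integral>h\<close>, by the substitutions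
  \<open>x \<mapsto> x + y\<close>, \<open>y \<mapsto> y - x\<close> and \<open>x \<mapsto> x + y\<close>.
\<close>

lemma haar_integral_uminus:
  fixes h :: "'a::{topological_ab_group_add,t2_space} \<Rightarrow> complex"
  assumes lc: "locally compact (UNIV :: 'a set)" and H: "haar_measure H" and h: "h \<in> Cc"
  shows "(\<integral>x. h (- x) \<partial>H) = (\<integral>x. h x \<partial>H)"
proof -
  obtain b :: "'a \<Rightarrow> complex" where b: "b \<in> Cc" "(\<integral>x. b x \<partial>H) \<noteq> 0"
    by (rule haar_bump[OF lc H])
  obtain Kb where Kb: "compact Kb" "\<And>x. x \<notin> Kb \<Longrightarrow> b x = 0" using CcE[OF b(1)] by metis
  obtain Kh where Kh: "compact Kh" "\<And>x. x \<notin> Kh \<Longrightarrow> h x = 0" using CcE[OF h] by metis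
  note cb = continuous_on_compose2[OF Cc_continuous[OF b(1)] _ subset_UNIV]
  note ch = continuous_on_compose2[OF Cc_continuous[OF h] _ subset_UNIV]
  let ?K = "{x + y | x y. x \<in> Kb \<and> y \<in> Kh}"
  have "(\<integral>x. h (- x) \<partial>H) * (\<integral>x. b x \<partial>H) = (\<integral>y. \<integral>x. b (x + y) * h (- y) \<partial>H \<partial>H)"
    by (simp add: haar_integral_translate[OF H Cc_continuous[OF b(1)]] mult.commute)
  also have "\<dots> = (\<integral>x. \<integral>y. b (x + y) * h (- y) \<partial>H \<partial>H)"
  proof (rule haar_fubini_Cc[OF H _ compact_set_plus(1)[OF Kb(1) Kh(1)] compact_uminus_image[OF Kh(1)]])
    show "continuous_on UNIV (\<lambda>(x, y). b (x + y) * h (- y))"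
      unfolding split_beta by (intro continuous_on_mult cb ch continuous_intros)
    show "b (x + y) * h (- y) = 0" if "x \<notin> ?K" for x y
    proof (rule ccontr)
      assume "\<not> ?thesis"
      then have "x + y \<in> Kb" "- y \<in> Kh" using Kb Kh by auto
      moreover have "x = (x + y) + (- y)" by simp
      ultimately show False using that by blast
    qed
    show "b (x + y) * h (- y) = 0" if "y \<notin> uminus ` Kh" for x y
    proof -
      have "- y \<notin> Kh" using that by (metis image_eqI minus_minus)
      then show ?thesis using Kh by simp
    qed
  qed
  also have "\<dots> = (\<integral>x. \<integral>y. b y * h (x - y) \<partial>H \<partial>H)"
  proof (rule Bochner_Integration.integral_cong[OF refl])
    fix x
    have "continuous_on UNIV (\<lambda>y. b (x + y) * h (- y))"
      by (intro continuous_on_mult cb ch continuous_intros)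
    from haar_integral_translate[OF H this, of "- x"]
    show "(\<integral>y. b (x + y) * h (- y) \<partial>H) = (\<integral>y. b y * h (x - y) \<partial>H)" by simp
  qed
  also have "\<dots> = (\<integral>y. \<integral>x. b y * h (x - y) \<partial>H \<partial>H)"
  proof (rule haar_fubini_Cc[symmetric, OF H _ compact_set_plus(1)[OF Kb(1) Kh(1)] Kb(1)])
    show "continuous_on UNIV (\<lambda>(x, y). b y * h (x - y))"
      unfolding split_beta diff_conv_add_uminus by (intro continuous_on_mult cb ch continuous_intros)
    show "b y * h (x - y) = 0" if "x \<notin> ?K" for x y
    proof (rule ccontr)
      assume "\<not> ?thesis"
      then have "y \<in> Kb" "x - y \<in> Kh" using Kb Kh by auto
      moreover have "x = y + (x - y)" by simp
      ultimately show False using that by blast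
    qed
  qed (use Kb in simp)
  also have "\<dots> = (\<integral>x. h x \<partial>H) * (\<integral>x. b x \<partial>H)"
    using haar_integral_translate[OF H Cc_continuous[OF h], of "- _"] by (simp add: mult.commute)
  finally show ?thesis using b(2) by simp
qed

lemma tilde_fun_Cc: "\<phi> \<in> Cc \<Longrightarrow> tilde_fun \<phi> \<in> Cc"
  for \<phi> :: "'a::{topological_ab_group_add,t2_space} \<Rightarrow> complex"
proof -
  assume \<phi>: "\<phi> \<in> Cc"
  then obtain K where K: "compact K" "\<And>x. x \<notin> K \<Longrightarrow> \<phi> x = 0" using CcE by metis
  have "tilde_fun \<phi> x = 0" if "x \<notin> uminus ` K" for x
  proof -
    have "- x \<notin> K" using that by (metis image_eqI minus_minus)
    then show ?thesis using K by (simp add: tilde_fun_def)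
  qed
  moreover have "continuous_on UNIV (tilde_fun \<phi>)"
    unfolding tilde_fun_def
    by (intro continuous_on_cnj continuous_on_compose2[OF Cc_continuous[OF \<phi>] _ subset_UNIV] continuous_intros)
  ultimately show ?thesis using CcI[OF _ compact_uminus_image[OF K(1)]] by blast
qed

text \<open>
  The supremum norm of the definition is replaced by an arbitrary bound \<open>B\<close>.
\<close>

lemma radon_functionalI:
  fixes \<mu> :: "('a::t2_space \<Rightarrow> complex) \<Rightarrow> complex"
  assumes "\<And>\<phi> \<psi>. \<phi> \<in> Cc \<Longrightarrow> \<psi> \<in> Cc \<Longrightarrow> \<mu> (\<lambda>x. \<phi> x + \<psi> x) = \<mu> \<phi> + \<mu> \<psi>"
    and "\<And>\<phi> c. \<phi> \<in> Cc \<Longrightarrow> \<mu> (\<lambda>x. c * \<phi> x) = c * \<mu> \<phi>"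
    and "\<And>K. compact K \<Longrightarrow> \<exists>C\<ge>0. \<forall>\<phi>\<in>Cc. \<forall>B\<ge>0. (\<forall>x. x \<notin> K \<longrightarrow> \<phi> x = 0) \<longrightarrow> (\<forall>x. norm (\<phi> x) \<le> B) \<longrightarrow> norm (\<mu> \<phi>) \<le> C * B"
  shows "radon_functional \<mu>"
  unfolding radon_functional_def
proof (intro conjI ballI allI impI)
  fix K :: "'a set" assume "compact K"
  then obtain C where C: "C \<ge> 0" "\<And>\<phi> B. \<lbrakk>\<phi> \<in> Cc; B \<ge> 0; \<And>x. x \<notin> K \<Longrightarrow> \<phi> x = 0; \<And>x. norm (\<phi> x) \<le> B\<rbrakk> \<Longrightarrow> norm (\<mu> \<phi>) \<le> C * B"
    using assms(3) by metis
  show "\<exists>C\<ge>0. \<forall>\<phi>\<in>Cc. closure {x. \<phi> x \<noteq> 0} \<subseteq> K \<longrightarrow> norm (\<mu> \<phi>) \<le> C * (SUP x. norm (\<phi> x))"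
  proof (intro exI conjI ballI impI)
    fix \<phi> :: "'a \<Rightarrow> complex" assume \<phi>: "\<phi> \<in> Cc" "closure {x. \<phi> x \<noteq> 0} \<subseteq> K"
    obtain B where "\<And>x. norm (\<phi> x) \<le> B" using Cc_bounded[OF \<phi>(1)] by metis
    then have "bdd_above (range (\<lambda>x. norm (\<phi> x)))" by (intro bdd_aboveI2)
    then have le: "norm (\<phi> x) \<le> (SUP x. norm (\<phi> x))" for x by (intro cSUP_upper) auto
    show "norm (\<mu> \<phi>) \<le> C * (SUP x. norm (\<phi> x))"
    proof (rule C(2)[OF \<phi>(1) _ _ le])
      show "0 \<le> (SUP x. norm (\<phi> x))" using le norm_ge_zero order_trans by blast
      show "\<phi> x = 0" if "x \<notin> K" for x
        using that \<phi>(2) closure_subset[of "{x. \<phi> x \<noteq> 0}"] by blast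
    qed
  qed (rule C(1))
qed (use assms in auto)

lemma radon_functional_tilde:
  fixes \<mu> :: "('a::{topological_ab_group_add,t2_space} \<Rightarrow> complex) \<Rightarrow> complex"
  assumes \<mu>: "radon_functional \<mu>"
  shows "radon_functional (tilde_functional \<mu>)"
proof (rule radon_functionalI)
  fix \<phi> \<psi> :: "'a \<Rightarrow> complex" assume "\<phi> \<in> Cc" "\<psi> \<in> Cc"
  then show "tilde_functional \<mu> (\<lambda>x. \<phi> x + \<psi> x) = tilde_functional \<mu> \<phi> + tilde_functional \<mu> \<psi>"
    using radon_add[OF \<mu> tilde_fun_Cc tilde_fun_Cc, of \<phi> \<psi>] by (simp add: tilde_functional_def tilde_fun_def)
next
  fix \<phi> :: "'a \<Rightarrow> complex" and c assume "\<phi> \<in> Cc"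
  then show "tilde_functional \<mu> (\<lambda>x. c * \<phi> x) = c * tilde_functional \<mu> \<phi>"
    using radon_scale[OF \<mu> tilde_fun_Cc, of \<phi> "cnj c"] by (simp add: tilde_functional_def tilde_fun_def)
next
  fix K :: "'a set" assume K: "compact K"
  obtain C where C: "C > 0" "\<And>\<phi> B. \<lbrakk>\<phi> \<in> Cc; \<And>x. x \<notin> uminus ` K \<Longrightarrow> \<phi> x = 0; \<And>x. x \<in> uminus ` K \<Longrightarrow> norm (\<phi> x) \<le> B; B \<ge> 0\<rbrakk>
      \<Longrightarrow> norm (\<mu> \<phi>) \<le> C * B"
    using radon_bound[OF \<mu> compact_uminus_image[OF K]] by metis
  show "\<exists>C\<ge>0. \<forall>\<phi>\<in>Cc. \<forall>B\<ge>0. (\<forall>x. x \<notin> K \<longrightarrow> \<phi> x = 0) \<longrightarrow> (\<forall>x. norm (\<phi> x) \<le> B) \<longrightarrow> norm (tilde_functional \<mu> \<phi>) \<le> C * B"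
  proof (intro exI[of _ C] conjI ballI allI impI)
    fix \<phi> :: "'a \<Rightarrow> complex" and B :: real
    assume \<phi>: "\<phi> \<in> Cc" "0 \<le> B" "\<forall>x. x \<notin> K \<longrightarrow> \<phi> x = 0" "\<forall>x. norm (\<phi> x) \<le> B"
    have "norm (\<mu> (tilde_fun \<phi>)) \<le> C * B"
    proof (rule C(2)[OF tilde_fun_Cc[OF \<phi>(1)]])
      show "tilde_fun \<phi> x = 0" if "x \<notin> uminus ` K" for x
      proof -
        have "- x \<notin> K" using that by (metis image_eqI minus_minus)
        then show ?thesis using \<phi>(3) by (simp add: tilde_fun_def)
      qed
    qed (use \<phi> in \<open>auto simp: tilde_fun_def\<close>)
    then show "norm (tilde_functional \<mu> \<phi>) \<le> C * B" by (simp add: tilde_functional_def)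
  qed (use C in simp)
qed

section \<open>Smoothing of compactly carried functionals\<close>

text \<open>
  The restriction of a measure to a relatively compact open set, seen as a functional on all continuous
  functions. Its bound refers to the values on \<open>K\<close> only, so that functions of noncompact support, such as
  characters, are admitted.
\<close>

locale compactly_carried =
  fixes M :: "('a::{topological_ab_group_add,t2_space} \<Rightarrow> complex) \<Rightarrow> complex" and K :: "'a set" and C :: real
  assumes add: "\<And>f g. continuous_on UNIV f \<Longrightarrow> continuous_on UNIV g \<Longrightarrow> M (\<lambda>x. f x + g x) = M f + M g"
    and scale: "\<And>f c. continuous_on UNIV f \<Longrightarrow> M (\<lambda>x. c * f x) = c * M f"
    and compact: "compact K" and pos: "C > 0"
    and bound: "\<And>f B. continuous_on UNIV f \<Longrightarrow> (\<And>x. x \<in> K \<Longrightarrow> norm (f x) \<le> B) \<Longrightarrow> 0 \<le> B \<Longrightarrow> norm (M f) \<le> C * B"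
begin

lemma radon: "radon_functional M"
proof (rule radon_functionalI)
  show "\<exists>C\<ge>0. \<forall>\<phi>\<in>Cc. \<forall>B\<ge>0. (\<forall>x. x \<notin> L \<longrightarrow> \<phi> x = 0) \<longrightarrow> (\<forall>x. norm (\<phi> x) \<le> B) \<longrightarrow> norm (M \<phi>) \<le> C * B"
    if "compact L" for L
  proof (intro exI[of _ C] conjI ballI allI impI)
    fix \<phi> :: "'a \<Rightarrow> complex" and B :: real
    assume "\<phi> \<in> Cc" "0 \<le> B" "\<forall>x. norm (\<phi> x) \<le> B"
    then show "norm (M \<phi>) \<le> C * B" using bound[OF Cc_continuous, of \<phi> B] by simp
  qed (use pos in simp)
qed (auto simp: add scale Cc_continuous)

lemma continuous_curry:
  fixes F :: "'a \<Rightarrow> 'a \<Rightarrow> complex"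
  assumes "continuous_on UNIV (\<lambda>(x, t). F x t)"
  shows "continuous_on UNIV (\<lambda>x. F x t)"
proof -
  have "continuous_on UNIV (\<lambda>x. (\<lambda>(x, t). F x t) (x, t))"
    by (rule continuous_on_compose2[OF assms]) (auto intro!: continuous_intros)
  then show ?thesis by simp
qed

lemma fubini:
  fixes F :: "'a \<Rightarrow> 'a \<Rightarrow> complex"
  assumes H: "haar_measure H" and F: "continuous_on UNIV (\<lambda>(x, t). F x t)" and L: "compact L"
    and zero: "\<And>x t. x \<in> K \<Longrightarrow> t \<notin> L \<Longrightarrow> F x t = 0"
    and S: "continuous_on UNIV (\<lambda>x. \<integral>t. F x t \<partial>H)"
  shows "(\<integral>t. M (\<lambda>x. F x t) \<partial>H) = M (\<lambda>x. \<integral>t. F x t \<partial>H)"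
  by (rule haar_fubini[where S="{f. continuous_on UNIV f}" and C=C, OF H _ _ pos _ F compact L zero])
    (use S continuous_curry[OF F] in \<open>auto intro!: continuous_intros simp: add scale bound\<close>)

lemma parameter_Cc:
  fixes F :: "'a \<Rightarrow> 'a \<Rightarrow> complex"
  assumes F: "continuous_on UNIV (\<lambda>(x, t). F x t)" and L: "compact L"
    and zero: "\<And>x t. x \<in> K \<Longrightarrow> t \<notin> L \<Longrightarrow> F x t = 0"
  shows "(\<lambda>t. M (\<lambda>x. F x t)) \<in> Cc" "\<And>t. t \<notin> L \<Longrightarrow> M (\<lambda>x. F x t) = 0"
proof -
  have diff: "M (\<lambda>x. f x - g x) = M f - M g" if "continuous_on UNIV f" "continuous_on UNIV g" for f g
    using add[OF that(1), of "\<lambda>x. - 1 * g x"] scale[OF that(2), of "-1"] that by (simp add: continuous_on_minus)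
  show "(\<lambda>t. M (\<lambda>x. F x t)) \<in> Cc"
    by (rule functional_parameter_Cc(1)[where S="{f. continuous_on UNIV f}" and C=C, OF _ _ pos _ F compact L zero])
      (use continuous_curry[OF F] in \<open>auto intro!: continuous_intros simp: diff bound\<close>)
  show "M (\<lambda>x. F x t) = 0" if "t \<notin> L" for t
    using bound[OF continuous_curry[OF F, of t], of 0] zero[OF _ that] by simp
qed

lemma convolution_Cc:
  assumes \<phi>: "continuous_on UNIV \<phi>" "compact L" "\<And>x. x \<notin> L \<Longrightarrow> \<phi> x = 0"
  shows "conv_functional_fun M \<phi> \<in> Cc"
    and "\<And>t. t \<notin> {a + b | a b. a \<in> K \<and> b \<in> L} \<Longrightarrow> conv_functional_fun M \<phi> t = 0"
proof -
  have F: "continuous_on UNIV (\<lambda>(s, t). \<phi> (t - s))"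
    unfolding split_beta diff_conv_add_uminus
    by (intro continuous_on_compose2[OF \<phi>(1) _ subset_UNIV] continuous_intros)
  have z: "\<phi> (t - s) = 0" if "s \<in> K" "t \<notin> {a + b | a b. a \<in> K \<and> b \<in> L}" for s t
  proof (rule \<phi>(3), rule notI)
    assume "t - s \<in> L"
    moreover have "t = s + (t - s)" by simp
    ultimately show False using that by blast
  qed
  show "conv_functional_fun M \<phi> \<in> Cc"
    unfolding conv_functional_fun_def
    by (rule parameter_Cc(1)[OF F compact_set_plus(1)[OF compact \<phi>(2)] z])
  show "conv_functional_fun M \<phi> t = 0" if "t \<notin> {a + b | a b. a \<in> K \<and> b \<in> L}" for t
    unfolding conv_functional_fun_def
    by (rule parameter_Cc(2)[OF F compact_set_plus(1)[OF compact \<phi>(2)] z that])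
qed

text \<open>
  The convolution theorem at the character \<open>\<xi>\<close>; the last factor is the Fourier transform of \<open>M\<close>. The inner integral
  over \<open>t\<close> is \<open>\<phi>\<^sup>\<and>(\<xi>) cnj \<xi>(s)\<close> by translation invariance.
\<close>

lemma fourier_convolution:
  assumes H: "haar_measure H" and \<phi>: "\<phi> \<in> Cc"
  shows "fourier H (conv_functional_fun M \<phi>) \<xi> = fourier H \<phi> \<xi> * M (\<lambda>s. cnj (char_apply \<xi> s))"
proof -
  obtain L where L: "compact L" "\<And>x. x \<notin> L \<Longrightarrow> \<phi> x = 0" using CcE[OF \<phi>] by metis
  note c\<phi> = continuous_on_compose2[OF Cc_continuous[OF \<phi>] _ subset_UNIV]
  note c\<xi> = continuous_on_compose2[OF char_continuous _ subset_UNIV]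
  have int: "(\<integral>t. cnj (char_apply \<xi> t) * \<phi> (t - s) \<partial>H) = fourier H \<phi> \<xi> * cnj (char_apply \<xi> s)" for s
  proof -
    have "continuous_on UNIV (\<lambda>t. cnj (char_apply \<xi> t) * \<phi> (t - s))"
      unfolding diff_conv_add_uminus by (intro continuous_on_mult continuous_on_cnj c\<phi> c\<xi> continuous_intros)
    from haar_integral_translate[OF H this, of s]
    have "(\<integral>t. cnj (char_apply \<xi> t) * \<phi> (t - s) \<partial>H) = (\<integral>t. cnj (char_apply \<xi> (t + s)) * \<phi> t \<partial>H)" by simp
    also have "\<dots> = (\<integral>t. cnj (char_apply \<xi> s) * (cnj (char_apply \<xi> t) * \<phi> t) \<partial>H)"
      by (simp add: char_add mult_ac)
    finally show ?thesis by (simp add: fourier_def mult.commute)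
  qed
  have "fourier H (conv_functional_fun M \<phi>) \<xi> = (\<integral>t. M (\<lambda>s. cnj (char_apply \<xi> t) * \<phi> (t - s)) \<partial>H)"
    unfolding fourier_def conv_functional_fun_def
    by (subst scale) (auto simp only: diff_conv_add_uminus intro!: c\<phi> continuous_intros)
  also have "\<dots> = M (\<lambda>s. \<integral>t. cnj (char_apply \<xi> t) * \<phi> (t - s) \<partial>H)"
  proof (rule fubini[OF H _ compact_set_plus(1)[OF compact L(1)]])
    show "continuous_on UNIV (\<lambda>(s, t). cnj (char_apply \<xi> t) * \<phi> (t - s))"
      unfolding split_beta diff_conv_add_uminus
      by (intro continuous_on_mult continuous_on_cnj c\<phi> c\<xi> continuous_intros)
    show "cnj (char_apply \<xi> t) * \<phi> (t - s) = 0" if "s \<in> K" "t \<notin> {a + b | a b. a \<in> K \<and> b \<in> L}" for s t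
    proof -
      have "t - s \<notin> L"
      proof
        assume "t - s \<in> L"
        moreover have "t = s + (t - s)" by simp
        ultimately show False using that by blast
      qed
      then show ?thesis using L by simp
    qed
    show "continuous_on UNIV (\<lambda>s. \<integral>t. cnj (char_apply \<xi> t) * \<phi> (t - s) \<partial>H)"
      unfolding int by (intro continuous_on_mult continuous_on_const continuous_on_cnj char_continuous)
  qed
  also have "\<dots> = fourier H \<phi> \<xi> * M (\<lambda>s. cnj (char_apply \<xi> s))"
    unfolding int by (rule scale) (intro continuous_on_cnj char_continuous)
  finally show ?thesis .
qed

end

text \<open>
  This is \<open>\<phi> * \<phi>\<^sup>~\<close> reflected at 0. The signs are chosen so that \<open>radon_apply_correlation\<close> needs an
  interchange of integrals only, and no change of variables.
\<close>

definition correlation :: "'a::topological_ab_group_add measure \<Rightarrow> ('a \<Rightarrow> complex) \<Rightarrow> 'a \<Rightarrow> complex" where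
  "correlation H \<phi> u = (\<integral>w. \<phi> (- w - u) * cnj (\<phi> (- w)) \<partial>H)"

lemma correlation_Cc:
  fixes \<phi> :: "'a::{topological_ab_group_add,t2_space} \<Rightarrow> complex"
  assumes H: "haar_measure H" and \<phi>: "continuous_on UNIV \<phi>" "compact L" "\<And>x. x \<notin> L \<Longrightarrow> \<phi> x = 0"
  shows "correlation H \<phi> \<in> Cc"
    and "\<And>u w. u \<notin> {a - b | a b. a \<in> L \<and> b \<in> L} \<Longrightarrow> \<phi> (- w - u) * cnj (\<phi> (- w)) = 0"
    and "\<And>u. u \<notin> {a - b | a b. a \<in> L \<and> b \<in> L} \<Longrightarrow> correlation H \<phi> u = 0"
    and "continuous_on UNIV (\<lambda>(u, w). \<phi> (- w - u) * cnj (\<phi> (- w)))"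
    and "\<And>u w. w \<notin> uminus ` L \<Longrightarrow> \<phi> (- w - u) * cnj (\<phi> (- w)) = 0"
proof -
  show z: "\<phi> (- w - u) * cnj (\<phi> (- w)) = 0" if "u \<notin> {a - b | a b. a \<in> L \<and> b \<in> L}" for u w
  proof (rule ccontr)
    assume "\<not> ?thesis"
    then have "- w - u \<in> L" "- w \<in> L" using \<phi>(3) by auto
    moreover have "u = (- w) - (- w - u)" by simp
    ultimately show False using that by blast
  qed
  show z': "correlation H \<phi> u = 0" if "u \<notin> {a - b | a b. a \<in> L \<and> b \<in> L}" for u
    unfolding correlation_def z[OF that] by simp
  show c: "continuous_on UNIV (\<lambda>(u, w). \<phi> (- w - u) * cnj (\<phi> (- w)))"
    unfolding split_beta diff_conv_add_uminus
    by (intro continuous_on_mult continuous_on_cnj continuous_on_compose2[OF \<phi>(1) _ subset_UNIV] continuous_intros)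
  show z2: "\<phi> (- w - u) * cnj (\<phi> (- w)) = 0" if "w \<notin> uminus ` L" for u w
  proof -
    have "- w \<notin> L" using that by (metis image_eqI minus_minus)
    then show ?thesis using \<phi>(3) by simp
  qed
  have "continuous_on UNIV (correlation H \<phi>)"
    unfolding correlation_def[abs_def]
    by (rule haar_parameter_continuous[OF H c compact_uminus_image[OF \<phi>(2)] z2])
  then show "correlation H \<phi> \<in> Cc"
    using z' by (rule CcI[OF _ compact_set_plus(2)[OF \<phi>(2) \<phi>(2)]])
qed

lemma radon_apply_correlation:
  fixes \<phi> :: "'a::{topological_ab_group_add,t2_space} \<Rightarrow> complex"
  assumes H: "haar_measure H" and \<gamma>: "radon_functional \<gamma>" and \<phi>: "\<phi> \<in> Cc"
  shows "conv_fun H (conv_functional_fun \<gamma> \<phi>) (tilde_fun \<phi>) 0 = \<gamma> (correlation H \<phi>)"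
proof -
  obtain L where L: "compact L" "\<And>x. x \<notin> L \<Longrightarrow> \<phi> x = 0" using CcE[OF \<phi>] by metis
  define K where "K = {a - b | a b. a \<in> L \<and> b \<in> L}"
  note corr = correlation_Cc[OF H Cc_continuous[OF \<phi>] L, folded K_def]
  let ?S = "{f \<in> Cc. \<forall>x. x \<notin> K \<longrightarrow> f x = 0}"
  have K: "compact K" unfolding K_def by (rule compact_set_plus(2)[OF L(1) L(1)])
  obtain C where C: "C > 0" "\<And>\<psi> B. \<lbrakk>\<psi> \<in> Cc; \<And>x. x \<notin> K \<Longrightarrow> \<psi> x = 0; \<And>x. x \<in> K \<Longrightarrow> norm (\<psi> x) \<le> B; B \<ge> 0\<rbrakk>
      \<Longrightarrow> norm (\<gamma> \<psi>) \<le> C * B"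
    using radon_bound[OF \<gamma> K] by metis
  have FS: "(\<lambda>u. \<phi> (- w - u) * cnj (\<phi> (- w))) \<in> ?S" for w
  proof -
    have "continuous_on UNIV (\<lambda>u. \<phi> (- w - u) * cnj (\<phi> (- w)))"
      unfolding diff_conv_add_uminus
      by (intro continuous_on_mult continuous_on_compose2[OF Cc_continuous[OF \<phi>] _ subset_UNIV] continuous_intros)
    then show ?thesis using CcI[OF _ K] corr(2) by blast
  qed
  have shift: "(\<lambda>u. \<phi> (- w - u)) \<in> Cc" for w
  proof (rule CcI)
    show "continuous_on UNIV (\<lambda>u. \<phi> (- w - u))"
      unfolding diff_conv_add_uminus
      by (intro continuous_on_compose2[OF Cc_continuous[OF \<phi>] _ subset_UNIV] continuous_intros)
    show "compact {a - b | a b. a \<in> {- w} \<and> b \<in> L}" by (rule compact_set_plus(2)[OF compact_sing L(1)])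
    show "\<phi> (- w - u) = 0" if "u \<notin> {a - b | a b. a \<in> {- w} \<and> b \<in> L}" for u
    proof (rule L(2), rule notI)
      assume "- w - u \<in> L"
      moreover have "u = - w - (- w - u)" by simp
      ultimately show False using that by blast
    qed
  qed
  have "conv_fun H (conv_functional_fun \<gamma> \<phi>) (tilde_fun \<phi>) 0 =
      (\<integral>w. \<gamma> (\<lambda>u. \<phi> (- w - u) * cnj (\<phi> (- w))) \<partial>H)"
    using radon_scale[OF \<gamma> shift]
    by (simp add: conv_fun_def conv_functional_fun_def tilde_fun_def mult.commute)
  also have "\<dots> = \<gamma> (\<lambda>u. \<integral>w. \<phi> (- w - u) * cnj (\<phi> (- w)) \<partial>H)"
  proof (rule haar_fubini[where S="?S" and C=C and K="K", OF H _ _ C(1) _ corr(4) K compact_uminus_image[OF L(1)] corr(5) FS])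
    show "(\<lambda>x. f x + g x) \<in> ?S \<and> \<gamma> (\<lambda>x. f x + g x) = \<gamma> f + \<gamma> g" if "f \<in> ?S" "g \<in> ?S" for f g
      using that Cc_add[of f g] radon_add[OF \<gamma>, of f g] by auto
    show "(\<lambda>x. c * f x) \<in> ?S \<and> \<gamma> (\<lambda>x. c * f x) = c * \<gamma> f" if "f \<in> ?S" for f c
      using that Cc_scale[of f c] radon_scale[OF \<gamma>, of f c] by auto
    show "norm (\<gamma> f) \<le> C * B" if "f \<in> ?S" "\<And>x. x \<in> K \<Longrightarrow> norm (f x) \<le> B" "0 \<le> B" for f B
      by (rule C(2)) (use that in blast)+
    show "(\<lambda>u. \<integral>w. \<phi> (- w - u) * cnj (\<phi> (- w)) \<partial>H) \<in> ?S"
      using corr(1,3) unfolding correlation_def[abs_def] by blast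
  qed
  finally show ?thesis unfolding correlation_def[abs_def] .
qed

context compactly_carried
begin

lemma conv_tilde_Cc:
  assumes \<Phi>: "\<Phi> \<in> Cc"
  shows "conv_functional M (tilde_functional M) \<Phi> = cnj (M (\<lambda>t. cnj (M (\<lambda>s. \<Phi> (s - t)))))"
proof -
  obtain L where L: "compact L" "\<And>x. x \<notin> L \<Longrightarrow> \<Phi> x = 0" using CcE[OF \<Phi>] by metis
  have F: "continuous_on UNIV (\<lambda>(s, t). \<Phi> (s + t))"
    unfolding split_beta
    by (intro continuous_on_compose2[OF Cc_continuous[OF \<Phi>] _ subset_UNIV] continuous_intros)
  have "\<Phi> (s + t) = 0" if "s \<in> K" "t \<notin> {a - b | a b. a \<in> L \<and> b \<in> K}" for s t
  proof (rule L(2), rule notI)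
    assume "s + t \<in> L"
    moreover have "t = (s + t) - s" by simp
    ultimately show False using that by blast
  qed
  then have k: "(\<lambda>t. M (\<lambda>s. \<Phi> (s + t))) \<in> Cc"
    by (rule parameter_Cc(1)[OF F compact_set_plus(2)[OF L(1) compact]])
  have "(\<lambda>s. \<Phi> (s + t)) \<in> Cc" for t
  proof (rule CcI[OF continuous_curry[OF F] compact_set_plus(2)[OF L(1) compact_sing[of t]]])
    show "\<Phi> (s + t) = 0" if "s \<notin> {a - b | a b. a \<in> L \<and> b \<in> {t}}" for s
    proof (rule L(2), rule notI)
      assume "s + t \<in> L"
      moreover have "s = (s + t) - t" by simp
      ultimately show False using that by blast
    qed
  qed
  then have "radon_integral M (\<lambda>s. \<Phi> (s + t)) = M (\<lambda>s. \<Phi> (s + t))" for t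
    by (rule radon_integral_Cc[OF radon])
  then have "conv_functional M (tilde_functional M) \<Phi> = tilde_functional M (\<lambda>t. M (\<lambda>s. \<Phi> (s + t)))"
    unfolding conv_functional_def using radon_integral_Cc[OF radon_functional_tilde[OF radon] k] by simp
  then show ?thesis by (simp add: tilde_functional_def tilde_fun_def)
qed

text \<open>
  By translation invariance \<open>correlation H \<phi> (s - t) = \<integral>\<phi>(-w - s) cnj \<phi>(-w - t) dw\<close>, with separated variables \<open>s\<close>
  and \<open>t\<close>. Moving \<open>M\<close> under the integral, once in \<open>s\<close> and once in \<open>t\<close>, therefore yields \<open>\<integral> f(-w) cnj f(-w) dw\<close> for the
  convolution \<open>f\<close> of \<open>M\<close> and \<open>\<phi>\<close>.
\<close>

lemma conv_tilde_correlation: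
  assumes lc: "locally compact (UNIV :: 'a set)" and H: "haar_measure H" and \<phi>: "\<phi> \<in> Cc"
  shows "conv_functional M (tilde_functional M) (correlation H \<phi>) =
    of_real (\<integral>t. (norm (conv_functional_fun M \<phi> t))\<^sup>2 \<partial>H)"
proof -
  obtain L where L: "compact L" "\<And>x. x \<notin> L \<Longrightarrow> \<phi> x = 0" using CcE[OF \<phi>] by metis
  note c\<phi> = continuous_on_compose2[OF Cc_continuous[OF \<phi>] _ subset_UNIV]
  note corr = correlation_Cc[OF H Cc_continuous[OF \<phi>] L]
  define f where "f = conv_functional_fun M \<phi>"
  have f: "f \<in> Cc" unfolding f_def by (rule convolution_Cc(1)[OF Cc_continuous[OF \<phi>] L])
  obtain Lf where Lf: "compact Lf" "\<And>x. x \<notin> Lf \<Longrightarrow> f x = 0" using CcE[OF f] by metis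
  note cf = continuous_on_compose2[OF Cc_continuous[OF f] _ subset_UNIV]
  have fM: "M (\<lambda>s. \<phi> (- w - s)) = f (- w)" for w by (simp add: f_def conv_functional_fun_def)
  have shift: "correlation H \<phi> (s - t) = (\<integral>w. \<phi> (- w - s) * cnj (\<phi> (- w - t)) \<partial>H)" for s t
  proof -
    have "continuous_on UNIV (\<lambda>w. \<phi> (- w - (s - t)) * cnj (\<phi> (- w)))"
      unfolding diff_conv_add_uminus by (intro continuous_on_mult continuous_on_cnj c\<phi> continuous_intros)
    from haar_integral_translate[OF H this, of t] show ?thesis
      by (simp add: correlation_def algebra_simps)
  qed
  have 1: "cnj (M (\<lambda>s. correlation H \<phi> (s - t))) = (\<integral>w. cnj (f (- w)) * \<phi> (- w - t) \<partial>H)" for t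
  proof -
    have "M (\<lambda>s. correlation H \<phi> (s - t)) = M (\<lambda>s. \<integral>w. \<phi> (- w - s) * cnj (\<phi> (- w - t)) \<partial>H)"
      by (simp only: shift)
    also have "\<dots> = (\<integral>w. M (\<lambda>s. \<phi> (- w - s) * cnj (\<phi> (- w - t))) \<partial>H)"
    proof (rule fubini[symmetric, OF H _ compact_set_plus(2)[OF compact_uminus_image[OF L(1)] compact_sing[of t]]])
      show "continuous_on UNIV (\<lambda>(s, w). \<phi> (- w - s) * cnj (\<phi> (- w - t)))"
        unfolding split_beta diff_conv_add_uminus
        by (intro continuous_on_mult continuous_on_cnj c\<phi> continuous_intros)
      show "\<phi> (- w - s) * cnj (\<phi> (- w - t)) = 0" if "w \<notin> {a - b | a b. a \<in> uminus ` L \<and> b \<in> {t}}" for s w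
      proof -
        have "- w - t \<notin> L"
        proof
          assume "- w - t \<in> L"
          moreover have "w = - (- w - t) - t" by simp
          ultimately show False using that by blast
        qed
        then show ?thesis using L(2) by simp
      qed
      show "continuous_on UNIV (\<lambda>s. \<integral>w. \<phi> (- w - s) * cnj (\<phi> (- w - t)) \<partial>H)"
      proof -
        have "continuous_on UNIV (\<lambda>s. correlation H \<phi> (s - t))"
          unfolding diff_conv_add_uminus
          by (intro continuous_on_compose2[OF Cc_continuous[OF corr(1)] _ subset_UNIV] continuous_intros)
        then show ?thesis by (simp only: shift)
      qed
    qed
    also have "\<dots> = (\<integral>w. f (- w) * cnj (\<phi> (- w - t)) \<partial>H)"
    proof (rule Bochner_Integration.integral_cong[OF refl])
      fix w
      have "continuous_on UNIV (\<lambda>s. \<phi> (- w - s))"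
        unfolding diff_conv_add_uminus by (intro c\<phi> continuous_intros)
      from scale[OF this, of "cnj (\<phi> (- w - t))"]
      show "M (\<lambda>s. \<phi> (- w - s) * cnj (\<phi> (- w - t))) = f (- w) * cnj (\<phi> (- w - t))"
        by (simp add: fM mult.commute)
    qed
    finally have "cnj (M (\<lambda>s. correlation H \<phi> (s - t))) = cnj (\<integral>w. f (- w) * cnj (\<phi> (- w - t)) \<partial>H)"
      by simp
    also have "\<dots> = (\<integral>w. cnj (f (- w) * cnj (\<phi> (- w - t))) \<partial>H)"
      by (rule Bochner_Integration.integral_cnj[symmetric])
    finally show ?thesis by simp
  qed
  have "M (\<lambda>t. cnj (M (\<lambda>s. correlation H \<phi> (s - t)))) = M (\<lambda>t. \<integral>w. cnj (f (- w)) * \<phi> (- w - t) \<partial>H)"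
    by (simp only: 1)
  also have "\<dots> = (\<integral>w. M (\<lambda>t. cnj (f (- w)) * \<phi> (- w - t)) \<partial>H)"
  proof -
    have F: "continuous_on UNIV (\<lambda>(t, w). cnj (f (- w)) * \<phi> (- w - t))"
      unfolding split_beta diff_conv_add_uminus
      by (intro continuous_on_mult continuous_on_cnj c\<phi> cf continuous_intros)
    have z: "cnj (f (- w)) * \<phi> (- w - t) = 0" if "w \<notin> uminus ` Lf" for t w
    proof -
      have "- w \<notin> Lf" using that by (metis image_eqI minus_minus)
      then show ?thesis using Lf by simp
    qed
    show ?thesis
      by (rule fubini[symmetric, OF H F compact_uminus_image[OF Lf(1)] z
            haar_parameter_continuous[OF H F compact_uminus_image[OF Lf(1)] z]])
  qed
  also have "\<dots> = (\<integral>w. cnj (f (- w)) * f (- w) \<partial>H)"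
  proof (rule Bochner_Integration.integral_cong[OF refl])
    fix w
    have "continuous_on UNIV (\<lambda>t. \<phi> (- w - t))"
      unfolding diff_conv_add_uminus by (intro c\<phi> continuous_intros)
    from scale[OF this] show "M (\<lambda>t. cnj (f (- w)) * \<phi> (- w - t)) = cnj (f (- w)) * f (- w)"
      by (simp add: fM)
  qed
  also have "\<dots> = (\<integral>w. cnj (f w) * f w \<partial>H)"
    by (rule haar_integral_uminus[OF lc H, of "\<lambda>w. cnj (f w) * f w"])
      (intro Cc_mult(2) f continuous_on_cnj Cc_continuous)
  also have "\<dots> = (\<integral>w. of_real ((norm (f w))\<^sup>2) \<partial>H)"
    by (simp only: complex_norm_square mult.commute)
  also have "\<dots> = of_real (\<integral>w. (norm (f w))\<^sup>2 \<partial>H)"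
    by (rule integral_complex_of_real)
  finally have eq: "M (\<lambda>t. cnj (M (\<lambda>s. correlation H \<phi> (s - t)))) = of_real (\<integral>w. (norm (f w))\<^sup>2 \<partial>H)" .
  have "conv_functional M (tilde_functional M) (correlation H \<phi>) =
      cnj (M (\<lambda>t. cnj (M (\<lambda>s. correlation H \<phi> (s - t)))))"
    by (rule conv_tilde_Cc[OF corr(1)])
  then show ?thesis by (simp only: eq complex_cnj_complex_of_real f_def)
qed

text \<open>
  Cauchy--Schwarz for the convolution \<open>f\<close> of \<open>M\<close> and \<open>\<phi>\<close>, in its linearised form: the square of \<open>norm (f t) - e\<close> is
  nonnegative. The free parameter \<open>e\<close> is later chosen to balance the two terms.
\<close>

lemma fourier_coefficient_bound:
  assumes lc: "locally compact (UNIV :: 'a set)" and H: "haar_measure H"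
    and \<phi>: "\<phi> \<in> Cc" and L: "compact L" "\<And>x. x \<notin> L \<Longrightarrow> \<phi> x = 0" and e: "e > 0"
  shows "norm (fourier H \<phi> \<xi>) * norm (M (\<lambda>s. cnj (char_apply \<xi> s))) \<le>
    norm (conv_functional M (tilde_functional M) (correlation H \<phi>)) / (2 * e) +
    e / 2 * measure H {a + b | a b. a \<in> K \<and> b \<in> L}"
proof -
  define f where "f = conv_functional_fun M \<phi>"
  let ?Z = "{a + b | a b. a \<in> K \<and> b \<in> L}"
  have f: "f \<in> Cc" "\<And>t. t \<notin> ?Z \<Longrightarrow> f t = 0"
    unfolding f_def using convolution_Cc[OF Cc_continuous[OF \<phi>] L] by blast+
  have Z: "?Z \<in> sets H" "emeasure H ?Z < \<infinity>"
    using haar_compact_sets[OF H] haar_compact_finite[OF H] compact_set_plus(1)[OF compact L(1)] by auto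
  have "(\<lambda>t. complex_of_real ((norm (f t))\<^sup>2)) \<in> Cc"
  proof (rule Cc_dominated[OF f(1)])
    show "continuous_on UNIV (\<lambda>t. complex_of_real ((norm (f t))\<^sup>2))"
      by (intro continuous_on_of_real continuous_on_power continuous_on_norm Cc_continuous f(1))
  qed simp
  from integrable_Re[OF haar_integrable[OF H this]] have int2: "integrable H (\<lambda>t. (norm (f t))\<^sup>2)"
    by (simp only: Re_complex_of_real)
  have int1: "integrable H (\<lambda>t. norm (f t))"
    by (intro integrable_norm haar_integrable[OF H f(1)])
  have intZ: "integrable H (\<lambda>t. e / 2 * indicator ?Z t)"
    using Z by (intro integrable_mult_right integrable_real_indicator)
  have int2': "integrable H (\<lambda>t. (norm (f t))\<^sup>2 / (2 * e))"
    using int2 by simp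
  have pointwise: "norm (f t) \<le> (norm (f t))\<^sup>2 / (2 * e) + e / 2 * indicator ?Z t" for t
  proof (cases "t \<in> ?Z")
    case True
    have "0 \<le> (norm (f t) - e)\<^sup>2 / (2 * e)" using e by simp
    also have "\<dots> = (norm (f t))\<^sup>2 / (2 * e) + e / 2 - norm (f t)"
      using e by (simp add: power2_eq_square field_simps)
    finally show ?thesis using True by simp
  next
    case False
    then show ?thesis using f(2)[OF False] by simp
  qed
  have "norm (fourier H \<phi> \<xi>) * norm (M (\<lambda>s. cnj (char_apply \<xi> s))) = norm (fourier H f \<xi>)"
    unfolding f_def fourier_convolution[OF H \<phi>] by (simp add: norm_mult)
  also have "\<dots> \<le> (\<integral>t. norm (f t) \<partial>H)"
    unfolding fourier_def using integral_norm_bound[of H "\<lambda>t. cnj (char_apply \<xi> t) * f t"]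
    by (simp add: norm_mult)
  also have "\<dots> \<le> (\<integral>t. (norm (f t))\<^sup>2 / (2 * e) + e / 2 * indicator ?Z t \<partial>H)"
    using pointwise by (intro integral_mono int1 Bochner_Integration.integrable_add int2' intZ)
  also have "\<dots> = (\<integral>t. (norm (f t))\<^sup>2 \<partial>H) / (2 * e) + e / 2 * measure H ?Z"
    using Z by (subst Bochner_Integration.integral_add[OF int2' intZ]) simp
  also have "(\<integral>t. (norm (f t))\<^sup>2 \<partial>H) = norm (conv_functional M (tilde_functional M) (correlation H \<phi>))"
    unfolding conv_tilde_correlation[OF lc H \<phi>] f_def[symmetric] by simp
  finally show ?thesis .
qed

end

section \<open>Van Hove boundaries\<close>

text \<open>
  This makes the van Hove boundary a Borel set, so that its measure is meaningful.
\<close>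

lemma closed_minus_compact:
  fixes D L :: "'a::topological_ab_group_add set"
  assumes D: "closed D" and L: "compact L"
  shows "closed {b - k | b k. b \<in> D \<and> k \<in> L}"
proof -
  let ?E = "{b - k | b k. b \<in> D \<and> k \<in> L}"
  have "\<exists>U. open U \<and> x \<in> U \<and> U \<subseteq> - ?E" if x: "x \<notin> ?E" for x
  proof -
    have op: "open {p. fst p + snd p \<in> - D}"
      using open_vimage[of "- D" "\<lambda>p::'a \<times> 'a. fst p + snd p"] D
      by (simp add: vimage_def open_Compl continuous_on_add continuous_on_fst continuous_on_snd)
    have "\<exists>U V. open U \<and> open V \<and> x \<in> U \<and> k \<in> V \<and> (\<forall>y\<in>U. \<forall>j\<in>V. y + j \<notin> D)" if k: "k \<in> L" for k
    proof -
      have "x + k \<notin> D"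
      proof
        assume "x + k \<in> D"
        moreover have "x = (x + k) - k" by simp
        ultimately show False using x k by blast
      qed
      then have "(x, k) \<in> {p. fst p + snd p \<in> - D}" by simp
      from open_prod_elim[OF op this] obtain U V where
        "open U" "open V" "(x, k) \<in> U \<times> V" "U \<times> V \<subseteq> {p. fst p + snd p \<in> - D}" by blast
      then show ?thesis by (intro exI[of _ U] exI[of _ V]) auto
    qed
    then obtain U V where UV: "\<And>k. k \<in> L \<Longrightarrow> open (U k) \<and> open (V k) \<and> x \<in> U k \<and> k \<in> V k \<and> (\<forall>y\<in>U k. \<forall>j\<in>V k. y + j \<notin> D)"
      by metis
    have "\<exists>T\<subseteq>L. finite T \<and> L \<subseteq> (\<Union>k\<in>T. V k)"
      by (rule compactE_image[OF L, of L V]) (use UV in blast)+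
    then obtain T where T: "T \<subseteq> L" "finite T" "L \<subseteq> (\<Union>k\<in>T. V k)" by blast
    show ?thesis
    proof (intro exI conjI)
      show "open (\<Inter>k\<in>T. U k)" using T UV by (intro open_INT) auto
      show "x \<in> (\<Inter>k\<in>T. U k)" using T UV by blast
      show "(\<Inter>k\<in>T. U k) \<subseteq> - ?E"
      proof
        fix y assume y: "y \<in> (\<Inter>k\<in>T. U k)"
        show "y \<in> - ?E"
        proof
          assume "y \<in> ?E"
          then obtain b j where bj: "y = b - j" "b \<in> D" "j \<in> L" by blast
          then obtain k where k: "k \<in> T" "j \<in> V k" using T(3) by blast
          then have "y + j \<notin> D" using y UV T(1) by blast
          then show False using bj by simp
        qed
      qed
    qed
  qed
  then have "open (- ?E)" by (intro iffD2[OF open_subopen] ballI) simp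
  then show ?thesis by (simp add: closed_def)
qed

text \<open>
  The sumset lies in the closure of \<open>A + L\<close>, and what exceeds \<open>A\<close> there belongs to the van Hove boundary.
\<close>

lemma van_hove_sumset_bound:
  fixes H :: "'a::{topological_ab_group_add,t2_space} measure"
  assumes H: "haar_measure H" and A: "open A" "compact (closure A)" and L: "compact L"
  shows "measure H {a + b | a b. a \<in> closure A \<and> b \<in> L} \<le> measure H A + measure H (van_hove_boundary L A)"
proof -
  let ?Z = "{a + b | a b. a \<in> closure A \<and> b \<in> L}"
  let ?Y = "closure {a + k | a k. a \<in> A \<and> k \<in> L}"
  have ZY: "?Z \<subseteq> ?Y"
  proof
    fix z assume "z \<in> ?Z"
    then obtain a b where ab: "z = a + b" "a \<in> closure A" "b \<in> L" by blast
    have "(\<lambda>x. x + b) ` closure A \<subseteq> ?Y"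
    proof (rule image_closure_subset)
      show "continuous_on (closure A) (\<lambda>x. x + b)" by (intro continuous_intros)
      show "(\<lambda>x. x + b) ` A \<subseteq> ?Y" using ab(3) closure_subset by fastforce
    qed simp
    then show "z \<in> ?Y" using ab by blast
  qed
  have cZ: "compact ?Z" by (rule compact_set_plus(1)[OF A(2) L])
  have YZ: "?Y \<subseteq> ?Z"
    using closure_subset[of A] by (intro closure_minimal compact_imp_closed[OF cZ]) blast
  have fin: "emeasure H ?Z < \<infinity>" "emeasure H (closure A) < \<infinity>"
    using haar_compact_finite[OF H] cZ A(2) by auto
  have E: "{b - k | b k. b \<in> - A \<and> k \<in> L} \<inter> closure A \<in> sets H"
    using closed_minus_compact[of "- A" L] A(1) L haar_sets[OF H] by (auto intro!: borel_closed closed_Int)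
  have Bs: "van_hove_boundary L A \<in> sets H"
    unfolding van_hove_boundary_def using E A(1) haar_sets[OF H] by (intro sets.Un sets.Diff) auto
  have As: "A \<in> sets H" using A(1) haar_sets[OF H] by simp
  have clA: "closure A \<in> sets H" "?Z \<in> sets H"
    using haar_compact_sets[OF H] A(2) cZ by auto
  have "van_hove_boundary L A \<subseteq> ?Z \<union> closure A"
    unfolding van_hove_boundary_def using YZ by blast
  then have "emeasure H (van_hove_boundary L A) \<le> emeasure H (?Z \<union> closure A)"
    using clA by (intro emeasure_mono) auto
  also have "\<dots> \<le> emeasure H ?Z + emeasure H (closure A)"
    using clA by (intro emeasure_subadditive)
  also have "\<dots> < \<infinity>" using fin by simp
  finally have Bf: "emeasure H (van_hove_boundary L A) < \<infinity>" .
  have Af: "emeasure H A < \<infinity>"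
    using emeasure_mono[OF closure_subset clA(1)] fin(2) by (rule le_less_trans)
  have "?Z \<subseteq> A \<union> van_hove_boundary L A"
    unfolding van_hove_boundary_def using ZY by blast
  then have "measure H ?Z \<le> measure H (A \<union> van_hove_boundary L A)"
    using As Bs Af Bf clA
    by (intro measure_mono_fmeasurable fmeasurable.Un fmeasurableI) auto
  also have "\<dots> \<le> measure H A + measure H (van_hove_boundary L A)"
    using As Bs Af Bf by (intro measure_Un_le)
  finally show ?thesis .
qed

section \<open>Damped test functions and the theorem\<close>

primrec damped :: "'a::topological_ab_group_add dual \<Rightarrow> ('a \<Rightarrow> complex) \<Rightarrow> 'a list \<Rightarrow> 'a \<Rightarrow> complex" where
  "damped \<xi> \<phi> [] = \<phi>"
| "damped \<xi> \<phi> (s # l) = (\<lambda>t. (damped \<xi> \<phi> l t + char_apply \<xi> s * damped \<xi> \<phi> l (t - s)) / 2)"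

lemma Cc_translate:
  fixes \<phi> :: "'a::{topological_ab_group_add,t2_space} \<Rightarrow> complex"
  assumes "\<phi> \<in> Cc"
  shows "(\<lambda>t. \<phi> (t - s)) \<in> Cc"
proof -
  obtain L where L: "compact L" "\<And>x. x \<notin> L \<Longrightarrow> \<phi> x = 0" using CcE[OF assms] by metis
  show ?thesis
  proof (rule CcI[OF _ compact_set_plus(1)[OF L(1) compact_sing[of s]]])
    show "continuous_on UNIV (\<lambda>t. \<phi> (t - s))"
      unfolding diff_conv_add_uminus
      by (intro continuous_on_compose2[OF Cc_continuous[OF assms] _ subset_UNIV] continuous_intros)
    show "\<phi> (t - s) = 0" if "t \<notin> {a + b | a b. a \<in> L \<and> b \<in> {s}}" for t
    proof (rule L(2), rule notI)
      assume "t - s \<in> L"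
      moreover have "t = (t - s) + s" by simp
      ultimately show False using that by blast
    qed
  qed
qed

lemma damped_Cc:
  fixes \<phi> :: "'a::{topological_ab_group_add,t2_space} \<Rightarrow> complex"
  assumes \<phi>: "\<phi> \<in> Cc"
  shows "damped \<xi> \<phi> l \<in> Cc"
proof (induction l)
  case (Cons s l)
  have "(\<lambda>t. (1/2) * (damped \<xi> \<phi> l t + char_apply \<xi> s * damped \<xi> \<phi> l (t - s))) \<in> Cc"
    by (intro Cc_scale Cc_add Cons Cc_translate)
  then show ?case by simp
qed (simp add: \<phi>)

lemma fourier_damped_Cons:
  fixes \<phi> :: "'a::{topological_ab_group_add,t2_space} \<Rightarrow> complex"
  assumes H: "haar_measure H" and \<phi>: "\<phi> \<in> Cc"
  shows "fourier H (damped \<xi> \<phi> (s # l)) \<eta> =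
     (1 + char_apply \<xi> s * cnj (char_apply \<eta> s)) / 2 * fourier H (damped \<xi> \<phi> l) \<eta>"
proof -
  let ?g = "damped \<xi> \<phi> l"
  have g: "?g \<in> Cc" by (rule damped_Cc[OF \<phi>])
  have c\<eta>: "continuous_on UNIV (\<lambda>t. cnj (char_apply \<eta> t))" by (intro continuous_on_cnj char_continuous)
  have i1: "integrable H (\<lambda>t. cnj (char_apply \<eta> t) * ?g t)"
    by (intro haar_integrable[OF H] Cc_mult(2) g c\<eta>)
  have i2: "integrable H (\<lambda>t. cnj (char_apply \<eta> t) * ?g (t - s))"
    by (intro haar_integrable[OF H] Cc_mult(2) Cc_translate g c\<eta>)
  have "continuous_on UNIV (\<lambda>t. cnj (char_apply \<eta> t) * ?g (t - s))"
    by (intro Cc_continuous Cc_mult(2) Cc_translate g c\<eta>)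
  from haar_integral_translate[OF H this, of s]
  have "(\<integral>t. cnj (char_apply \<eta> t) * ?g (t - s) \<partial>H) = (\<integral>t. cnj (char_apply \<eta> s) * (cnj (char_apply \<eta> t) * ?g t) \<partial>H)"
    by (simp add: char_add mult_ac)
  then have 2: "(\<integral>t. cnj (char_apply \<eta> t) * ?g (t - s) \<partial>H) = cnj (char_apply \<eta> s) * fourier H ?g \<eta>"
    by (simp add: fourier_def)
  have "fourier H (damped \<xi> \<phi> (s # l)) \<eta> =
     (\<integral>t. (1/2) * (cnj (char_apply \<eta> t) * ?g t) + (char_apply \<xi> s / 2) * (cnj (char_apply \<eta> t) * ?g (t - s)) \<partial>H)"
    unfolding fourier_def by (intro Bochner_Integration.integral_cong refl) (simp add: field_simps)
  also have "\<dots> = (1/2) * fourier H ?g \<eta> + (char_apply \<xi> s / 2) * (cnj (char_apply \<eta> s) * fourier H ?g \<eta>)"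
    using i1 i2 by (simp add: 2 fourier_def)
  finally show ?thesis by (simp add: field_simps)
qed

text \<open>
  The damping factors come from averaging test functions with their translates, so damped integrals of
  \<open>\<bar>\<phi>\<^sup>\<and>\<bar>\<^sup>2\<close> are again of the form that the Fourier transform of \<open>\<gamma>\<close> evaluates.
\<close>

lemma fourier_damped:
  fixes \<phi> :: "'a::{topological_ab_group_add,t2_space} \<Rightarrow> complex"
  assumes H: "haar_measure H" and \<phi>: "\<phi> \<in> Cc"
  shows "(norm (fourier H (damped \<xi> \<phi> l) \<eta>))\<^sup>2 = damping \<xi> l \<eta> * (norm (fourier H \<phi> \<eta>))\<^sup>2"
    and "fourier H (damped \<xi> \<phi> l) \<xi> = fourier H \<phi> \<xi>"
proof -
  show "(norm (fourier H (damped \<xi> \<phi> l) \<eta>))\<^sup>2 = damping \<xi> l \<eta> * (norm (fourier H \<phi> \<eta>))\<^sup>2"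
  proof (induction l)
    case (Cons s l)
    then show ?case
      unfolding fourier_damped_Cons[OF H \<phi>] norm_mult power_mult_distrib by (simp only: damping_def list.map prod_list.Cons mult.assoc)
  qed simp
  show "fourier H (damped \<xi> \<phi> l) \<xi> = fourier H \<phi> \<xi>"
  proof (induction l)
    case (Cons s l)
    then show ?case unfolding fourier_damped_Cons[OF H \<phi>] by (simp add: char_mult_cnj)
  qed simp
qed

lemma eventually_in_net:
  assumes "directed_index_set I le"
  shows "eventually (\<lambda>i. i \<in> I) (net_filter I le)"
proof -
  obtain i where i: "i \<in> I" using assms by (auto simp: directed_index_set_def)
  have "net_filter I le \<le> principal {j \<in> I. le i j}"
    unfolding net_filter_def by (rule INF_lower[OF i])
  then have "eventually (\<lambda>j. j \<in> {j \<in> I. le i j}) (net_filter I le)"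
    by (simp add: le_principal)
  then show ?thesis by (rule eventually_mono) simp
qed

theorem corollary7p5:
  fixes H :: "'a::{topological_ab_group_add, t2_space} measure"
    and I :: "'i set" and le :: "'i \<Rightarrow> 'i \<Rightarrow> bool" and A :: "'i \<Rightarrow> 'a set"
    and \<mu> \<gamma> :: "('a \<Rightarrow> complex) \<Rightarrow> complex"
    and \<gamma>_hat :: "('a dual \<Rightarrow> complex) \<Rightarrow> complex"
    and \<xi> :: "'a dual"
  assumes "locally compact (UNIV :: 'a set)"
    and "haar_measure H"
    and "van_hove_net H I le A"
    and "radon_functional \<mu>"
    and "translation_bounded \<mu>"
    and "is_autocorrelation H I le A \<mu> \<gamma>"
    and "is_fourier_transform H \<gamma> \<gamma>_hat"
    and "\<not> ((\<lambda>i. of_real (1 / measure H (A i)) *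
              radon_integral \<mu> (\<lambda>t. indicator (A i) t * cnj (char_apply \<xi> t)))
            \<longlongrightarrow> 0) (net_filter I le)"
  shows "measure_of_set \<gamma>_hat {\<xi>} \<noteq> 0"
proof
  assume null: "measure_of_set \<gamma>_hat {\<xi>} = 0"
  note lc = assms(1) and H = assms(2) and \<mu> = assms(4)
  let ?F = "net_filter I le"
  have ft: "radon_functional \<gamma>_hat" "positive_functional \<gamma>_hat"
    "\<And>\<phi>. \<phi> \<in> Cc \<Longrightarrow> radon_has_integral \<gamma>_hat (\<lambda>\<eta>. of_real ((norm (fourier H \<phi> \<eta>))\<^sup>2))
        (conv_fun H (conv_functional_fun \<gamma> \<phi>) (tilde_fun \<phi>) 0)"
    using assms(7) unfolding is_fourier_transform_def by blast+
  have \<gamma>: "radon_functional \<gamma>"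
    and auto: "\<And>\<phi>. \<phi> \<in> Cc \<Longrightarrow> ((\<lambda>i. of_real (1 / measure H (A i)) *
          conv_functional (restrict_functional \<mu> (A i))
            (tilde_functional (restrict_functional \<mu> (A i))) \<phi>) \<longlongrightarrow> \<gamma> \<phi>) ?F"
    using assms(6) unfolding is_autocorrelation_def by blast+
  have dir: "directed_index_set I le"
    and Ai: "\<And>i. i \<in> I \<Longrightarrow> open (A i) \<and> compact (closure (A i)) \<and> 0 < emeasure H (A i)"
    and vH: "\<And>K. compact K \<Longrightarrow> ((\<lambda>i. measure H (van_hove_boundary K (A i)) / measure H (A i)) \<longlongrightarrow> 0) ?F"
    using assms(3) unfolding van_hove_net_def by blast+
  obtain b :: "'a \<Rightarrow> complex" where b: "b \<in> Cc" "(\<integral>x. b x \<partial>H) \<noteq> 0"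
    by (rule haar_bump[OF lc H])
  \<comment> \<open>The Fourier transform of this test function does not vanish at the given character.\<close>
  define \<phi> where "\<phi> t = char_apply \<xi> t * b t" for t
  have \<phi>: "\<phi> \<in> Cc" unfolding \<phi>_def[abs_def] by (intro Cc_mult(2) b(1) char_continuous)
  have "cnj (char_apply \<xi> t) * \<phi> t = b t" for t
    using char_mult_cnj[of \<xi> t] by (simp add: \<phi>_def mult_ac flip: mult.assoc)
  then have "fourier H \<phi> \<xi> \<noteq> 0" using b(2) by (simp add: fourier_def)
  define \<kappa> where "\<kappa> = norm (fourier H \<phi> \<xi>)"
  have \<kappa>: "\<kappa> > 0" using \<open>fourier H \<phi> \<xi> \<noteq> 0\<close> by (simp add: \<kappa>_def)
  have "((\<lambda>i. of_real (1 / measure H (A i)) *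
              radon_integral \<mu> (\<lambda>t. indicator (A i) t * cnj (char_apply \<xi> t))) \<longlongrightarrow> 0) ?F"
  proof (rule tendstoI)
    fix r :: real assume r: "r > 0"
    \<comment> \<open>With this e the final estimate reads \<kappa> |a| < 2 e = \<kappa> r for the average a.\<close>
    define e where "e = r * \<kappa> / 2"
    have e: "e > 0" using r \<kappa> by (simp add: e_def)
    have "radon_has_integral \<gamma>_hat (\<lambda>\<eta>. of_real (damping \<xi> l \<eta>) * of_real ((norm (fourier H \<phi> \<eta>))\<^sup>2))
        (\<gamma> (correlation H (damped \<xi> \<phi> l)))" for l
      using ft(3)[OF damped_Cc[OF \<phi>, of \<xi> l]]
      unfolding radon_apply_correlation[OF H \<gamma> damped_Cc[OF \<phi>]] fourier_damped(1)[OF H \<phi>] of_real_mult .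
    moreover have "0 < e\<^sup>2 / 2" using e by simp
    ultimately obtain l where l: "norm (\<gamma> (correlation H (damped \<xi> \<phi> l))) \<le> e\<^sup>2 / 2"
      by (rule damped_integral_null[OF ft(1,2) null])
    define g where "g = damped \<xi> \<phi> l"
    have g: "g \<in> Cc" unfolding g_def by (rule damped_Cc[OF \<phi>])
    obtain L where L: "compact L" "\<And>x. x \<notin> L \<Longrightarrow> g x = 0" using CcE[OF g] by metis
    define Y where "Y i = of_real (1 / measure H (A i)) * conv_functional (restrict_functional \<mu> (A i))
            (tilde_functional (restrict_functional \<mu> (A i))) (correlation H g)" for i
    have "(Y \<longlongrightarrow> \<gamma> (correlation H g)) ?F"
      unfolding Y_def[abs_def] by (rule auto[OF correlation_Cc(1)[OF H Cc_continuous[OF g] L]])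
    then have "eventually (\<lambda>i. dist (Y i) (\<gamma> (correlation H g)) < e\<^sup>2 / 2) ?F"
      using e by (intro tendstoD) auto
    moreover have "eventually (\<lambda>i. dist (measure H (van_hove_boundary L (A i)) / measure H (A i)) 0 < 1) ?F"
      by (intro tendstoD[OF vH[OF L(1)]]) simp
    moreover have "eventually (\<lambda>i. i \<in> I) ?F" by (rule eventually_in_net[OF dir])
    ultimately show "eventually (\<lambda>i. dist (of_real (1 / measure H (A i)) *
              radon_integral \<mu> (\<lambda>t. indicator (A i) t * cnj (char_apply \<xi> t))) 0 < r) ?F"
    proof eventually_elim
      case (elim i)
      have i: "open (A i)" "compact (closure (A i))" "0 < emeasure H (A i)" using Ai[OF elim(3)] by auto
      let ?M = "restrict_functional \<mu> (A i)"
      define m where "m = measure H (A i)"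
      have "emeasure H (A i) < \<infinity>"
        using emeasure_mono[OF closure_subset haar_compact_sets[OF H i(2)]] haar_compact_finite[OF H i(2)]
        by (rule le_less_trans)
      then have m: "m > 0" using i(3) by (simp add: m_def measure_def enn2real_positive_iff)
      obtain C where C: "C > 0" "\<forall>b B. continuous_on UNIV b \<longrightarrow> (\<forall>x\<in>closure (A i). norm (b x) \<le> B) \<longrightarrow> 0 \<le> B \<longrightarrow>
          norm (?M b) \<le> C * B"
        using restrict_functional_bound[OF \<mu> i(1,2)] by blast
      interpret M: compactly_carried ?M "closure (A i)" C
        by unfold_locales
          (use restrict_functional_add[OF \<mu> i(1,2)] restrict_functional_scale[OF \<mu> i(1,2)] i(2) C in auto)
      have "\<kappa> * norm (?M (\<lambda>s. cnj (char_apply \<xi> s))) \<le>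
          norm (conv_functional ?M (tilde_functional ?M) (correlation H g)) / (2 * e) +
          e / 2 * measure H {a + b | a b. a \<in> closure (A i) \<and> b \<in> L}"
        using M.fourier_coefficient_bound[OF lc H g L e, of \<xi>]
        unfolding g_def fourier_damped(2)[OF H \<phi>] \<kappa>_def .
      also have "norm (conv_functional ?M (tilde_functional ?M) (correlation H g)) = m * norm (Y i)"
        using m by (simp add: Y_def m_def norm_mult norm_divide)
      also have "norm (Y i) < e\<^sup>2"
        using elim(1) l norm_triangle_ineq2[of "Y i" "\<gamma> (correlation H g)"] by (simp add: dist_norm g_def)
      \<comment> \<open>Eventually the boundary has at most the measure of the set itself.\<close>
      also have "measure H {a + b | a b. a \<in> closure (A i) \<and> b \<in> L} \<le> m + m"
      proof -
        have "measure H (van_hove_boundary L (A i)) \<le> m"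
          using elim(2) m by (simp add: m_def divide_simps)
        then show ?thesis
          using van_hove_sumset_bound[OF H i(1,2) L(1)] by (simp add: m_def)
      qed
      finally have "\<kappa> * norm (?M (\<lambda>s. cnj (char_apply \<xi> s))) < m * e\<^sup>2 / (2 * e) + e / 2 * (m + m)"
        using m e by (simp add: divide_strict_right_mono)
      also have "\<dots> \<le> 2 * e * m" using e m by (simp add: power2_eq_square field_simps)
      also have "\<dots> = \<kappa> * (r * m)" by (simp add: e_def)
      finally have "norm (?M (\<lambda>s. cnj (char_apply \<xi> s))) < r * m" using \<kappa> by simp
      then show ?case
        using m unfolding restrict_functional_def m_def[symmetric]
        by (simp add: norm_mult norm_divide divide_simps)
    qed
  qed
  then show False using assms(8) by blast
qed

end
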